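(* Let $Z_1,Z_2,\dots$ be independent and identically distributed real-valued random variables, let $\Delta_1,\Delta_2,\dots$ be independent random variables with values in $(-1,\infty)$, and let the two sequences be mutually independent. Let $\delta_i>0$ and $\pi_i\in[0,1)$ be constants for $i\ge1$. For $u\ge0$ set $U_0=u$ and $$U_i=\bigl[(1-\pi_i)(1+\delta_i)+\pi_i(1+\Delta_i)\bigr]U_{i-1}+Z_i,\qquad i=1,2,\dots,$$ and for $n\ge 1$ define $$\psi(u;n)=\mathbf P\Bigl\{\min_{0\le i\le n}U_i<0\,\Big|\,U_0=u\Bigr\}.$$ Let $F$ be the common distribution function of $-Z_i$, $i\ge1$, and put $$\Upsilon_i=\frac1{1+\Delta_i},\qquad \hat s_i=\frac1{(1-\pi_i)(1+\delta_i)},\qquad u_k=u\prod_{i=1}^k\frac1{\hat s_i}.$$ Let $n\ge1$. If $F\in\mathcal S\cap\mathrm{MDA}(\Lambda,w)$ and for each $1\le i\le n$ the tail probability $\mathbf P\{\Upsilon_i>u\}$ is regularly varying at infinity (in $u$) with index $-\alpha_i$ for some $\alpha_i\in[0,\infty)$, then $$\psi(u;n)\sim\sum_{k=1}^n\overline F(u_k)\prod_{i=1}^k\left[\frac{\Gamma(\alpha_i+1)}{(\pi_i\hat s_i)^{\alpha_i}}\,\mathbf P\{\Upsilon_i>u_kw(u_k)\}\right],\qquad u\to\infty .$$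
   Context: $\overline F=1-F$, $r_F=\sup\{x:F(x)<1\}$, and $\Gamma(\cdot)$ is the Euler gamma function. $a(u)\sim b(u)$ means $a(u)/b(u)\to1$. Here $U_i$ is the insurer's wealth at time $i$, $Z_i$ the net profit in period $i$, $\delta_i$ the risk-free interest rate, $\Delta_i$ the return rate of the risky stock, $\pi_i$ the fraction of wealth invested in the stock at the beginning of period $i$ (the rest being kept in the risk-free bond), and $\psi(u;n)$ is the probability of ruin by time $n$. $F\in\mathcal S$ (subexponential, possibly two-sided, $r_F=\infty$) means that $F_+\in\mathcal S_+$, where $F_+(x)=0$ for $x<0$ and $F_+(x)=F(x)$ for $x\ge0$; and a distribution function $K$ with $K(0-)=0$, $r_K=\infty$ is in $\mathcal S_+$ if $\lim_{x\to\infty}\overline{K^{2*}}(x)/\overline K(x)=2$, with $K^{2*}$ the convolution square of $K$. $F\in\mathrm{MDA}(\Lambda,w)$ (Gumbel max-domain of attraction with scaling function $w$; here $r_F=\infty$) means that $w$ is a positive function with $\lim_{x\to\infty}\overline F(x+y/w(x))/\overline F(x)=e^{-y}$ for all $y\in\mathbb R$ and $\lim_{x\to\infty}x\,w(x)=\infty$.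
   Formalization: The formal theorem assumes π_i > 0 for 1 ≤ i ≤ n: at π_i = 0 the factor (π_i ŝ_i)^{-α_i} is undefined for α_i > 0, and for α_i = 0 (with 0^0 = 1) the claim fails already for n = 1. *)

theory Defs
  imports "HOL-Probability.Probability" "HOL-Library.Landau_Symbols"
begin

definition distribution_function :: "(real \<Rightarrow> real) \<Rightarrow> bool" where
  "distribution_function F \<longleftrightarrow>
     mono F \<and> (\<forall>x. continuous (at_right x) F) \<and>
     (F \<longlongrightarrow> 0) at_bot \<and> (F \<longlongrightarrow> 1) at_top"

definition tail :: "(real \<Rightarrow> real) \<Rightarrow> real \<Rightarrow> real" where
  "tail F x = 1 - F x"

definition right_endpoint :: "(real \<Rightarrow> real) \<Rightarrow> ereal" where
  "right_endpoint F = (SUP x \<in> {x. F x < 1}. ereal x)"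

definition conv_square :: "(real \<Rightarrow> real) \<Rightarrow> real \<Rightarrow> real" where
  "conv_square K = cdf (interval_measure K \<star> interval_measure K)"

text \<open>
  The class S+ of subexponential distribution functions on the half-line
  (an atom at 0 is allowed; the left limit at 0 vanishes).
\<close>

definition subexponential_nonneg :: "(real \<Rightarrow> real) \<Rightarrow> bool" where
  "subexponential_nonneg K \<longleftrightarrow>
     distribution_function K \<and> (K \<longlongrightarrow> 0) (at_left 0) \<and> right_endpoint K = \<infinity> \<and>
     ((\<lambda>x. tail (conv_square K) x / tail K x) \<longlongrightarrow> 2) at_top"

definition positive_part_df :: "(real \<Rightarrow> real) \<Rightarrow> real \<Rightarrow> real" where
  "positive_part_df F x = (if x < 0 then 0 else F x)"

definition subexponential :: "(real \<Rightarrow> real) \<Rightarrow> bool" where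
  "subexponential F \<longleftrightarrow>
     distribution_function F \<and> right_endpoint F = \<infinity> \<and> subexponential_nonneg (positive_part_df F)"

text \<open>Gumbel max-domain of attraction, in the case of an infinite right endpoint.\<close>

definition MDA_Gumbel :: "(real \<Rightarrow> real) \<Rightarrow> (real \<Rightarrow> real) \<Rightarrow> bool" where
  "MDA_Gumbel F w \<longleftrightarrow>
     distribution_function F \<and> right_endpoint F = \<infinity> \<and> (\<forall>x. w x > 0) \<and>
     (\<forall>y. ((\<lambda>x. tail F (x + y / w x) / tail F x) \<longlongrightarrow> exp (- y)) at_top) \<and>
     filterlim (\<lambda>x. x * w x) at_top at_top"

text \<open>Regular variation at infinity, with index \<open>\<rho>\<close>, in the sense of Karamata.\<close>

definition regularly_varying :: "(real \<Rightarrow> real) \<Rightarrow> real \<Rightarrow> bool" where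
  "regularly_varying f \<rho> \<longleftrightarrow>
     (\<exists>x0. (\<forall>x\<ge>x0. f x > 0) \<and> f \<in> borel_measurable (restrict_space borel {x0..})) \<and>
     (\<forall>t>0. ((\<lambda>x. f (t * x) / f x) \<longlongrightarrow> t powr \<rho>) at_top)"

primrec wealth ::
  "(nat \<Rightarrow> real) \<Rightarrow> (nat \<Rightarrow> real) \<Rightarrow> (nat \<Rightarrow> 'a \<Rightarrow> real) \<Rightarrow> (nat \<Rightarrow> 'a \<Rightarrow> real) \<Rightarrow>
   real \<Rightarrow> nat \<Rightarrow> 'a \<Rightarrow> real" where
  "wealth \<delta> \<pi> \<Delta> Z u 0 \<omega> = u"
| "wealth \<delta> \<pi> \<Delta> Z u (Suc i) \<omega> =
     ((1 - \<pi> (Suc i)) * (1 + \<delta> (Suc i)) + \<pi> (Suc i) * (1 + \<Delta> (Suc i) \<omega>)) * wealth \<delta> \<pi> \<Delta> Z u i \<omega>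
     + Z (Suc i) \<omega>"

text \<open>
  Since the initial wealth is the constant \<open>u\<close>, conditioning on it amounts to using it
  as the initial value of the recursion.
\<close>

definition ruin_prob ::
  "'a measure \<Rightarrow> (nat \<Rightarrow> real) \<Rightarrow> (nat \<Rightarrow> real) \<Rightarrow> (nat \<Rightarrow> 'a \<Rightarrow> real) \<Rightarrow> (nat \<Rightarrow> 'a \<Rightarrow> real) \<Rightarrow>
   real \<Rightarrow> nat \<Rightarrow> real" where
  "ruin_prob M \<delta> \<pi> \<Delta> Z u n = \<P>(\<omega> in M. Min ((\<lambda>i. wealth \<delta> \<pi> \<Delta> Z u i \<omega>) ` {0..n}) < 0)"

definition inverse_return :: "(nat \<Rightarrow> 'a \<Rightarrow> real) \<Rightarrow> nat \<Rightarrow> 'a \<Rightarrow> real" where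
  "inverse_return \<Delta> i \<omega> = 1 / (1 + \<Delta> i \<omega>)"

definition bond_discount :: "(nat \<Rightarrow> real) \<Rightarrow> (nat \<Rightarrow> real) \<Rightarrow> nat \<Rightarrow> real" where
  "bond_discount \<delta> \<pi> i = 1 / ((1 - \<pi> i) * (1 + \<delta> i))"

definition bond_value :: "(nat \<Rightarrow> real) \<Rightarrow> (nat \<Rightarrow> real) \<Rightarrow> real \<Rightarrow> nat \<Rightarrow> real" where
  "bond_value \<delta> \<pi> u k = u * (\<Prod>i=1..k. 1 / bond_discount \<delta> \<pi> i)"

end

theory Submission
  imports Defs
begin

text \<open>
Write $X_i = -Z_i$ for the net losses and $R_i = a_i + \pi_i(1+\Delta_i)$, $a_i = 1/\hat s_i$, for the growth
factor of the portfolio in period $i$. Discounting with $\theta_k = \prod_{i\le k} 1/R_i$ turns ruin by time $n$ into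
the event that one of the sums $\sum_{i\le k}\theta_i X_i$, $k \le n$, exceeds $u$. The proof has two independent halves.

One big jump. The weights $\theta_i$ are bounded and independent of the claims. Subexponentiality says
that a sum of claims becomes large through a single claim, and this holds uniformly over bounded weights
(lemma \<open>weighted_sum_bound\<close>): if no single weighted claim nearly reaches the level, two of
the unweighted claims must be large while the unweighted sum passes the level. The weights no longer occur in this event,
and its probability is at most a small multiple of $\overline F$. Conditioning on the returns gives
$\psi(u;n) \sim \sum_{k\le n} P(\theta_k X_k > u)$ (theorem \<open>crossing_prob_asymptotics\<close>),
provided that each summand is insensitive to bounded shifts of $u$.

One claim. With $W_i = \pi_i \hat s_i/\Upsilon_i$ one has $u/\theta_k = u_k\prod_{i\le k}(1+W_i)$, so that
$P(\theta_k X_k > u) = E\,\overline F(u_k\prod_{i\le k}(1+W_i))$. Put $q = x\,w(x)$. The Gumbel condition gives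
$\overline F(x(1+W)) \approx \overline F(x)\,e^{-qW}$, and as $P(W < 1/q)$ varies regularly, the Laplace transform satisfies
$E e^{-qW} \sim \Gamma(\alpha+1)\,P(W < 1/q)$. The approximation has to hold in the mean, where
large values of $qW$ matter; it does because a Gumbel tail decays faster than any power of $s$ at $x + s/w(x)$,
uniformly in $x$ (lemmas \<open>gumbel_tail_uniform\<close>, \<open>dilate_asymptotics\<close>). The averaged
tail $E\,\overline F(x(1+W))$ satisfies the Gumbel condition with the same $w$ (lemma \<open>gumbel_tail_dilate\<close>), so that
the factors $1+W_1, \dots, 1+W_k$ can be treated one after another, each contributing
$\Gamma(\alpha_i+1)\,P(W_i < 1/q) \sim \Gamma(\alpha_i+1)(\pi_i\hat s_i)^{-\alpha_i}P(\Upsilon_i > q)$.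

Subexponentiality enters a second time: it makes $\overline F$ long-tailed, which forces $w(x) \to 0$, and
then every averaged tail is insensitive to bounded shifts. This is what the first half asks for.
\<close>

section \<open>Monotone regularly varying tails\<close>

text \<open>
Positivity at every argument costs nothing for a monotone function that is eventually positive,
and it removes all case distinctions from quotients.
\<close>
definition regular_tail :: "(real \<Rightarrow> real) \<Rightarrow> real \<Rightarrow> bool" where
  "regular_tail g \<alpha> \<longleftrightarrow> antimono g \<and> (\<forall>x. 0 < g x \<and> g x \<le> 1) \<and>
     (\<forall>t>0. ((\<lambda>x. g (t * x) / g x) \<longlongrightarrow> t powr (- \<alpha>)) at_top)"

lemma regular_tailD:
  assumes "regular_tail g \<alpha>"
  shows "x \<le> y \<Longrightarrow> g y \<le> g x" "0 < g x" "g x \<le> 1"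
    "t > 0 \<Longrightarrow> ((\<lambda>x. g (t * x) / g x) \<longlongrightarrow> t powr (- \<alpha>)) at_top"
  using assms by (auto simp: regular_tail_def antimono_def)

text \<open>
A bound of Potter type. Halving the argument multiplies $g$ by at most $2^b$ as long as the
argument is large, because the limiting factor is $2^\alpha < 2^b$. Once repeated halving has brought
the argument below the threshold, the trivial bound $g \le 1$ takes over, and the constant pays for it.
The bound holds for every $s > 0$ and so provides integrable majorants on the whole half-line.
\<close>
lemma regular_tail_potter:
  assumes g: "regular_tail g \<alpha>" and b: "\<alpha> < real b"
  obtains C x0 where "C \<ge> 1" "x0 > 0" "\<And>x s. x \<ge> x0 \<Longrightarrow> s > 0 \<Longrightarrow> g (x / s) \<le> C * (1 + s) ^ b * g x"
proof -
  have "((\<lambda>x. g ((1/2) * x) / g x) \<longlongrightarrow> (1/2) powr (- \<alpha>)) at_top"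
    using regular_tailD(4)[OF g, of "1/2"] by simp
  moreover have "(1/2::real) powr (- \<alpha>) < 2 ^ b"
    using b by (simp add: powr_minus powr_divide powr_realpow[symmetric] del: powr_realpow) 
  ultimately have "eventually (\<lambda>x. g ((1/2) * x) / g x < 2 ^ b) at_top"
    by (rule order_tendstoD(2))
  then obtain x1 where "\<And>x. x \<ge> x1 \<Longrightarrow> g ((1/2) * x) / g x < 2 ^ b"
    by (auto simp: eventually_at_top_linorder)
  then have half: "g (x / 2) \<le> 2 ^ b * g x" if "x \<ge> x1" for x
    using that regular_tailD(2)[OF g, of x] by (force simp: field_simps)
  define x0 where "x0 = max 1 x1"
  \<comment> \<open>an argument that one halving would take below \<open>x0\<close> is less than \<open>2 * x0\<close>, so that \<open>g\<close> is at least \<open>1 / D\<close> there\<close>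
  define D where "D = 1 / g (2 * x0)"
  have D: "D \<ge> 1" using regular_tailD(2,3)[OF g, of "2 * x0"] by (simp add: D_def)
  have dyadic: "g (x / 2 ^ j) \<le> D * (2 ^ b) ^ j * g x" if "x \<ge> x0" for x j
    using that
  proof (induction j arbitrary: x)
    case 0
    then show ?case using D regular_tailD(2)[OF g, of x] by simp
  next
    case (Suc j)
    show ?case
    proof (cases "x / 2 \<ge> x0")
      case True
      have "g (x / 2 ^ Suc j) = g ((x / 2) / 2 ^ j)" by simp
      also have "\<dots> \<le> D * (2 ^ b) ^ j * g (x / 2)" by (rule Suc.IH[OF True])
      also have "\<dots> \<le> D * (2 ^ b) ^ j * (2 ^ b * g x)"
        using D half[of x] Suc.prems by (intro mult_left_mono) (auto simp: x0_def)
      finally show ?thesis by (simp add: ac_simps)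
    next
      case False
      have "g (x / 2 ^ Suc j) \<le> D * g (2 * x0)"
        using regular_tailD(2,3)[OF g] by (simp add: D_def less_imp_neq[symmetric])
      also have "\<dots> \<le> D * g x" using False D by (intro mult_left_mono regular_tailD(1)[OF g]) auto
      also have "\<dots> \<le> D * (2 ^ b) ^ Suc j * g x"
        using D regular_tailD(2)[OF g, of x] by (auto intro!: mult_right_mono simp: one_le_power mult_ge1_I)
      finally show ?thesis .
    qed
  qed
  show ?thesis
  proof (rule that[of "D * 2 ^ b" x0])
    show "1 \<le> D * 2 ^ b" using D by (simp add: mult_ge1_I)
    show "x0 > 0" by (simp add: x0_def)
    fix x s :: real assume x: "x \<ge> x0" and s: "s > 0"
    have x_pos: "x > 0" using x by (simp add: x0_def)
    define j where "j = (LEAST j. s \<le> 2 ^ j)"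
    have ex: "\<exists>j. s \<le> 2 ^ j" using real_arch_pow[of 2 s] by (auto intro: less_imp_le)
    have j1: "s \<le> 2 ^ j" unfolding j_def by (rule LeastI_ex[OF ex])
    have j2: "2 ^ j \<le> 2 * (1 + s)"
    proof (cases j)
      case (Suc i)
      have "\<not> s \<le> 2 ^ i" using not_less_Least[of i "\<lambda>j. s \<le> 2 ^ j"] Suc by (auto simp: j_def)
      then show ?thesis using Suc s by auto
    qed (use s in auto)
    have "g (x / s) \<le> g (x / 2 ^ j)"
      using j1 s x_pos by (intro regular_tailD(1)[OF g] divide_left_mono) auto
    also have "\<dots> \<le> D * (2 ^ b) ^ j * g x" by (rule dyadic[OF x])
    also have "(2 ^ b) ^ j = (2 ^ j :: real) ^ b" by (simp add: power_mult[symmetric] mult.commute)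
    also have "D * (2 ^ j :: real) ^ b * g x \<le> D * (2 * (1 + s)) ^ b * g x"
      using D j2 regular_tailD(2)[OF g, of x] by (intro mult_right_mono mult_left_mono power_mono) auto
    also have "\<dots> = D * 2 ^ b * (1 + s) ^ b * g x" by (subst power_mult_distrib) simp
    finally show "g (x / s) \<le> D * 2 ^ b * (1 + s) ^ b * g x" .
  qed
qed

text \<open>
Monotonicity encloses $g(b)$ between $g(t\,a)$ for $t$ slightly below and slightly above 1, and
$t^{-\alpha}$ is continuous at $t = 1$.
\<close>
lemma regular_tail_equiv_arguments:
  assumes g: "regular_tail g \<alpha>"
    and a: "filterlim a at_top F" and ratio: "((\<lambda>x. b x / a x) \<longlongrightarrow> 1) F"
  shows "((\<lambda>x. g (b x) / g (a x)) \<longlongrightarrow> (1::real)) F"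
proof (rule order_tendstoI)
  have lim: "((\<lambda>x. g (t * a x) / g (a x)) \<longlongrightarrow> t powr (- \<alpha>)) F" if "t > 0" for t
    by (rule filterlim_compose[OF regular_tailD(4)[OF g that] a])
  have apos: "eventually (\<lambda>x. a x > 0) F"
    using a by (rule filterlim_at_top_dense[THEN iffD1, rule_format])
  have cont: "((\<lambda>t::real. t powr (- \<alpha>)) \<longlongrightarrow> 1) (at 1)"
    using tendsto_powr[OF tendsto_ident_at tendsto_const, where a = "1::real"] by simp
  {
    fix l :: real assume "l < 1"
    from order_tendstoD(1)[OF cont this] have "eventually (\<lambda>t::real. t powr (- \<alpha>) > l) (at_right 1)"
      by (auto simp: eventually_at_split)
    then have "eventually (\<lambda>t::real. t powr (- \<alpha>) > l \<and> t > 1) (at_right 1)"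
      using eventually_at_right_less[of "1::real"] by (rule eventually_conj)
    then obtain t :: real where t: "t > 1" "t powr (- \<alpha>) > l"
      using eventually_happens[of _ "at_right (1::real)"] by (auto simp: trivial_limit_at_right_real)
    have "eventually (\<lambda>x. g (t * a x) / g (a x) > l) F"
      using lim[of t] t by (intro order_tendstoD(1)) auto
    moreover have "eventually (\<lambda>x. b x / a x < t) F" by (rule order_tendstoD(2)[OF ratio]) (use t in auto)
    ultimately show "eventually (\<lambda>x. g (b x) / g (a x) > l) F" using apos
    proof eventually_elim
      case (elim x)
      have "g (t * a x) \<le> g (b x)" using elim by (intro regular_tailD(1)[OF g]) (auto simp: field_simps)
      then have "g (t * a x) / g (a x) \<le> g (b x) / g (a x)"
        using regular_tailD(2)[OF g, of "a x"] by (intro divide_right_mono) auto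
      then show ?case using elim by linarith
    qed
  }
  {
    fix l :: real assume "l > 1"
    from order_tendstoD(2)[OF cont this] have "eventually (\<lambda>t::real. t powr (- \<alpha>) < l) (at_left 1)"
      by (auto simp: eventually_at_split)
    moreover have "eventually (\<lambda>t::real. 0 < t \<and> t < 1) (at_left 1)"
      using eventually_at_left_real[of 0 "1::real"] by auto
    ultimately have "eventually (\<lambda>t::real. t powr (- \<alpha>) < l \<and> 0 < t \<and> t < 1) (at_left 1)"
      by (rule eventually_conj)
    then obtain t :: real where t: "0 < t" "t < 1" "t powr (- \<alpha>) < l"
      using eventually_happens[of _ "at_left (1::real)"] by (auto simp: trivial_limit_at_left_real)
    have "eventually (\<lambda>x. g (t * a x) / g (a x) < l) F"
      using lim[of t] t by (intro order_tendstoD(2)) auto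
    moreover have "eventually (\<lambda>x. b x / a x > t) F" by (rule order_tendstoD(1)[OF ratio]) (use t in auto)
    ultimately show "eventually (\<lambda>x. g (b x) / g (a x) < l) F" using apos
    proof eventually_elim
      case (elim x)
      have "g (b x) \<le> g (t * a x)" using elim by (intro regular_tailD(1)[OF g]) (auto simp: field_simps)
      then have "g (b x) / g (a x) \<le> g (t * a x) / g (a x)"
        using regular_tailD(2)[OF g, of "a x"] by (intro divide_right_mono) auto
      then show ?case using elim by linarith
    qed
  }
qed

context prob_space
begin

text \<open>
Since $\Phi(s) = \int_s^\infty \rho$, an expectation of $\Phi(q W)$ is an integral of
$\rho(r)\,P(q W < r)$ over $r$, by Fubini. This turns information about the distribution function of
$W$ near 0, stored in $g$, into asymptotics of expectations.
\<close>
lemma layer_cake: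
  fixes W :: "'a \<Rightarrow> real" and \<rho> \<Phi> :: "real \<Rightarrow> real"
  assumes [measurable]: "random_variable borel W" "\<rho> \<in> borel_measurable borel"
    and pos: "\<And>\<omega>. \<omega> \<in> space M \<Longrightarrow> W \<omega> > 0"
    and \<rho>: "\<And>r. r \<ge> 0 \<Longrightarrow> \<rho> r \<ge> 0" and q: "q > 0"
    and deriv: "\<And>r. r \<ge> 0 \<Longrightarrow> (\<Phi> has_real_derivative - \<rho> r) (at r)"
    and lim: "(\<Phi> \<longlongrightarrow> 0) at_top"
    and g: "\<And>q. q > 0 \<Longrightarrow> g q = prob {\<omega> \<in> space M. W \<omega> < 1 / q}"
  shows "(\<integral>\<^sup>+ \<omega>. ennreal (\<Phi> (q * W \<omega>)) \<partial>M) = (\<integral>\<^sup>+ r. ennreal (\<rho> r * g (q / r)) * indicator {0<..} r \<partial>lborel)"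
proof -
  interpret L: pair_sigma_finite M "lborel :: real measure" ..
  have \<Phi>: "ennreal (\<Phi> s) = (\<integral>\<^sup>+ r. ennreal (\<rho> r) * indicator {s<..} r \<partial>lborel)" if "s > 0" for s
  proof -
    have "(\<integral>\<^sup>+ r. ennreal (\<rho> r) * indicator {s..} r \<partial>lborel) = ennreal (0 - (- \<Phi> s))"
    proof (rule nn_integral_FTC_atLeast[where F = "\<lambda>x. - \<Phi> x"])
      show "((\<lambda>x. - \<Phi> x) \<longlongrightarrow> 0) at_top" using tendsto_minus[OF lim] by simp
      show "((\<lambda>x. - \<Phi> x) has_real_derivative \<rho> x) (at x)" if "s \<le> x" for x
        using DERIV_minus[OF deriv[of x]] that \<open>s > 0\<close> by simp
    qed (use \<rho> that in auto)
    also have "(\<integral>\<^sup>+ r. ennreal (\<rho> r) * indicator {s..} r \<partial>lborel) = (\<integral>\<^sup>+ r. ennreal (\<rho> r) * indicator {s<..} r \<partial>lborel)"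
    proof (rule nn_integral_cong_AE)
      show "AE r in lborel. ennreal (\<rho> r) * indicator {s..} r = ennreal (\<rho> r) * indicator {s<..} r"
        using AE_lborel_singleton[of s] by eventually_elim (simp add: indicator_def)
    qed
    finally show ?thesis by simp
  qed
  have "(\<integral>\<^sup>+ \<omega>. ennreal (\<Phi> (q * W \<omega>)) \<partial>M) =
      (\<integral>\<^sup>+ \<omega>. (\<integral>\<^sup>+ r. ennreal (\<rho> r) * (if q * W \<omega> < r then 1 else 0) \<partial>lborel) \<partial>M)"
  proof (rule nn_integral_cong)
    fix \<omega> assume "\<omega> \<in> space M"
    then have "0 < q * W \<omega>" using pos q by simp
    from \<Phi>[OF this] show "ennreal (\<Phi> (q * W \<omega>)) = (\<integral>\<^sup>+ r. ennreal (\<rho> r) * (if q * W \<omega> < r then 1 else 0) \<partial>lborel)"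
      by (simp add: indicator_def of_bool_def)
  qed
  also have "\<dots> = (\<integral>\<^sup>+ r. (\<integral>\<^sup>+ \<omega>. ennreal (\<rho> r) * (if q * W \<omega> < r then 1 else 0) \<partial>M) \<partial>lborel)"
    by (rule L.Fubini'[symmetric]) measurable
  also have "\<dots> = (\<integral>\<^sup>+ r. ennreal (\<rho> r * g (q / r)) * indicator {0<..} r \<partial>lborel)"
  proof (rule nn_integral_cong)
    fix r :: real
    have "(\<integral>\<^sup>+ \<omega>. ennreal (\<rho> r) * (if q * W \<omega> < r then 1 else 0) \<partial>M) =
        (\<integral>\<^sup>+ \<omega>. ennreal (\<rho> r) * indicator {\<omega> \<in> space M. q * W \<omega> < r} \<omega> \<partial>M)"
      by (intro nn_integral_cong) (auto simp: indicator_def)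
    also have "\<dots> = ennreal (\<rho> r) * ennreal (prob {\<omega> \<in> space M. q * W \<omega> < r})"
      by (subst nn_integral_cmult_indicator) (auto simp: emeasure_eq_measure)
    also have "\<dots> = ennreal (\<rho> r * g (q / r)) * indicator {0<..} r"
    proof (cases "r > 0")
      case True
      have "{\<omega> \<in> space M. q * W \<omega> < r} = {\<omega> \<in> space M. W \<omega> < 1 / (q / r)}"
        using q by (auto simp: field_simps)
      then show ?thesis using True g[of "q / r"] q \<rho>[of r] by (simp add: ennreal_mult)
    next
      case False
      have "0 < q * W \<omega>" if "\<omega> \<in> space M" for \<omega> using pos[OF that] q by simp
      then have "{\<omega> \<in> space M. q * W \<omega> < r} = {}" using False by force
      then show ?thesis unfolding \<open>{\<omega> \<in> space M. q * W \<omega> < r} = {}\<close> using False by simp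
    qed
    finally show "(\<integral>\<^sup>+ \<omega>. ennreal (\<rho> r) * (if q * W \<omega> < r then 1 else 0) \<partial>M) =
        ennreal (\<rho> r * g (q / r)) * indicator {0<..} r" .
  qed
  finally show ?thesis .
qed

end

section \<open>Expectations governed by small values\<close>

lemma antimono_borel_measurable:
  fixes g :: "real \<Rightarrow> real"
  assumes "antimono g" shows "g \<in> borel_measurable borel"
proof -
  have "mono (\<lambda>x. - g x)" using assms by (auto simp: antimono_def mono_def)
  from borel_measurable_uminus[OF borel_measurable_mono[OF this]] show ?thesis by simp
qed

lemma regular_tail_measurable: "regular_tail g \<alpha> \<Longrightarrow> g \<in> borel_measurable borel"
  by (simp add: regular_tail_def antimono_borel_measurable)

lemma polynomial_le_exp_half:
  obtains K :: real where "K > 0" "\<And>r. r \<ge> 0 \<Longrightarrow> (1 + r) ^ b * exp (- r) \<le> K * exp (- r / 2)"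
proof -
  \<comment> \<open>\<open>Suc b\<close> rather than \<open>b\<close> keeps the constant positive for \<open>b = 0\<close>\<close>
  define c :: real where "c = 2 * real (Suc b)"
  have c: "c \<ge> 1" by (simp add: c_def)
  show ?thesis
  proof (rule that[of "c ^ b"])
    show "c ^ b > 0" using c by simp
    fix r :: real assume r: "r \<ge> 0"
    have "1 + r \<le> c * (1 + r / c)" using c by (simp add: field_simps)
    also have "\<dots> \<le> c * exp (r / c)" using c by (intro mult_left_mono exp_ge_add_one_self) auto
    finally have "(1 + r) ^ b \<le> (c * exp (r / c)) ^ b" using r by (intro power_mono) auto
    also have "\<dots> = c ^ b * exp (real b * (r / c))" by (simp only: power_mult_distrib exp_of_nat_mult)
    also have "\<dots> \<le> c ^ b * exp (r / 2)"
    proof -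
      have "real b * (r / c) \<le> r / 2" using r by (simp add: c_def field_simps)
      then show ?thesis using c by (intro mult_left_mono) auto
    qed
    finally have "(1 + r) ^ b * exp (- r) \<le> c ^ b * exp (r / 2) * exp (- r)"
      by (intro mult_right_mono) auto
    also have "\<dots> = c ^ b * exp (- r / 2)" by (simp add: mult.assoc flip: exp_add)
    finally show "(1 + r) ^ b * exp (- r) \<le> c ^ b * exp (- r / 2)" .
  qed
qed

text \<open>
A positive variable whose distribution function varies regularly at 0 with index $\alpha$. The
behaviour at 0 is recorded through $g(q) = P(W < 1/q)$, so that it can be used as a tail at infinity.
\<close>
locale small_value_regular = prob_space +
  fixes W :: "'a \<Rightarrow> real" and g :: "real \<Rightarrow> real" and \<alpha> :: real
  assumes W_measurable [measurable]: "random_variable borel W"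
    and W_pos: "\<And>\<omega>. \<omega> \<in> space M \<Longrightarrow> W \<omega> > 0"
    and g_eq: "\<And>q. q > 0 \<Longrightarrow> g q = prob {\<omega> \<in> space M. W \<omega> < 1 / q}"
    and g_regular: "regular_tail g \<alpha>"
    and \<alpha>_nonneg: "\<alpha> \<ge> 0"
begin

lemma integrable_exp_neg: "integrable M (\<lambda>\<omega>. exp (- (q * W \<omega>)))" if "q > 0" for q
proof (rule integrable_const_bound[where B = 1])
  show "AE \<omega> in M. norm (exp (- (q * W \<omega>))) \<le> 1"
    using W_pos that by (intro AE_I2) (simp add: less_imp_le)
qed measurable

text \<open>
The Abelian half of Karamata's theorem: $E e^{-qW} = \int_0^\infty e^{-r} g(q/r)\,dr$, the quotient
$g(q/r)/g(q)$ tends to $r^\alpha$, and the Potter bound makes dominated convergence applicable.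
\<close>
lemma laplace_asymptotics:
  "((\<lambda>q. (\<integral>\<omega>. exp (- (q * W \<omega>)) \<partial>M) / g q) \<longlongrightarrow> Gamma (\<alpha> + 1)) at_top"
proof -
  note [measurable] = regular_tail_measurable[OF g_regular]
  obtain b :: nat where b: "\<alpha> < real b" using reals_Archimedean2 by blast
  obtain C x0 where C: "C \<ge> 1" "x0 > 0" "\<And>x s. x \<ge> x0 \<Longrightarrow> s > 0 \<Longrightarrow> g (x / s) \<le> C * (1 + s) ^ b * g x"
    using regular_tail_potter[OF g_regular b] by blast
  obtain K :: real where K: "K > 0" "\<And>r. r \<ge> 0 \<Longrightarrow> (1 + r) ^ b * exp (- r) \<le> K * exp (- r / 2)"
    using polynomial_le_exp_half[of b] by blast
  define s where "s q r = indicator {0<..} r * (exp (- r) * g (q / r) / g q)" for q r :: real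
  define f where "f r = indicator {0<..} r * (exp (- r) * r powr \<alpha>)" for r :: real
  define d where "d r = indicator {0..} r * (C * K * exp (- r / 2))" for r :: real
  have "((\<lambda>q. \<integral>r. s q r \<partial>lborel) \<longlongrightarrow> (\<integral>r. f r \<partial>lborel)) at_top"
  proof (rule integral_dominated_convergence_at_top)
    show "f \<in> borel_measurable lborel" unfolding f_def by measurable
    show "s q \<in> borel_measurable lborel" for q unfolding s_def by measurable
    have "integrable lborel d"
    proof (rule integrableI_nonneg)
      show "d \<in> borel_measurable lborel" unfolding d_def by measurable
      show "AE x in lborel. 0 \<le> d x" using C(1) K(1) by (auto simp: d_def)
      have "(\<integral>\<^sup>+x. ennreal (d x) \<partial>lborel) = (\<integral>\<^sup>+x. ennreal (C * K * exp (- x / 2)) * indicator {0..} x \<partial>lborel)"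
        by (intro nn_integral_cong) (simp add: d_def indicator_def)
      also have "\<dots> = ennreal (0 - (- 2 * C * K * exp (- 0 / 2)))"
      proof (rule nn_integral_FTC_atLeast)
        show "((\<lambda>x. - 2 * C * K * exp (- x / 2)) has_real_derivative C * K * exp (- x / 2)) (at x)" for x
          by (auto intro!: derivative_eq_intros)
        have "((\<lambda>x::real. exp (- x / 2)) \<longlongrightarrow> 0) at_top"
          using filterlim_tendsto_pos_mult_at_top[OF tendsto_const[of "1/2 :: real"] _ filterlim_ident]
          by (intro filterlim_compose[OF exp_at_bot]) (simp add: filterlim_uminus_at_bot)
        from tendsto_mult_left[OF this, of "- 2 * C * K"]
        show "((\<lambda>x. - 2 * C * K * exp (- x / 2)) \<longlongrightarrow> 0) at_top" by simp
      qed (use C(1) K(1) in auto)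
      finally show "(\<integral>\<^sup>+x. ennreal (d x) \<partial>lborel) < \<infinity>" by simp
    qed
    then show "integrable lborel d" .
    show "AE r in lborel. ((\<lambda>q. s q r) \<longlongrightarrow> f r) at_top"
    proof (rule AE_I2)
      fix r :: real
      show "((\<lambda>q. s q r) \<longlongrightarrow> f r) at_top"
      proof (cases "r > 0")
        case True
        have "((\<lambda>q. g (inverse r * q) / g q) \<longlongrightarrow> inverse r powr - \<alpha>) at_top"
          using True by (intro regular_tailD(4)[OF g_regular]) auto
        also have "inverse r powr - \<alpha> = r powr \<alpha>" using True by (simp add: powr_minus inverse_powr)
        finally have "((\<lambda>q. exp (- r) * (g (inverse r * q) / g q)) \<longlongrightarrow> exp (- r) * r powr \<alpha>) at_top"
          by (intro tendsto_mult tendsto_const)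
        then show ?thesis using True by (simp add: s_def f_def field_simps)
      qed (simp add: s_def f_def)
    qed
    show "\<forall>\<^sub>F q in at_top. AE r in lborel. norm (s q r) \<le> d r"
      using eventually_ge_at_top[of x0]
    proof eventually_elim
      case (elim q)
      have "norm (s q r) \<le> d r" for r
      proof (cases "r > 0")
        case True
        have gq: "g q > 0" "g (q / r) > 0" using regular_tailD(2)[OF g_regular] by auto
        have "norm (s q r) = exp (- r) * (g (q / r) / g q)" using True gq by (simp add: s_def)
        also have "\<dots> \<le> exp (- r) * (C * (1 + r) ^ b)"
          using C(3)[OF elim True] gq by (intro mult_left_mono) (simp_all add: field_simps)
        also have "\<dots> = C * ((1 + r) ^ b * exp (- r))" by simp
        also have "\<dots> \<le> C * (K * exp (- r / 2))" using C(1) K(2)[of r] True by (intro mult_left_mono) auto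
        finally show ?thesis using True by (simp add: d_def)
      qed (use C(1) K(1) in \<open>simp add: s_def d_def\<close>)
      then show ?case by simp
    qed
  qed
  also have "(\<integral>r. f r \<partial>lborel) = Gamma (\<alpha> + 1)"
  proof -
    have "((\<lambda>t. t powr (\<alpha> + 1 - 1) / exp t) has_integral Gamma (\<alpha> + 1)) {0..}"
      using \<alpha>_nonneg by (intro Gamma_integral_real) auto
    then have "((\<lambda>t. if t \<in> {0..} then t powr (\<alpha> + 1 - 1) / exp t else 0) has_integral Gamma (\<alpha> + 1)) UNIV"
      by (simp only: has_integral_restrict_UNIV)
    moreover have "negligible {0::real}" by simp
    ultimately have "(f has_integral Gamma (\<alpha> + 1)) UNIV"
      by (rule has_integral_spike[rotated 2]) (auto simp: f_def indicator_def exp_minus divide_inverse)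
    moreover have "f \<in> borel_measurable lborel" unfolding f_def by measurable
    moreover have "f r \<ge> 0" for r by (simp add: f_def)
    ultimately have "has_bochner_integral lborel f (Gamma (\<alpha> + 1))"
      by (intro has_bochner_integral_nn_integral)
        (use \<alpha>_nonneg in \<open>auto simp: nn_integral_has_integral_lborel intro!: less_imp_le Gamma_real_pos\<close>)
    then show ?thesis by (rule has_bochner_integral_integral_eq)
  qed
  finally have lim: "((\<lambda>q. \<integral>r. s q r \<partial>lborel) \<longlongrightarrow> Gamma (\<alpha> + 1)) at_top" .
  have eq: "(\<integral>r. s q r \<partial>lborel) = (\<integral>\<omega>. exp (- (q * W \<omega>)) \<partial>M) / g q" if q: "q > 0" for q
  proof -
    have gq: "g x > 0" for x using regular_tailD(2)[OF g_regular] by auto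
    have "(\<integral>r. s q r \<partial>lborel) = (\<integral>r. indicator {0<..} r * (exp (- r) * g (q / r)) \<partial>lborel) / g q"
      by (simp add: s_def flip: integral_divide_zero)
    also have "(\<integral>r. indicator {0<..} r * (exp (- r) * g (q / r)) \<partial>lborel) =
        enn2real (\<integral>\<^sup>+r. ennreal (exp (- r) * g (q / r)) * indicator {0<..} r \<partial>lborel)"
      using gq by (subst integral_eq_nn_integral)
        (auto intro!: arg_cong[where f = enn2real] nn_integral_cong simp: indicator_def less_imp_le)
    also have "\<dots> = enn2real (\<integral>\<^sup>+\<omega>. ennreal (exp (- (q * W \<omega>))) \<partial>M)"
    proof (subst layer_cake[where W = W and \<Phi> = "\<lambda>x. exp (- x)" and \<rho> = "\<lambda>x. exp (- x)" and q = q, symmetric])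
      show "((\<lambda>x::real. exp (- x)) \<longlongrightarrow> 0) at_top"
        by (rule filterlim_compose[OF exp_at_bot filterlim_uminus_at_bot_at_top])
    qed (auto intro!: derivative_eq_intros W_pos g_eq q)
    also have "\<dots> = (\<integral>\<omega>. exp (- (q * W \<omega>)) \<partial>M)" by (subst integral_eq_nn_integral) auto
    finally show ?thesis .
  qed
  show ?thesis
    by (rule Lim_transform_eventually[OF lim]) (use eventually_gt_at_top[of 0] in \<open>eventually_elim; simp add: eq\<close>)
qed

text \<open>
Gumbel tails are bounded by powers, uniformly in the base point. This is the matching
integrability statement: for a sufficiently high power the expectation is still of the order of $P(W < 1/q)$.
\<close>
lemma power_moment_bound:
  obtains m :: nat and B q0 where "B > 0" "q0 > 0"
    "\<And>q. q \<ge> q0 \<Longrightarrow> (\<integral>\<omega>. 1 / (1 + q * W \<omega>) ^ m \<partial>M) \<le> B * g q"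
proof -
  note [measurable] = regular_tail_measurable[OF g_regular]
  obtain b :: nat where b: "\<alpha> < real b" using reals_Archimedean2 by blast
  obtain C x0 where C: "C \<ge> 1" "x0 > 0" "\<And>x s. x \<ge> x0 \<Longrightarrow> s > 0 \<Longrightarrow> g (x / s) \<le> C * (1 + s) ^ b * g x"
    using regular_tail_potter[OF g_regular b] by blast
  have gpos: "g x > 0" for x using regular_tailD(2)[OF g_regular] by auto
  define \<rho> where "\<rho> r = (if r < 0 then 0 else real (Suc b) / (1 + r) ^ (b + 2))" for r :: real
  have bound: "(\<integral>\<omega>. 1 / (1 + q * W \<omega>) ^ Suc b \<partial>M) \<le> C * Suc b * g q" if q: "q \<ge> x0" for q
  proof -
    have q0: "q > 0" using q C by simp
    have "(\<integral>\<^sup>+\<omega>. ennreal (1 / (1 + q * W \<omega>) ^ Suc b) \<partial>M) =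
        (\<integral>\<^sup>+ r. ennreal (\<rho> r * g (q / r)) * indicator {0<..} r \<partial>lborel)"
    proof (rule layer_cake[where \<Phi> = "\<lambda>x. 1 / (1 + x) ^ Suc b"])
      show "\<rho> \<in> borel_measurable borel" unfolding \<rho>_def by measurable
      show "((\<lambda>x::real. 1 / (1 + x) ^ Suc b) has_real_derivative - \<rho> r) (at r)" if "r \<ge> 0" for r
      proof -
        have nz: "1 + r \<noteq> 0" using that by simp
        have "((\<lambda>x. (1 + x) ^ Suc b) has_real_derivative Suc b * (1 + r) ^ b) (at r)"
          by (rule derivative_eq_intros refl | simp del: power_Suc)+
        from DERIV_inverse_fun[OF this] nz
        have "((\<lambda>x. 1 / (1 + x) ^ Suc b) has_real_derivative
            - (Suc b * (1 + r) ^ b * inverse (((1 + r) ^ Suc b) ^ 2))) (at r)"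
          by (simp add: inverse_eq_divide numeral_2_eq_2)
        also have "((1 + r) ^ Suc b) ^ 2 = (1 + r) ^ b * (1 + r) ^ (b + 2)"
          by (simp add: power2_eq_square ac_simps)
        also have "- (Suc b * (1 + r) ^ b * inverse ((1 + r) ^ b * (1 + r) ^ (b + 2))) = - \<rho> r"
          using nz that by (simp add: \<rho>_def divide_inverse)
        finally show ?thesis .
      qed
      show "((\<lambda>x::real. 1 / (1 + x) ^ Suc b) \<longlongrightarrow> 0) at_top"
        by (intro tendsto_divide_0[OF tendsto_const] filterlim_at_top_imp_at_infinity
            filterlim_pow_at_top filterlim_tendsto_add_at_top[OF tendsto_const] filterlim_ident) auto
    qed (auto intro!: W_pos g_eq q0 simp: \<rho>_def)
    also have "\<dots> \<le> (\<integral>\<^sup>+ r. ennreal (C * Suc b * g q / (1 + r)\<^sup>2) * indicator {0..} r \<partial>lborel)"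
    proof (intro nn_integral_mono)
      fix r :: real
      show "ennreal (\<rho> r * g (q / r)) * indicator {0<..} r \<le> ennreal (C * Suc b * g q / (1 + r)\<^sup>2) * indicator {0..} r"
      proof (cases "r > 0")
        case True
        have "\<rho> r * g (q / r) \<le> \<rho> r * (C * (1 + r) ^ b * g q)"
          using C(3)[OF q True] by (intro mult_left_mono) (auto simp: \<rho>_def)
        also have "\<dots> = C * Suc b * g q / (1 + r)\<^sup>2"
        proof -
          have "(1 + r) ^ b \<noteq> 0" "1 + r \<noteq> 0" using True by auto
          moreover have "\<rho> r = Suc b / ((1 + r) ^ b * (1 + r)\<^sup>2)" using True by (simp only: \<rho>_def power_add if_False not_less_iff_gr_or_eq) simp
          ultimately show ?thesis by simp
        qed
        finally show ?thesis using True by (simp add: ennreal_leI)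
      qed simp
    qed
    also have "\<dots> = ennreal (0 - (- (C * Suc b * g q) / (1 + 0)))"
    proof (rule nn_integral_FTC_atLeast)
      show "((\<lambda>x. - (C * Suc b * g q) / (1 + x)) has_real_derivative C * Suc b * g q / (1 + x)\<^sup>2) (at x)"
        if "0 \<le> x" for x
        using that by (auto intro!: derivative_eq_intros simp: field_simps power2_eq_square)
      show "((\<lambda>x. - (C * Suc b * g q) / (1 + x)) \<longlongrightarrow> 0) at_top"
        by (intro tendsto_divide_0[OF tendsto_const] filterlim_at_top_imp_at_infinity
            filterlim_tendsto_add_at_top[OF tendsto_const] filterlim_ident)
    qed (use C(1) gpos[of q] in auto)
    finally have *: "(\<integral>\<^sup>+\<omega>. ennreal (1 / (1 + q * W \<omega>) ^ Suc b) \<partial>M) \<le> ennreal (C * Suc b * g q)" by simp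
    have "(\<integral>\<omega>. 1 / (1 + q * W \<omega>) ^ Suc b \<partial>M) = enn2real (\<integral>\<^sup>+\<omega>. ennreal (1 / (1 + q * W \<omega>) ^ Suc b) \<partial>M)"
      by (subst integral_eq_nn_integral) (use W_pos q0 in \<open>auto intro!: AE_I2 simp: less_imp_le add_nonneg_nonneg\<close>)
    also have "\<dots> \<le> enn2real (ennreal (C * Suc b * g q))"
      by (rule enn2real_mono[OF *]) simp
    also have "\<dots> = C * Suc b * g q" using C(1) gpos[of q] by (simp add: less_imp_le)
    finally show ?thesis .
  qed
  show ?thesis
    by (rule that[of "C * Suc b" x0 "Suc b"]) (use C bound in auto)
qed

end

section \<open>Tails of Gumbel type\<close>

definition scaling_function :: "(real \<Rightarrow> real) \<Rightarrow> bool" where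
  "scaling_function w \<longleftrightarrow> (\<forall>x. w x > 0) \<and> filterlim (\<lambda>x. x * w x) at_top at_top"

text \<open>
These are properties of a Gumbel-type tail that survive averaging over an independent
factor, so that the averaging step can be iterated.
\<close>
definition gumbel_tail :: "(real \<Rightarrow> real) \<Rightarrow> (real \<Rightarrow> real) \<Rightarrow> bool" where
  "gumbel_tail H w \<longleftrightarrow> antimono H \<and> (\<forall>x. 0 < H x \<and> H x \<le> 1) \<and>
     (\<forall>y. ((\<lambda>x. H (x + y / w x) / H x) \<longlongrightarrow> exp (- y)) at_top)"

lemma gumbel_tailD:
  assumes "gumbel_tail H w"
  shows "x \<le> y \<Longrightarrow> H y \<le> H x" "0 < H x" "H x \<le> 1"
    "((\<lambda>x. H (x + y / w x) / H x) \<longlongrightarrow> exp (- y)) at_top" "H \<in> borel_measurable borel"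
  using assms by (auto simp: gumbel_tail_def antimono_def intro: antimono_borel_measurable)

lemma scaling_functionD:
  assumes "scaling_function w"
  shows "w x > 0" "filterlim (\<lambda>x. x * w x) at_top at_top"
  using assms by (auto simp: scaling_function_def)

lemma shifted_argument_ratio:
  assumes w: "scaling_function w"
  shows "((\<lambda>x. (x + y / w x) / x) \<longlongrightarrow> 1) at_top"
proof -
  have "((\<lambda>x. y / (x * w x)) \<longlongrightarrow> 0) at_top"
    by (intro tendsto_divide_0[OF tendsto_const] filterlim_at_top_imp_at_infinity scaling_functionD(2)[OF w])
  from tendsto_add[OF tendsto_const[of 1] this] have "((\<lambda>x. 1 + y / (x * w x)) \<longlongrightarrow> 1) at_top" by simp
  moreover have "eventually (\<lambda>x. 1 + y / (x * w x) = (x + y / w x) / x) at_top"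
    using eventually_gt_at_top[of 0]
  proof eventually_elim
    case (elim x)
    then show ?case using scaling_functionD(1)[OF w, of x] by (simp add: field_simps)
  qed
  ultimately show ?thesis by (rule Lim_transform_eventually)
qed

lemma shifted_argument_at_top:
  assumes w: "scaling_function w"
  shows "filterlim (\<lambda>x. x + y / w x) at_top at_top"
proof -
  have lim: "filterlim (\<lambda>x. ((x + y / w x) / x) * x) at_top at_top"
    by (rule filterlim_tendsto_pos_mult_at_top[OF shifted_argument_ratio[OF w]]) (auto simp: filterlim_ident)
  show ?thesis
  proof (rule filterlim_mono_eventually[OF lim order_refl order_refl])
    show "eventually (\<lambda>x. ((x + y / w x) / x) * x = x + y / w x) at_top"
      using eventually_gt_at_top[of 0] by eventually_elim simp
  qed
qed

text \<open>
At the shifted point $x' = x + y/w(x)$ a further step of length $1/w(x)$ lowers $H$ by the factor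
$e^{-1}$, and so does a step of length $1/w(x')$. As $H$ is monotone, the two step lengths
cannot differ by a fixed factor.
\<close>
lemma gumbel_tail_self_neglecting:
  assumes H: "gumbel_tail H w" and w: "scaling_function w"
  shows "((\<lambda>x. w (x + y / w x) / w x) \<longlongrightarrow> 1) at_top"
proof -
  define x' where "x' x = x + y / w x" for x
  have wp: "w x > 0" for x using scaling_functionD(1)[OF w] .
  have Hp: "H x > 0" for x using gumbel_tailD(2)[OF H] .
  have A: "((\<lambda>x. H (x' x + 1 / w x) / H (x' x)) \<longlongrightarrow> exp (- 1)) at_top"
  proof -
    have "((\<lambda>x. (H (x + (y + 1) / w x) / H x) / (H (x + y / w x) / H x)) \<longlongrightarrow> exp (- (y + 1)) / exp (- y)) at_top"
      by (intro tendsto_divide gumbel_tailD(4)[OF H]) auto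
    also have "exp (- (y + 1)) / exp (- y) = exp (- 1 :: real)" by (simp flip: exp_diff)
    also have "(\<lambda>x. (H (x + (y + 1) / w x) / H x) / (H (x + y / w x) / H x)) = (\<lambda>x. H (x' x + 1 / w x) / H (x' x))"
    proof
      fix x
      have "H x \<noteq> 0" using Hp[of x] by simp
      moreover have "x + (y + 1) / w x = x' x + 1 / w x" by (simp add: x'_def add_divide_distrib)
      ultimately show "(H (x + (y + 1) / w x) / H x) / (H (x + y / w x) / H x) = H (x' x + 1 / w x) / H (x' x)"
        unfolding x'_def[symmetric] by simp
    qed
    finally show ?thesis .
  qed
  have B: "((\<lambda>x. H (x' x + z / w (x' x)) / H (x' x)) \<longlongrightarrow> exp (- z)) at_top" for z
    unfolding x'_def by (rule filterlim_compose[OF gumbel_tailD(4)[OF H] shifted_argument_at_top[OF w]])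
  have anti: "a < b" if "H b < H a" for a b
    proof (rule ccontr)
    assume "\<not> a < b"
    then have "H a \<le> H b" by (intro gumbel_tailD(1)[OF H]) simp
    then show False using that by simp
  qed
  show ?thesis
  proof (rule order_tendstoI)
    fix l :: real assume l: "l < 1"
    show "eventually (\<lambda>x. w (x + y / w x) / w x > l) at_top"
    proof (cases "l > 0")
      case True
      define c where "c = (exp (-1) + exp (- l)) / 2"
      have c: "exp (- 1) < c" "c < exp (- l)" using l by (auto simp: c_def)
      show ?thesis using order_tendstoD(2)[OF A c(1)] order_tendstoD(1)[OF B[of l] c(2)]
      proof eventually_elim
        case (elim x)
        then have "H (x' x + 1 / w x) / H (x' x) < H (x' x + l / w (x' x)) / H (x' x)" by linarith
        then have "H (x' x + 1 / w x) < H (x' x + l / w (x' x))"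
          using Hp[of "x' x"] by (simp add: divide_less_cancel)
        then have "l / w (x' x) < 1 / w x" using anti by fastforce
        then have "l < w (x' x) / w x" using wp[of "x' x"] by (simp add: pos_divide_less_eq)
        then show ?case unfolding x'_def .
      qed
    next
      case False
      have "w (x + y / w x) / w x > l" for x
        using False divide_pos_pos[OF wp[of "x + y / w x"] wp[of x]] by linarith
      then show ?thesis by simp
    qed
  next
    fix l :: real assume l: "l > 1"
    define c where "c = (exp (-1) + exp (- l)) / 2"
    have c: "exp (- 1) > c" "c > exp (- l)" using l by (auto simp: c_def)
    show "eventually (\<lambda>x. w (x + y / w x) / w x < l) at_top"
      using order_tendstoD(1)[OF A c(1)] order_tendstoD(2)[OF B[of l] c(2)]
    proof eventually_elim
      case (elim x)
      then have "H (x' x + l / w (x' x)) / H (x' x) < H (x' x + 1 / w x) / H (x' x)" by linarith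
      then have "H (x' x + l / w (x' x)) < H (x' x + 1 / w x)"
        using Hp[of "x' x"] by (simp add: divide_less_cancel)
      then have "1 / w x < l / w (x' x)" using anti by fastforce
      then have "w (x' x) / w x < l" using wp[of "x' x"] by (simp add: pos_less_divide_eq)
      then show ?case unfolding x'_def .
    qed
  qed
qed

text \<open>
A step of length $T/w$ divides $H$ by at least $2^m$, while $w$ loses at most a factor 2, so that
the next step is at most twice as long. After $j$ steps the distance is at most
$T(2^j-1)/w(x)$ and $H$ has been divided by $2^{mj}$; this is decay of order $m$, with a constant
that does not depend on $x$.
\<close>
lemma gumbel_tail_power_decay:
  assumes H: "gumbel_tail H w" and w: "scaling_function w"
  obtains C x0 where "C > 0" "\<And>x s. x \<ge> x0 \<Longrightarrow> s \<ge> 0 \<Longrightarrow> H (x + s / w x) \<le> C / (1 + s) ^ m * H x"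
proof -
  have wp: "w x > 0" for x using scaling_functionD(1)[OF w] .
  have Hp: "H x > 0" for x using gumbel_tailD(2)[OF H] .
  \<comment> \<open>chosen so that \<open>exp (- T) < 2 powr (- m)\<close>\<close>
  define T :: real where "T = 1 + real m * ln 2"
  have T: "T \<ge> 1" by (simp add: T_def)
  have "exp (- T) < (1 / 2) ^ m"
  proof -
    have "exp (- T) = exp (- 1) * (1 / 2) ^ m"
    proof -
      have "exp (- T) = exp (- 1) * exp (- (real m * ln 2))" by (simp add: T_def flip: exp_add)
      also have "exp (- (real m * ln 2)) = (1 / 2 :: real) ^ m"
        by (simp add: exp_minus exp_of_nat_mult power_one_over inverse_eq_divide)
      finally show ?thesis .
    qed
    also have "\<dots> < 1 * (1 / 2) ^ m" by (intro mult_strict_right_mono) auto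
    finally show ?thesis by simp
  qed
  from order_tendstoD(2)[OF gumbel_tailD(4)[OF H] this]
  have "eventually (\<lambda>x. H (x + T / w x) / H x < (1 / 2) ^ m) at_top" .
  moreover have "eventually (\<lambda>x. w (x + T / w x) / w x > 1 / 2) at_top"
    by (rule order_tendstoD(1)[OF gumbel_tail_self_neglecting[OF H w]]) simp
  ultimately have "eventually (\<lambda>x. H (x + T / w x) / H x < (1 / 2) ^ m \<and> w (x + T / w x) / w x > 1 / 2) at_top"
    by (rule eventually_conj)
  then obtain x0 where x0: "\<And>x. x \<ge> x0 \<Longrightarrow> H (x + T / w x) / H x < (1 / 2) ^ m \<and> w (x + T / w x) / w x > 1 / 2"
    by (auto simp: eventually_at_top_linorder)
  have step: "H (x + T / w x) \<le> (1 / 2) ^ m * H x" "1 / w (x + T / w x) \<le> 2 / w x" if "x \<ge> x0" for x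
  proof -
    define x' where "x' = x + T / w x"
    have *: "H x' / H x < (1 / 2) ^ m" "1 / 2 < w x' / w x" using x0[OF that] by (simp_all add: x'_def)
    have "H x' \<le> (1 / 2) ^ m * H x" using *(1) Hp[of x] by (simp only: pos_divide_less_eq less_imp_le)
    moreover have "w x < 2 * w x'" using *(2) wp[of x] by (simp add: pos_less_divide_eq)
    then have "1 / w x' \<le> 2 / w x" using wp[of x] wp[of x'] by (simp add: frac_le_eq divide_simps)
    ultimately show "H (x + T / w x) \<le> (1 / 2) ^ m * H x" "1 / w (x + T / w x) \<le> 2 / w x"
      by (simp_all add: x'_def)
  qed
  have iter: "H (x + T * (2 ^ j - 1) / w x) \<le> ((1 / 2) ^ m) ^ j * H x" if "x \<ge> x0" for j x
    using that
  proof (induction j arbitrary: x)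
    case (Suc j)
    define x' where "x' = x + T / w x"
    have x': "x' \<ge> x0" using Suc.prems T wp[of x] by (auto simp: x'_def intro: add_increasing2)
    have "x' + T * (2 ^ j - 1) / w x' \<le> x' + T * (2 ^ j - 1) * (2 / w x)"
      using mult_left_mono[OF step(2)[OF Suc.prems], of "T * (2 ^ j - 1)"] T by (simp add: x'_def)
    also have "\<dots> = x + T * (2 ^ Suc j - 1) / w x" using wp[of x] by (simp add: x'_def field_simps)
    finally have "H (x + T * (2 ^ Suc j - 1) / w x) \<le> H (x' + T * (2 ^ j - 1) / w x')"
      by (rule gumbel_tailD(1)[OF H])
    also have "\<dots> \<le> ((1 / 2) ^ m) ^ j * H x'" by (rule Suc.IH[OF x'])
    also have "\<dots> \<le> ((1 / 2) ^ m) ^ j * ((1 / 2) ^ m * H x)"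
      using step(1)[OF Suc.prems] by (intro mult_left_mono) (auto simp: x'_def)
    finally show ?case by (simp add: mult_ac)
  qed simp
  show ?thesis
  proof (rule that[of "(2 * T) ^ m" x0])
    show "(2 * T) ^ m > 0" using T by simp
    fix x s :: real assume x: "x \<ge> x0" and s: "s \<ge> 0"
    define j where "j = (LEAST j. 1 + s / T < 2 ^ j)"
    have ex: "\<exists>j. 1 + s / T < 2 ^ j" using real_arch_pow[of 2 "1 + s / T"] by auto
    have j1: "1 + s / T < 2 ^ j" unfolding j_def by (rule LeastI_ex[OF ex])
    then obtain i where i: "j = Suc i" using s T by (cases j) (auto simp: field_simps)
    have j2: "2 ^ i \<le> 1 + s / T"
      using not_less_Least[of i "\<lambda>j. 1 + s / T < 2 ^ j"] i by (auto simp: j_def)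
    have "(1 + s) \<le> T * (1 + s / T)" using T by (simp add: field_simps)
    also have "\<dots> \<le> T * (2 * 2 ^ i)" using j1 i T by (intro mult_left_mono) auto
    finally have "(1 + s) ^ m \<le> (2 * T * 2 ^ i) ^ m" using s by (intro power_mono) (auto simp: mult_ac)
    then have "(1 + s) ^ m \<le> (2 * T) ^ m * (2 ^ i) ^ m" by (simp only: power_mult_distrib)
    moreover have "((1 / 2) ^ m) ^ i = 1 / (2 ^ i :: real) ^ m"
      by (simp only: power_one_over power_mult[symmetric] mult.commute[of i m])
    moreover have "(1 + s) ^ m > 0" using s by simp
    ultimately have *: "((1 / 2) ^ m) ^ i \<le> (2 * T) ^ m / (1 + s) ^ m" by (simp add: divide_simps mult_ac)
    have "T * (2 ^ i - 1) \<le> s" using j2 T by (simp add: field_simps)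
    then have "H (x + s / w x) \<le> H (x + T * (2 ^ i - 1) / w x)"
      using wp[of x] by (intro gumbel_tailD(1)[OF H] add_left_mono divide_right_mono) auto
    also have "\<dots> \<le> ((1 / 2) ^ m) ^ i * H x" by (rule iter[OF x])
    also have "\<dots> \<le> (2 * T) ^ m / (1 + s) ^ m * H x" using * Hp[of x] by (intro mult_right_mono) auto
    finally show "H (x + s / w x) \<le> (2 * T) ^ m / (1 + s) ^ m * H x" .
  qed
qed

text \<open>
For large $s$ both functions are below the weighted bound by the power decay of order $m + 1$. On
the remaining compact interval, pointwise convergence of monotone functions to a continuous limit
is uniform, as a fine grid shows.
\<close>
lemma gumbel_tail_uniform:
  assumes H: "gumbel_tail H w" and w: "scaling_function w" and \<epsilon>: "\<epsilon> > 0"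
  shows "eventually (\<lambda>x. \<forall>s\<ge>0. \<bar>H (x + s / w x) / H x - exp (- s)\<bar> \<le> \<epsilon> / (1 + s) ^ m) at_top"
proof -
  have wp: "w x > 0" for x using scaling_functionD(1)[OF w] .
  have Hp: "H x > 0" for x using gumbel_tailD(2)[OF H] .
  obtain C x0 where C: "C > 0" "\<And>x s. x \<ge> x0 \<Longrightarrow> s \<ge> 0 \<Longrightarrow> H (x + s / w x) \<le> C / (1 + s) ^ Suc m * H x"
    using gumbel_tail_power_decay[OF H w] by blast
  obtain K :: real where K: "K > 0" "\<And>r. r \<ge> 0 \<Longrightarrow> (1 + r) ^ Suc m * exp (- r) \<le> K * exp (- r / 2)"
    using polynomial_le_exp_half[of "Suc m"] by blast
  define D where "D = max C K"
  have D: "D > 0" using C by (simp add: D_def)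
  obtain N :: nat where N: "D / \<epsilon> \<le> real N" using real_arch_simple by blast
  define \<eta> where "\<eta> = \<epsilon> / (1 + real N) ^ m"
  have \<eta>: "\<eta> > 0" using \<epsilon> by (simp add: \<eta>_def)
  obtain k :: nat where k: "2 / \<eta> < real k" using reals_Archimedean2 by blast
  have k0: "real k > 0" using k divide_pos_pos[OF _ \<eta>, of 2] by linarith
  have k': "1 / real k \<le> \<eta> / 2" using k k0 \<eta> by (simp add: field_simps)
  have "eventually (\<lambda>x. \<forall>j\<in>{..Suc (N * k)}. \<bar>H (x + (real j / real k) / w x) / H x - exp (- (real j / real k))\<bar> < \<eta> / 2) at_top"
  proof (intro eventually_ball_finite ballI)
    fix j show "eventually (\<lambda>x. \<bar>H (x + (real j / real k) / w x) / H x - exp (- (real j / real k))\<bar> < \<eta> / 2) at_top"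
      using tendstoD[OF gumbel_tailD(4)[OF H, of "real j / real k"], of "\<eta> / 2"] \<eta> by (simp add: dist_real_def)
  qed simp
  then show ?thesis using eventually_ge_at_top[of x0]
  proof eventually_elim
    case (elim x)
    define h where "h s = H (x + s / w x) / H x" for s
    have h_anti: "h t \<le> h s" if "s \<le> t" for s t
      unfolding h_def using that Hp[of x] wp[of x]
      by (intro divide_right_mono gumbel_tailD(1)[OF H] add_left_mono) auto
    have h_pos: "h s > 0" for s using Hp by (simp add: h_def)
    have near: "\<bar>h (real j / real k) - exp (- (real j / real k))\<bar> < \<eta> / 2" if "j \<le> Suc (N * k)" for j
      using elim(1) that by (simp add: h_def)
    show ?case
    proof (intro allI impI)
      fix s :: real assume s: "s \<ge> 0"
      have "\<bar>h s - exp (- s)\<bar> \<le> \<epsilon> / (1 + s) ^ m"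
      proof (cases "s \<ge> real N")
        case True
        have "h s \<le> C / (1 + s) ^ Suc m" using C(2)[OF elim(2) s] Hp[of x] by (simp add: h_def field_simps)
        also have "\<dots> \<le> D / (1 + s) ^ Suc m" using s by (intro divide_right_mono) (auto simp: D_def)
        finally have 1: "h s \<le> D / (1 + s) ^ Suc m" .
        have "(1 + s) ^ Suc m * exp (- s) \<le> K * exp (- s / 2)" by (rule K(2)[OF s])
        also have "\<dots> \<le> K * 1" using K(1) s by (intro mult_left_mono) auto
        also have "\<dots> \<le> D" by (simp add: D_def)
        finally have "exp (- s) * (1 + s) ^ Suc m \<le> D" by (simp only: mult.commute)
        moreover have "(1 + s) ^ Suc m > 0" using s by (intro zero_less_power) auto
        ultimately have 2: "exp (- s) \<le> D / (1 + s) ^ Suc m" by (simp only: pos_le_divide_eq)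
        have "D = D / \<epsilon> * \<epsilon>" using \<epsilon> by simp
        also have "\<dots> \<le> (1 + s) * \<epsilon>" using N True \<epsilon> by (intro mult_right_mono) auto
        finally have "D \<le> \<epsilon> * (1 + s)" by (simp only: mult.commute)
        then have "D / (1 + s) ^ Suc m \<le> \<epsilon> * (1 + s) / (1 + s) ^ Suc m" using s by (intro divide_right_mono) auto
        also have "\<dots> = \<epsilon> / (1 + s) ^ m" using s by simp
        finally show ?thesis using 1 2 h_pos[of s] exp_gt_zero[of "- s"] by linarith
      next
        case False
        define j where "j = nat \<lfloor>s * real k\<rfloor>"
        have j: "real j \<le> s * real k" "s * real k < real j + 1" using s k0 by (auto simp: j_def)
        have "s * real k < real N * real k" using False k0 by simp
        then have "real j < real (N * k)" using j(1) by simp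
        then have "j < N * k" by (simp only: of_nat_less_iff)
        then have jN: "j \<le> Suc (N * k)" "Suc j \<le> Suc (N * k)" by auto
        define a b where "a = real j / real k" and "b = real (Suc j) / real k"
        have ab: "a \<le> s" "s \<le> b" "b = a + 1 / real k" using j k0 by (auto simp: a_def b_def field_simps)
        have a0: "a \<ge> 0" by (simp add: a_def)
        have "exp (- a) - exp (- b) = exp (- a) * (1 - exp (- (1 / real k)))"
          by (simp add: ab algebra_simps exp_diff exp_minus field_simps)
        also have "\<dots> \<le> 1 * (1 / real k)"
          using exp_ge_add_one_self[of "- (1 / real k)"] a0 k0 by (intro mult_mono) auto
        finally have e: "exp (- a) - exp (- b) \<le> \<eta> / 2" using k' by simp
        have "h b \<le> h s" "h s \<le> h a" "exp (- b) \<le> exp (- s)" "exp (- s) \<le> exp (- a)"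
          using ab by (auto intro: h_anti)
        then have "\<bar>h s - exp (- s)\<bar> \<le> \<eta>" using near[OF jN(1)] near[OF jN(2)] e unfolding a_def[symmetric] b_def[symmetric] by linarith
        also have "\<eta> \<le> \<epsilon> / (1 + s) ^ m" unfolding \<eta>_def
          using False s \<epsilon> by (intro divide_left_mono power_mono) auto
        finally show ?thesis .
      qed
      then show "\<bar>H (x + s / w x) / H x - exp (- s)\<bar> \<le> \<epsilon> / (1 + s) ^ m" by (simp add: h_def)
    qed
  qed
qed

context small_value_regular
begin

definition dilate :: "(real \<Rightarrow> real) \<Rightarrow> real \<Rightarrow> real" where
  "dilate H x = (\<integral>\<omega>. H (x * (1 + W \<omega>)) \<partial>M)"

lemma integrable_dilate:
  assumes H: "gumbel_tail H w"
  shows "integrable M (\<lambda>\<omega>. H (x * (1 + W \<omega>)))"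
proof (rule integrable_const_bound[where B = 1])
  note [measurable] = gumbel_tailD(5)[OF H]
  show "AE \<omega> in M. norm (H (x * (1 + W \<omega>))) \<le> 1"
    using gumbel_tailD(2,3)[OF H] by (intro AE_I2) (simp add: less_imp_le)
  show "(\<lambda>\<omega>. H (x * (1 + W \<omega>))) \<in> borel_measurable M" by measurable
qed

text \<open>
With $q = x\,w(x)$ one has $x(1+W) = x + qW/w(x)$, so $H(x(1+W))/H(x)$ is close to $e^{-qW}$. The
weighted uniform bound makes the error $o(E (1+qW)^{-m}) = o(g(q))$, and the main term is
the Laplace transform of $W$ at $q$.
\<close>
lemma dilate_asymptotics:
  assumes H: "gumbel_tail H w" and w: "scaling_function w"
  shows "((\<lambda>x. dilate H x / (H x * g (x * w x))) \<longlongrightarrow> Gamma (\<alpha> + 1)) at_top"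
proof -
  have wp: "w x > 0" for x using scaling_functionD(1)[OF w] .
  have Hp: "H x > 0" for x using gumbel_tailD(2)[OF H] .
  have gp: "g x > 0" for x using regular_tailD(2)[OF g_regular] .
  note q_top = scaling_functionD(2)[OF w]
  define L where "L q = (\<integral>\<omega>. exp (- (q * W \<omega>)) \<partial>M)" for q
  obtain m B q0 where B: "B > 0" "q0 > 0"
    "\<And>q. q \<ge> q0 \<Longrightarrow> (\<integral>\<omega>. 1 / (1 + q * W \<omega>) ^ m \<partial>M) \<le> B * g q"
    by (rule power_moment_bound) (rule that)
  have L: "((\<lambda>x. L (x * w x) / g (x * w x)) \<longlongrightarrow> Gamma (\<alpha> + 1)) at_top"
    unfolding L_def by (rule filterlim_compose[OF laplace_asymptotics q_top])
  have diff: "((\<lambda>x. dilate H x / (H x * g (x * w x)) - L (x * w x) / g (x * w x)) \<longlongrightarrow> 0) at_top"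
  proof (rule tendstoI)
    fix e :: real assume e: "e > 0"
    define \<epsilon> where "\<epsilon> = e / (2 * B)"
    have \<epsilon>: "\<epsilon> > 0" using e B by (simp add: \<epsilon>_def)
    have "eventually (\<lambda>x. x * w x \<ge> q0) at_top" using q_top by (simp add: filterlim_at_top)
    with gumbel_tail_uniform[OF H w \<epsilon>, of m] eventually_gt_at_top[of 0]
    show "eventually (\<lambda>x. dist (dilate H x / (H x * g (x * w x)) - L (x * w x) / g (x * w x)) 0 < e) at_top"
    proof eventually_elim
      case (elim x)
      define q where "q = x * w x"
      have q: "q > 0" "q \<ge> q0" using elim wp[of x] by (auto simp: q_def)
      have W0: "0 \<le> q * W \<omega>" if "\<omega> \<in> space M" for \<omega> using W_pos[OF that] q by simp
      have arg: "x * (1 + W \<omega>) = x + q * W \<omega> / w x" for \<omega> using wp[of x] by (simp add: q_def field_simps)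
      have "\<bar>dilate H x / H x - L q\<bar> = \<bar>\<integral>\<omega>. (H (x * (1 + W \<omega>)) / H x - exp (- (q * W \<omega>))) \<partial>M\<bar>"
        unfolding dilate_def L_def
        by (subst Bochner_Integration.integral_diff) (auto intro: integrable_exp_neg q integrable_dilate[OF H])
      also have "\<dots> \<le> (\<integral>\<omega>. \<bar>H (x * (1 + W \<omega>)) / H x - exp (- (q * W \<omega>))\<bar> \<partial>M)"
        by (rule integral_abs_bound)
      also have "\<dots> \<le> (\<integral>\<omega>. \<epsilon> * (1 / (1 + q * W \<omega>) ^ m) \<partial>M)"
      proof (rule integral_mono)
        show "integrable M (\<lambda>\<omega>. \<bar>H (x * (1 + W \<omega>)) / H x - exp (- (q * W \<omega>))\<bar>)"
          by (intro integrable_abs Bochner_Integration.integrable_diff integrable_exp_neg q integrable_divide_zero integrable_dilate[OF H])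
        show "integrable M (\<lambda>\<omega>. \<epsilon> * (1 / (1 + q * W \<omega>) ^ m))"
        proof (rule integrable_const_bound[where B = \<epsilon>])
          show "AE \<omega> in M. norm (\<epsilon> * (1 / (1 + q * W \<omega>) ^ m)) \<le> \<epsilon>"
          proof (rule AE_I2)
            fix \<omega> assume "\<omega> \<in> space M"
            then have t: "0 \<le> 1 / (1 + q * W \<omega>) ^ m" "1 / (1 + q * W \<omega>) ^ m \<le> 1"
              using W0 by (auto simp: divide_le_eq one_le_power)
            then have "norm (\<epsilon> * (1 / (1 + q * W \<omega>) ^ m)) = \<epsilon> * (1 / (1 + q * W \<omega>) ^ m)"
              using \<epsilon> unfolding real_norm_def by (intro abs_of_nonneg mult_nonneg_nonneg) auto
            also have "\<dots> \<le> \<epsilon> * 1" using \<epsilon> t by (intro mult_left_mono) auto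
            finally show "norm (\<epsilon> * (1 / (1 + q * W \<omega>) ^ m)) \<le> \<epsilon>" by simp
          qed
        qed measurable
        show "\<bar>H (x * (1 + W \<omega>)) / H x - exp (- (q * W \<omega>))\<bar> \<le> \<epsilon> * (1 / (1 + q * W \<omega>) ^ m)" if "\<omega> \<in> space M" for \<omega>
          using elim(1)[rule_format, OF W0[OF that]] by (simp add: arg)
      qed
      also have "\<dots> = \<epsilon> * (\<integral>\<omega>. 1 / (1 + q * W \<omega>) ^ m \<partial>M)" by (rule integral_mult_right_zero)
      also have "\<dots> \<le> \<epsilon> * (B * g q)" using B(3)[OF q(2)] \<epsilon> by (intro mult_left_mono) auto
      finally have "\<bar>dilate H x / H x - L q\<bar> / g q \<le> \<epsilon> * B" using gp[of q] by (simp add: field_simps)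
      moreover have "\<bar>dilate H x / H x - L q\<bar> / g q = \<bar>dilate H x / (H x * g q) - L q / g q\<bar>"
      proof -
        have "dilate H x / (H x * g q) - L q / g q = (dilate H x / H x - L q) / g q"
          by (simp add: diff_divide_distrib)
        then show ?thesis using gp[of q] by (simp only: abs_divide abs_of_pos)
      qed
      moreover have "\<epsilon> * B < e" using e B by (simp add: \<epsilon>_def)
      ultimately show ?case by (simp add: dist_real_def q_def)
    qed
  qed
  from tendsto_add[OF diff L] show ?thesis by simp
qed

text \<open>
The asymptotic formula for the averaged tail is $H(x)$ times a slowly changing factor: moving from $x$ to
$x + y/w(x)$ changes $x\,w(x)$ only by a factor tending to 1. Hence the average inherits the limit relation with the
same $w$, and the formula can be applied again to one factor after another.
\<close>
lemma gumbel_tail_dilate: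
  assumes H: "gumbel_tail H w" and w: "scaling_function w"
  shows "gumbel_tail (dilate H) w"
  unfolding gumbel_tail_def
proof (intro conjI allI)
  have wp: "w x > 0" for x using scaling_functionD(1)[OF w] .
  have Hp: "H x > 0" for x using gumbel_tailD(2)[OF H] .
  have gp: "g x > 0" for x using regular_tailD(2)[OF g_regular] .
  show "antimono (dilate H)"
  proof (rule antimonoI)
    fix x y :: real assume "x \<le> y"
    then show "dilate H y \<le> dilate H x" unfolding dilate_def using W_pos
      by (intro integral_mono integrable_dilate[OF H] gumbel_tailD(1)[OF H] mult_right_mono) (auto simp: less_imp_le add_nonneg_nonneg)
  qed
  show pos: "0 < dilate H x" for x
    unfolding dilate_def by (rule expectation_greater) (auto intro: integrable_dilate[OF H] Hp)
  show "dilate H x \<le> 1" for x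
    unfolding dilate_def by (rule integral_le_const) (auto intro: integrable_dilate[OF H] gumbel_tailD(3)[OF H])
  have Gamma_nz: "Gamma (\<alpha> + 1) \<noteq> 0"
    by (rule less_imp_neq[symmetric], rule Gamma_real_pos) (use \<alpha>_nonneg in simp)
  fix y
  define x' where "x' x = x + y / w x" for x
  have x'_top: "filterlim x' at_top at_top" unfolding x'_def by (rule shifted_argument_at_top[OF w])
  define P where "P x = dilate H x / (H x * g (x * w x))" for x
  have P: "(P \<longlongrightarrow> Gamma (\<alpha> + 1)) at_top" unfolding P_def by (rule dilate_asymptotics[OF H w])
  have Pp: "P x > 0" for x using pos Hp gp by (simp add: P_def)
  have "((\<lambda>x. ((x + y / w x) / x) * (w (x + y / w x) / w x)) \<longlongrightarrow> 1 * 1) at_top"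
    by (intro tendsto_mult shifted_argument_ratio[OF w] gumbel_tail_self_neglecting[OF H w])
  then have r: "((\<lambda>x. (x' x * w (x' x)) / (x * w x)) \<longlongrightarrow> 1) at_top" by (simp add: x'_def)
  have "((\<lambda>x. (P (x' x) / P x) * (H (x' x) / H x) * (g (x' x * w (x' x)) / g (x * w x))) \<longlongrightarrow>
       (Gamma (\<alpha> + 1) / Gamma (\<alpha> + 1)) * exp (- y) * 1) at_top"
  proof (intro tendsto_mult tendsto_divide P filterlim_compose[OF P x'_top])
    show "Gamma (\<alpha> + 1) \<noteq> 0" by (rule Gamma_nz)
    show "((\<lambda>x. H (x' x) / H x) \<longlongrightarrow> exp (- y)) at_top" unfolding x'_def by (rule gumbel_tailD(4)[OF H])
    show "((\<lambda>x. g (x' x * w (x' x)) / g (x * w x)) \<longlongrightarrow> 1) at_top"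
      by (rule regular_tail_equiv_arguments[OF g_regular scaling_functionD(2)[OF w] r])
  qed
  moreover note Gamma_nz
  moreover have "(P (x' x) / P x) * (H (x' x) / H x) * (g (x' x * w (x' x)) / g (x * w x)) = dilate H (x' x) / dilate H x" for x
    using Hp[of x] Hp[of "x' x"] gp[of "x * w x"] gp[of "x' x * w (x' x)"] pos[of x]
    by (simp add: P_def)
  ultimately show "((\<lambda>x. dilate H (x + y / w x) / dilate H x) \<longlongrightarrow> exp (- y)) at_top"
    by (simp add: x'_def)
qed

end

section \<open>Long tails\<close>

definition long_tailed :: "(real \<Rightarrow> real) \<Rightarrow> bool" where
  "long_tailed H \<longleftrightarrow> (\<forall>c. ((\<lambda>x. H (x + c) / H x) \<longlongrightarrow> 1) at_top)"

lemma long_tailedI: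
  assumes pos: "\<And>x. H x > 0"
    and lim: "\<And>c. c > 0 \<Longrightarrow> ((\<lambda>x. H (x + c) / H x) \<longlongrightarrow> 1) at_top"
  shows "long_tailed H"
  unfolding long_tailed_def
proof
  fix c :: real
  consider "c > 0" | "c = 0" | "c < 0" by linarith
  then show "((\<lambda>x. H (x + c) / H x) \<longlongrightarrow> 1) at_top"
  proof cases
    case 2
    have "H x \<noteq> 0" for x using pos[of x] by simp
    then show ?thesis using 2 by simp
  next
    case 3
    have shift: "filterlim (\<lambda>x. x + c) at_top at_top"
      using filterlim_tendsto_add_at_top[OF tendsto_const filterlim_ident, of c] by (simp add: add.commute)
    have "((\<lambda>x. inverse (H ((x + c) + (- c)) / H (x + c))) \<longlongrightarrow> inverse 1) at_top"
      using 3 by (intro tendsto_inverse filterlim_compose[OF lim shift]) auto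
    then show ?thesis by (simp add: inverse_eq_divide)
  qed (rule lim)
qed

text \<open>
A shift by $1/w(x)$ reduces $H$ by the factor $e^{-1}$, a bounded shift leaves a long-tailed $H$
asymptotically unchanged; so $1/w(x)$ exceeds every bound.
\<close>
lemma scaling_tendsto_0:
  assumes H: "gumbel_tail H w" and w: "scaling_function w" and l: "long_tailed H"
  shows "(w \<longlongrightarrow> 0) at_top"
proof (rule order_tendstoI)
  have wp: "w x > 0" for x using scaling_functionD(1)[OF w] .
  have Hp: "H x > 0" for x using gumbel_tailD(2)[OF H] .
  show "eventually (\<lambda>x. a < w x) at_top" if "a < 0" for a
    using that wp less_trans by (intro always_eventually allI) blast
  fix a :: real assume a: "a > 0"
  have "eventually (\<lambda>x. H (x + 1 / w x) / H x < (1 + exp (- 1)) / 2) at_top"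
    by (rule order_tendstoD(2)[OF gumbel_tailD(4)[OF H]]) simp
  moreover have "eventually (\<lambda>x. H (x + 1 / a) / H x > (1 + exp (- 1)) / 2) at_top"
    by (rule order_tendstoD(1)[OF l[unfolded long_tailed_def, rule_format]]) simp
  ultimately show "eventually (\<lambda>x. w x < a) at_top"
  proof eventually_elim
    case (elim x)
    then have "H (x + 1 / w x) / H x < H (x + 1 / a) / H x" by linarith
    then have *: "H (x + 1 / w x) < H (x + 1 / a)" using Hp[of x] by (simp add: divide_less_cancel)
    have "1 / a < 1 / w x"
    proof (rule ccontr)
      assume "\<not> 1 / a < 1 / w x"
      then have "H (x + 1 / a) \<le> H (x + 1 / w x)" by (intro gumbel_tailD(1)[OF H]) simp
      with * show False by simp
    qed
    then show ?case using a wp[of x] by (simp add: field_simps)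
  qed
qed

text \<open>
This carries long-tailedness from the claim distribution to the averaged tails, which share its $w$.
\<close>
lemma gumbel_tail_long_tailed:
  assumes H: "gumbel_tail H w" and w: "scaling_function w" and w0: "(w \<longlongrightarrow> 0) at_top"
  shows "long_tailed H"
proof (rule long_tailedI)
  have wp: "w x > 0" for x using scaling_functionD(1)[OF w] .
  show Hp: "H x > 0" for x using gumbel_tailD(2)[OF H] .
  fix c :: real assume c: "c > 0"
  show "((\<lambda>x. H (x + c) / H x) \<longlongrightarrow> 1) at_top"
  proof (rule order_tendstoI)
    fix a :: real assume "a > 1"
    have "H (x + c) / H x \<le> 1" for x
      using gumbel_tailD(1)[OF H, of x "x + c"] Hp[of x] c by simp
    then show "eventually (\<lambda>x. H (x + c) / H x < a) at_top"
      using \<open>a > 1\<close> by (intro always_eventually allI) (rule le_less_trans)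
  next
    fix a :: real assume a: "a < 1"
    define b where "b = max a (1 / 2)"
    have b: "0 < b" "b < 1" "a \<le> b" using a by (auto simp: b_def)
    define y where "y = - ln b / 2"
    have y: "y > 0" using b by (simp add: y_def)
    have "exp (- y) > b"
    proof -
      have "ln b < - y" using b by (simp add: y_def)
      then have "exp (ln b) < exp (- y)" by (simp only: exp_less_mono)
      then show ?thesis using b by simp
    qed
    from order_tendstoD(1)[OF gumbel_tailD(4)[OF H] this]
    have "eventually (\<lambda>x. b < H (x + y / w x) / H x) at_top" .
    moreover have "eventually (\<lambda>x. w x < y / c) at_top"
      using y c by (intro order_tendstoD(2)[OF w0]) auto
    ultimately show "eventually (\<lambda>x. a < H (x + c) / H x) at_top"
    proof eventually_elim
      case (elim x)
      have "c \<le> y / w x" using elim(2) c wp[of x] by (simp add: field_simps)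
      then have "H (x + y / w x) / H x \<le> H (x + c) / H x"
        using Hp[of x] by (intro divide_right_mono gumbel_tailD(1)[OF H]) auto
      then show ?case using elim b by linarith
    qed
  qed
qed

section \<open>Integrating out an independent variable\<close>

text \<open>
Conditioning on $Y$: the second variable is frozen at an independent outcome $\omega'$ of the same space, which avoids
naming the distributions of $X$ and $Y$.
\<close>
lemma (in prob_space) indep_var_expectation:
  fixes f :: "'b \<times> 'b \<Rightarrow> real"
  assumes ind: "indep_var S X T Y" and f [measurable]: "f \<in> borel_measurable (S \<Otimes>\<^sub>M T)"
    and bound: "\<And>z. \<bar>f z\<bar> \<le> B"
  shows "(\<integral>\<omega>. f (X \<omega>, Y \<omega>) \<partial>M) = (\<integral>\<omega>'. (\<integral>\<omega>. f (X \<omega>, Y \<omega>') \<partial>M) \<partial>M)"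
proof -
  have XY [measurable]: "random_variable S X" "random_variable T Y"
    using ind by (auto dest: indep_var_rv1 indep_var_rv2)
  interpret D1: prob_space "distr M S X" by (rule prob_space_distr) measurable
  interpret D2: prob_space "distr M T Y" by (rule prob_space_distr) measurable
  interpret P: pair_prob_space "distr M S X" "distr M T Y" ..
  have int: "integrable (distr M S X \<Otimes>\<^sub>M distr M T Y) f"
    by (rule P.integrable_const_bound[where B = B]) (use bound in auto)
  have "(\<integral>\<omega>. f (X \<omega>, Y \<omega>) \<partial>M) = (\<integral>z. f z \<partial>distr M (S \<Otimes>\<^sub>M T) (\<lambda>\<omega>. (X \<omega>, Y \<omega>)))"
    by (subst integral_distr) auto
  also have "\<dots> = (\<integral>z. f z \<partial>(distr M S X \<Otimes>\<^sub>M distr M T Y))"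
    using ind by (simp add: indep_var_distribution_eq)
  also have "\<dots> = (\<integral>y. (\<integral>x. f (x, y) \<partial>distr M S X) \<partial>distr M T Y)"
    using P.integral_snd[of "\<lambda>x y. f (x, y)"] int by simp
  also have "\<dots> = (\<integral>\<omega>'. (\<integral>x. f (x, Y \<omega>') \<partial>distr M S X) \<partial>M)"
    by (subst integral_distr) (auto intro!: D1.borel_measurable_lebesgue_integral)
  also have "\<dots> = (\<integral>\<omega>'. (\<integral>\<omega>. f (X \<omega>, Y \<omega>') \<partial>M) \<partial>M)"
  proof (rule Bochner_Integration.integral_cong[OF refl])
    fix \<omega>' assume "\<omega>' \<in> space M"
    then have [measurable]: "Y \<omega>' \<in> space T" using measurable_space[OF XY(2)] by auto
    show "(\<integral>x. f (x, Y \<omega>') \<partial>distr M S X) = (\<integral>\<omega>. f (X \<omega>, Y \<omega>') \<partial>M)"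
      by (subst integral_distr) auto
  qed
  finally show ?thesis .
qed

lemma (in prob_space) indep_var_prob:
  assumes ind: "indep_var S X T Y" and P [measurable]: "Measurable.pred (S \<Otimes>\<^sub>M T) (\<lambda>z. P (fst z) (snd z))"
  shows "prob {\<omega> \<in> space M. P (X \<omega>) (Y \<omega>)} = (\<integral>\<omega>'. prob {\<omega> \<in> space M. P (X \<omega>) (Y \<omega>')} \<partial>M)"
    and "integrable M (\<lambda>\<omega>'. prob {\<omega> \<in> space M. P (X \<omega>) (Y \<omega>')})"
proof -
  have XY [measurable]: "random_variable S X" "random_variable T Y"
    using ind by (auto dest: indep_var_rv1 indep_var_rv2)
  let ?f = "\<lambda>z. of_bool (P (fst z) (snd z)) :: real"
  have f_measurable [measurable]: "?f \<in> borel_measurable (S \<Otimes>\<^sub>M T)" unfolding of_bool_def by measurable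
  have 1: "(\<integral>\<omega>. ?f (X \<omega>, Y \<omega>) \<partial>M) = (\<integral>\<omega>'. (\<integral>\<omega>. ?f (X \<omega>, Y \<omega>') \<partial>M) \<partial>M)"
    by (rule indep_var_expectation[OF ind f_measurable, where B = 1]) simp
  have prob_eq: "prob {\<omega> \<in> space M. Q \<omega>} = (\<integral>\<omega>. of_bool (Q \<omega>) \<partial>M)" for Q
  proof -
    have "(\<integral>\<omega>. of_bool (Q \<omega>) \<partial>M) = (\<integral>\<omega>. indicator {\<omega>\<in>space M. Q \<omega>} \<omega> \<partial>M)"
      by (rule Bochner_Integration.integral_cong) (auto simp: indicator_def)
    also have "\<dots> = measure M ({\<omega>\<in>space M. Q \<omega>} \<inter> space M)" by (rule Bochner_Integration.integral_indicator)
    finally show ?thesis by (simp add: Int_absorb2)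
  qed
  show "prob {\<omega> \<in> space M. P (X \<omega>) (Y \<omega>)} = (\<integral>\<omega>'. prob {\<omega> \<in> space M. P (X \<omega>) (Y \<omega>')} \<partial>M)"
    using 1 by (simp add: prob_eq)
  interpret D1: prob_space "distr M S X" by (rule prob_space_distr) measurable
  have "(\<lambda>y. \<integral>x. ?f (x, y) \<partial>distr M S X) \<in> borel_measurable T"
    by (rule D1.borel_measurable_lebesgue_integral) measurable
  from measurable_compose[OF XY(2) this]
  have "(\<lambda>\<omega>'. \<integral>x. ?f (x, Y \<omega>') \<partial>distr M S X) \<in> borel_measurable M" .
  also have "?this \<longleftrightarrow> (\<lambda>\<omega>'. prob {\<omega> \<in> space M. P (X \<omega>) (Y \<omega>')}) \<in> borel_measurable M"
  proof (rule measurable_cong)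
    fix \<omega>' assume "\<omega>' \<in> space M"
    then have [measurable]: "Y \<omega>' \<in> space T" using measurable_space[OF XY(2)] by auto
    have "(\<lambda>x. ?f (x, Y \<omega>')) \<in> borel_measurable S" by measurable
    then show "(\<integral>x. ?f (x, Y \<omega>') \<partial>distr M S X) = prob {\<omega> \<in> space M. P (X \<omega>) (Y \<omega>')}"
      unfolding prob_eq using XY(1) \<open>(\<lambda>x. ?f (x, Y \<omega>')) \<in> borel_measurable S\<close>
      by (subst integral_distr) auto
  qed
  finally show "integrable M (\<lambda>\<omega>'. prob {\<omega> \<in> space M. P (X \<omega>) (Y \<omega>')})"
    by (intro integrable_const_bound[where B = 1]) auto
qed

section \<open>Sums of subexponential claims\<close>

lemma tail_positive:
  assumes F: "distribution_function F" and r: "right_endpoint F = \<infinity>"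
  shows "tail F x > 0"
proof (rule ccontr)
  assume "\<not> tail F x > 0"
  then have "F x \<ge> 1" by (simp add: tail_def)
  then have "y \<le> x" if "F y < 1" for y
    using that F by (metis distribution_function_def linorder_not_le monoD order_trans less_imp_le)
  then have "right_endpoint F \<le> ereal x"
    unfolding right_endpoint_def by (intro SUP_least) auto
  then show False using r by simp
qed

lemma tail_antimono: "distribution_function F \<Longrightarrow> antimono (tail F)"
  by (auto simp: distribution_function_def tail_def mono_def antimono_def)

lemma tail_le_1: "distribution_function F \<Longrightarrow> tail F x \<le> 1"
proof -
  assume F: "distribution_function F"
  have "F x \<ge> 0"
  proof (rule tendsto_upperbound)
    show "(F \<longlongrightarrow> 0) at_bot" using F by (simp add: distribution_function_def)
    show "eventually (\<lambda>y. F y \<le> F x) at_bot"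
      using F by (intro eventually_mono[OF eventually_le_at_bot[of x]]) (auto simp: distribution_function_def mono_def)
  qed simp
  then show ?thesis by (simp add: tail_def)
qed

lemma tail_tendsto_0: "distribution_function F \<Longrightarrow> (tail F \<longlongrightarrow> 0) at_top"
  unfolding tail_def distribution_function_def by (intro tendsto_eq_intros refl | force)+

locale subexponential_iid = prob_space +
  fixes X :: "nat \<Rightarrow> 'a \<Rightarrow> real" and \<mu> :: "real measure" and F :: "real \<Rightarrow> real"
  assumes X_indep: "indep_vars (\<lambda>_. borel) X {1..}"
    and X_distr: "\<And>i. i \<ge> 1 \<Longrightarrow> distr M borel (X i) = \<mu>"
    and F_cdf: "F = cdf \<mu>"
    and F_subexp: "subexponential F"
begin

lemma X_measurable: "i \<ge> 1 \<Longrightarrow> random_variable borel (X i)"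
  using X_indep by (auto simp: indep_vars_def)

lemma F_distribution: "distribution_function F" and F_endpoint: "right_endpoint F = \<infinity>"
  using F_subexp by (auto simp: subexponential_def)

lemmas F_tail_pos = tail_positive[OF F_distribution F_endpoint]
lemmas F_tail_le_1 = tail_le_1[OF F_distribution]

lemma F_tail_antimono: "x \<le> y \<Longrightarrow> tail F y \<le> tail F x"
  using tail_antimono[OF F_distribution] by (auto simp: antimono_def)

lemma \<mu>_real_distribution: "real_distribution \<mu>"
  using real_distribution_distr[OF X_measurable[of 1]] X_distr[of 1] by simp

lemma prob_X: "i \<ge> 1 \<Longrightarrow> A \<in> sets borel \<Longrightarrow> prob {\<omega> \<in> space M. X i \<omega> \<in> A} = measure \<mu> A"
  using measure_distr[OF X_measurable[of i], of A] X_distr[of i]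
  by (simp add: vimage_def Int_def conj_commute)

lemma prob_X_le: "i \<ge> 1 \<Longrightarrow> prob {\<omega> \<in> space M. X i \<omega> \<le> t} = F t"
  using prob_X[of i "{..t}"] by (simp add: F_cdf cdf_def)

lemma prob_X_gt: "i \<ge> 1 \<Longrightarrow> prob {\<omega> \<in> space M. X i \<omega> > t} = tail F t"
proof -
  assume i: "i \<ge> 1"
  note [measurable] = X_measurable[OF i]
  have "prob {\<omega> \<in> space M. \<not> X i \<omega> \<le> t} = 1 - prob {\<omega> \<in> space M. X i \<omega> \<le> t}"
    by (rule prob_neg) measurable
  then show ?thesis using prob_X_le[OF i] by (simp add: tail_def not_le)
qed

definition X_plus :: "nat \<Rightarrow> 'a \<Rightarrow> real" where "X_plus i \<omega> = max 0 (X i \<omega>)"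

lemma X_plus_measurable: "i \<ge> 1 \<Longrightarrow> random_variable borel (X_plus i)"
  unfolding X_plus_def using X_measurable[of i] by measurable

lemma X_plus_nonneg: "X_plus i \<omega> \<ge> 0" by (simp add: X_plus_def)

lemma prob_X_plus_gt: "i \<ge> 1 \<Longrightarrow> t \<ge> 0 \<Longrightarrow> prob {\<omega> \<in> space M. X_plus i \<omega> > t} = tail F t"
proof -
  assume "i \<ge> 1" "t \<ge> 0"
  moreover from this have "{\<omega> \<in> space M. X_plus i \<omega> > t} = {\<omega> \<in> space M. X i \<omega> > t}" by (auto simp: X_plus_def)
  ultimately show ?thesis using prob_X_gt by simp
qed

lemma indep_pair: "indep_var borel (X_plus i) borel (X j)" if "i \<noteq> j" "i \<ge> 1" "j \<ge> 1" for i j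
proof -
  have "indep_var (Pi\<^sub>M {i} (\<lambda>_. borel)) (\<lambda>\<omega>. \<lambda>i\<in>{i}. X i \<omega>) (Pi\<^sub>M {j} (\<lambda>_. borel)) (\<lambda>\<omega>. \<lambda>i\<in>{j}. X i \<omega>)"
    by (rule indep_var_restrict[OF X_indep]) (use that in auto)
  from indep_var_compose[OF this, of "\<lambda>x. max 0 (x i)" borel "\<lambda>x. x j" borel]
  show ?thesis by (simp add: o_def X_plus_def[abs_def])
qed

lemma distr_X_plus: "i \<ge> 1 \<Longrightarrow> distr M borel (X_plus i) = interval_measure (positive_part_df F)"
proof -
  assume i: "i \<ge> 1"
  note [measurable] = X_measurable[OF i] X_plus_measurable[OF i]
  have K: "distribution_function (positive_part_df F)"
    using F_subexp by (auto simp: subexponential_def subexponential_nonneg_def)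
  then have K': "\<And>x y. x \<le> y \<Longrightarrow> positive_part_df F x \<le> positive_part_df F y"
    "\<And>a. continuous (at_right a) (positive_part_df F)"
    "(positive_part_df F \<longlongrightarrow> 0) at_bot" "(positive_part_df F \<longlongrightarrow> 1) at_top"
    by (auto simp: distribution_function_def mono_def)
  show ?thesis
  proof (rule cdf_unique)
    show "real_distribution (distr M borel (X_plus i))" by (rule real_distribution_distr) measurable
    show "real_distribution (interval_measure (positive_part_df F))"
      by (rule real_distribution_interval_measure) (use K' in auto)
    have "cdf (distr M borel (X_plus i)) x = positive_part_df F x" for x
    proof -
      have "cdf (distr M borel (X_plus i)) x = prob {\<omega> \<in> space M. X_plus i \<omega> \<le> x}"
        by (simp add: cdf_def measure_distr vimage_def Int_def conj_commute)
      also have "\<dots> = positive_part_df F x"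
      proof (cases "x < 0")
        case True
        then have empty: "{\<omega> \<in> space M. X_plus i \<omega> \<le> x} = {}" by (auto simp: X_plus_def)
        show ?thesis unfolding empty using True by (simp add: positive_part_df_def)
      next
        case False
        then have "{\<omega> \<in> space M. X_plus i \<omega> \<le> x} = {\<omega> \<in> space M. X i \<omega> \<le> x}" by (auto simp: X_plus_def)
        then show ?thesis using False prob_X_le[OF i] by (simp add: positive_part_df_def)
      qed
      finally show ?thesis .
    qed
    moreover have "cdf (interval_measure (positive_part_df F)) = positive_part_df F"
      by (rule cdf_interval_measure) (use K' in auto)
    ultimately show "cdf (distr M borel (X_plus i)) = cdf (interval_measure (positive_part_df F))" by auto
  qed
qed

lemma pair_tail:
  assumes ij: "i \<noteq> j" "i \<ge> 1" "j \<ge> 1"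
  shows "((\<lambda>t. prob {\<omega> \<in> space M. X_plus i \<omega> + X_plus j \<omega> > t} / tail F t) \<longlongrightarrow> 2) at_top"
proof -
  note [measurable] = X_plus_measurable[OF ij(2)] X_plus_measurable[OF ij(3)]
  let ?K = "positive_part_df F"
  have "indep_var borel (X_plus i) borel (\<lambda>\<omega>. max 0 (X j \<omega>))"
    using indep_var_compose[OF indep_pair[OF ij], of "\<lambda>x. x" borel "\<lambda>x. max 0 x" borel] by (simp add: o_def)
  then have ind: "indep_var borel (X_plus i) borel (X_plus j)" by (simp add: X_plus_def[abs_def])
  have conv: "distr M borel (\<lambda>\<omega>. X_plus i \<omega> + X_plus j \<omega>) = (interval_measure ?K \<star> interval_measure ?K)"
    using sum_indep_random_variable[OF ind] distr_X_plus ij by simp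
  then have cdf: "conv_square ?K t = prob {\<omega> \<in> space M. X_plus i \<omega> + X_plus j \<omega> \<le> t}" for t
    unfolding conv_square_def conv[symmetric]
    by (simp add: cdf_def measure_distr vimage_def Int_def conj_commute)
  have tail: "tail (conv_square ?K) t = prob {\<omega> \<in> space M. X_plus i \<omega> + X_plus j \<omega> > t}" for t
  proof -
    have "prob {\<omega> \<in> space M. \<not> X_plus i \<omega> + X_plus j \<omega> \<le> t} = 1 - prob {\<omega> \<in> space M. X_plus i \<omega> + X_plus j \<omega> \<le> t}"
      by (rule prob_neg) measurable
    then show ?thesis by (simp add: tail_def cdf not_le)
  qed
  have "((\<lambda>x. tail (conv_square ?K) x / tail ?K x) \<longlongrightarrow> 2) at_top"
    using F_subexp by (simp add: subexponential_def subexponential_nonneg_def)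
  then show ?thesis
  proof (rule Lim_transform_eventually)
    show "eventually (\<lambda>t. tail (conv_square ?K) t / tail ?K t = prob {\<omega> \<in> space M. X_plus i \<omega> + X_plus j \<omega> > t} / tail F t) at_top"
      using eventually_ge_at_top[of 0] by eventually_elim (unfold tail, simp add: tail_def positive_part_df_def)
  qed
qed

lemma indep_X_prob:
  assumes "i \<noteq> j" "i \<ge> 1" "j \<ge> 1" "A \<in> sets borel" "B \<in> sets borel"
  shows "prob {\<omega> \<in> space M. X i \<omega> \<in> A \<and> X j \<omega> \<in> B} = measure \<mu> A * measure \<mu> B"
proof -
  have "prob (\<Inter>k\<in>{i,j}. X k -` (if k = i then A else B) \<inter> space M) =
      (\<Prod>k\<in>{i,j}. prob (X k -` (if k = i then A else B) \<inter> space M))"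
    by (rule indep_varsD[OF X_indep]) (use assms in auto)
  moreover have "(\<Inter>k\<in>{i,j}. X k -` (if k = i then A else B) \<inter> space M) = {\<omega> \<in> space M. X i \<omega> \<in> A \<and> X j \<omega> \<in> B}"
    using assms by auto
  moreover have "X k -` C \<inter> space M = {\<omega> \<in> space M. X k \<omega> \<in> C}" for k C by auto
  ultimately show ?thesis using assms prob_X by simp
qed

lemma \<mu>_tail: "measure \<mu> {t<..} = tail F t" and \<mu>_atMost: "measure \<mu> {..t} = F t"
  and \<mu>_Ioc: "s \<le> t \<Longrightarrow> measure \<mu> {s<..t} = F t - F s"
proof -
  interpret \<mu>: real_distribution \<mu> by (rule \<mu>_real_distribution)
  show "measure \<mu> {t<..} = tail F t"
    using prob_X[of 1 "{t<..}"] prob_X_gt[of 1 t] by simp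
  show "measure \<mu> {..t} = F t" by (simp add: F_cdf cdf_def)
  show "s \<le> t \<Longrightarrow> measure \<mu> {s<..t} = F t - F s"
    using \<mu>.cdf_diff_eq[of s t] by (cases "s = t") (auto simp: F_cdf)
qed

text \<open>
Split $\{X_1^+ + X_2^+ > t\}$ according to whether $X_1 > t$, $X_1 \le c$ or $c < X_1 \le t$. The
first two parts contribute about $(1 + F(c))\overline F(t)$, the third at least
$(F(t)-F(c))\,\overline F(t-c)$, and the total is about $2\overline F(t)$.
\<close>
lemma F_tail_long_tailed: "long_tailed (tail F)"
proof (rule long_tailedI)
  show "tail F x > 0" for x by (rule F_tail_pos)
  fix c :: real assume c: "c > 0"
  define r where "r t = prob {\<omega> \<in> space M. X_plus 1 \<omega> + X_plus 2 \<omega> > t} / tail F t" for t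
  have r: "(r \<longlongrightarrow> 2) at_top" unfolding r_def by (rule pair_tail) auto
  have F1: "(F \<longlongrightarrow> 1) at_top" using F_distribution by (simp add: distribution_function_def)
  have Fc: "F c < 1" using F_tail_pos[of c] by (simp add: tail_def)
  have bound: "tail F (t - c) / tail F t \<le> (r t - 1 - F c) / (F t - F c)" if t: "t \<ge> c" "F t > F c" for t
  proof -
    note [measurable] = X_measurable[of 1] X_measurable[of 2] X_plus_measurable[of 1] X_plus_measurable[of 2]
    let ?E1 = "{\<omega> \<in> space M. X 1 \<omega> \<in> {t<..}}"
    let ?E2 = "{\<omega> \<in> space M. X 1 \<omega> \<in> {..c} \<and> X 2 \<omega> \<in> {t<..}}"
    let ?E3 = "{\<omega> \<in> space M. X 1 \<omega> \<in> {c<..t} \<and> X 2 \<omega> \<in> {t - c<..}}"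
    have E: "?E1 \<in> events" "?E2 \<in> events" "?E3 \<in> events" by measurable
    have "prob ?E1 + prob ?E2 + prob ?E3 = prob (?E1 \<union> ?E2) + prob ?E3"
      using t E by (subst finite_measure_Union) auto
    also have "\<dots> = prob (?E1 \<union> ?E2 \<union> ?E3)"
      using t E by (subst finite_measure_Union[of "?E1 \<union> ?E2" ?E3]) auto
    also have "\<dots> \<le> prob {\<omega> \<in> space M. X_plus 1 \<omega> + X_plus 2 \<omega> > t}"
    proof (rule finite_measure_mono)
      show "?E1 \<union> ?E2 \<union> ?E3 \<subseteq> {\<omega> \<in> space M. X_plus 1 \<omega> + X_plus 2 \<omega> > t}"
        using c t by (auto simp: X_plus_def)
    qed measurable
    finally have sum_le: "prob ?E1 + prob ?E2 + prob ?E3 \<le> prob {\<omega> \<in> space M. X_plus 1 \<omega> + X_plus 2 \<omega> > t}" .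
    have "prob ?E1 = tail F t" by (subst prob_X) (auto simp: \<mu>_tail)
    moreover have "prob ?E2 = F c * tail F t" by (subst indep_X_prob) (auto simp: \<mu>_tail \<mu>_atMost)
    moreover have "prob ?E3 = (F t - F c) * tail F (t - c)"
      using t by (subst indep_X_prob) (auto simp: \<mu>_tail \<mu>_Ioc)
    moreover have "prob {\<omega> \<in> space M. X_plus 1 \<omega> + X_plus 2 \<omega> > t} = r t * tail F t"
      using F_tail_pos[of t] by (simp add: r_def)
    ultimately have "tail F t + F c * tail F t + (F t - F c) * tail F (t - c) \<le> r t * tail F t"
      using sum_le by linarith
    then show ?thesis using t F_tail_pos[of t] by (simp add: field_simps)
  qed
  have "((\<lambda>t. tail F (t - c) / tail F t) \<longlongrightarrow> 1) at_top"
  proof (rule tendsto_sandwich)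
    show "eventually (\<lambda>t. 1 \<le> tail F (t - c) / tail F t) at_top"
      using F_tail_antimono c F_tail_pos by (intro always_eventually allI) (simp add: le_divide_eq)
    have "eventually (\<lambda>t. F t > F c) at_top" by (rule order_tendstoD(1)[OF F1 Fc])
    then show "eventually (\<lambda>t. tail F (t - c) / tail F t \<le> (r t - 1 - F c) / (F t - F c)) at_top"
      using eventually_ge_at_top[of c] by eventually_elim (rule bound)
    have "((\<lambda>t. (r t - 1 - F c) / (F t - F c)) \<longlongrightarrow> (2 - 1 - F c) / (1 - F c)) at_top"
      using Fc by (intro tendsto_intros r F1) auto
    then show "((\<lambda>t. (r t - 1 - F c) / (F t - F c)) \<longlongrightarrow> 1) at_top" using Fc by simp
  qed simp
  moreover have shift: "filterlim (\<lambda>x. x + c) at_top at_top"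
    using filterlim_tendsto_add_at_top[OF tendsto_const filterlim_ident, of c] by (simp add: add.commute)
  ultimately have "((\<lambda>t. inverse (tail F (t + c - c) / tail F (t + c))) \<longlongrightarrow> inverse 1) at_top"
    by (intro tendsto_inverse filterlim_compose[OF _ shift]) auto
  then show "((\<lambda>x. tail F (x + c) / tail F x) \<longlongrightarrow> 1) at_top" by (simp add: inverse_eq_divide)
qed

text \<open>
A summand may be replaced by one with a heavier tail inside the probability of a large sum, on the
event that the other summand leaves room for at least $A$: only tail values beyond $A$ enter.
\<close>
lemma prob_sum_restrict_mono:
  assumes S: "indep_var borel S borel (X j)" and S': "indep_var borel S' borel (X j)"
    and le: "\<And>t. t \<ge> A \<Longrightarrow> prob {\<omega> \<in> space M. S \<omega> > t} \<le> c * prob {\<omega> \<in> space M. S' \<omega> > t}" and c: "c \<ge> 0"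
  shows "prob {\<omega> \<in> space M. S \<omega> + X j \<omega> > u \<and> a < X j \<omega> \<and> X j \<omega> \<le> u - A} \<le>
     c * prob {\<omega> \<in> space M. S' \<omega> + X j \<omega> > u \<and> a < X j \<omega> \<and> X j \<omega> \<le> u - A}"
proof -
  let ?P = "\<lambda>s x. s + x > u \<and> a < x \<and> x \<le> u - A"
  have meas: "Measurable.pred (borel \<Otimes>\<^sub>M borel) (\<lambda>z. ?P (fst z) (snd z))" by measurable
  note S1 = indep_var_prob[OF S, where P = ?P, OF meas] and S'1 = indep_var_prob[OF S', where P = ?P, OF meas]
  have "prob {\<omega> \<in> space M. ?P (S \<omega>) (X j \<omega>)} = (\<integral>\<omega>'. prob {\<omega> \<in> space M. ?P (S \<omega>) (X j \<omega>')} \<partial>M)" by (rule S1)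
  also have "\<dots> \<le> (\<integral>\<omega>'. c * prob {\<omega> \<in> space M. ?P (S' \<omega>) (X j \<omega>')} \<partial>M)"
  proof (rule integral_mono)
    fix \<omega>'
    have *: "{\<omega> \<in> space M. ?P (S \<omega>) x} = (if a < x \<and> x \<le> u - A then {\<omega> \<in> space M. S \<omega> > u - x} else {})" for S :: "'a \<Rightarrow> real" and x
      by auto
    show "prob {\<omega> \<in> space M. ?P (S \<omega>) (X j \<omega>')} \<le> c * prob {\<omega> \<in> space M. ?P (S' \<omega>) (X j \<omega>')}"
      unfolding * using le[of "u - X j \<omega>'"] by auto
  qed (use S1(2) S'1(2) in auto)
  also have "\<dots> = c * prob {\<omega> \<in> space M. ?P (S' \<omega>) (X j \<omega>)}" unfolding S'1(1) by simp
  finally show ?thesis by simp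
qed

end

context subexponential_iid
begin

lemma indep_partial_sum: "indep_var borel (\<lambda>\<omega>. \<Sum>i=1..m. X_plus i \<omega>) borel (X (Suc m))"
proof -
  have "indep_var (Pi\<^sub>M {1..m} (\<lambda>_. borel)) (\<lambda>\<omega>. \<lambda>i\<in>{1..m}. X i \<omega>) (Pi\<^sub>M {Suc m} (\<lambda>_. borel)) (\<lambda>\<omega>. \<lambda>i\<in>{Suc m}. X i \<omega>)"
    by (rule indep_var_restrict[OF X_indep]) auto
  from indep_var_compose[OF this, of "\<lambda>x. \<Sum>i=1..m. max 0 (x i)" borel "\<lambda>x. x (Suc m)" borel]
  have "indep_var borel ((\<lambda>x. \<Sum>i = 1..m. max 0 (x i)) \<circ> (\<lambda>\<omega>. \<lambda>i\<in>{1..m}. X i \<omega>))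
       borel ((\<lambda>x. x (Suc m)) \<circ> (\<lambda>\<omega>. \<lambda>i\<in>{Suc m}. X i \<omega>))" by measurable
  moreover have "(\<Sum>i=1..m. max 0 ((\<lambda>i\<in>{1..m}. X i \<omega>) i)) = (\<Sum>i=1..m. X_plus i \<omega>)" for \<omega>
    by (rule sum.cong) (auto simp: X_plus_def)
  ultimately show ?thesis unfolding o_def by simp
qed

text \<open>
If the sum exceeds $u$ and neither part exceeds $u - A$, both parts are larger than $A$. There the
partial sum can be exchanged for $X_1^+$ at the price of the factor $c$, and the event that two
single claims do this is what remains of the pair sum after the one-claim events are removed.
\<close>
lemma prob_sum_step:
  assumes m: "m \<ge> 1" and c: "c \<ge> 0" and A: "A \<ge> 0" and u: "u \<ge> A"
    and le: "\<And>t. t \<ge> A \<Longrightarrow> prob {\<omega> \<in> space M. (\<Sum>i=1..m. X_plus i \<omega>) > t} \<le> c * tail F t"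
    and uA: "u - A \<ge> A"
  shows "prob {\<omega> \<in> space M. (\<Sum>i=1..Suc m. X_plus i \<omega>) > u} \<le> (1 + c) * tail F (u - A)
     + c * (prob {\<omega> \<in> space M. X_plus 1 \<omega> + X_plus (Suc m) \<omega> > u} - F A * tail F u - tail F u)"
proof -
  have [measurable]: "random_variable borel (X_plus i)" "random_variable borel (X i)" if "i \<in> {1..Suc m}" for i
    using that X_plus_measurable X_measurable by auto
  have [measurable]: "random_variable borel (X (Suc m))" "random_variable borel (X_plus (Suc m))"
     "random_variable borel (X 1)" "random_variable borel (X_plus 1)" by (auto intro: X_measurable X_plus_measurable)
  define S where "S \<omega> = (\<Sum>i=1..m. X_plus i \<omega>)" for \<omega>
  have [measurable]: "random_variable borel S" unfolding S_def by measurable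
  let ?N = "X (Suc m)"
  let ?E1 = "{\<omega> \<in> space M. ?N \<omega> > u - A}" and ?E2 = "{\<omega> \<in> space M. S \<omega> > u - A}"
  let ?E3 = "{\<omega> \<in> space M. S \<omega> + ?N \<omega> > u \<and> A < ?N \<omega> \<and> ?N \<omega> \<le> u - A}"
  let ?G1 = "{\<omega> \<in> space M. X_plus 1 \<omega> + ?N \<omega> > u \<and> A < ?N \<omega> \<and> ?N \<omega> \<le> u - A}"
  let ?G2 = "{\<omega> \<in> space M. ?N \<omega> \<in> {..A} \<and> X 1 \<omega> \<in> {u<..}}"
  let ?G3 = "{\<omega> \<in> space M. ?N \<omega> \<in> {u<..}}"
  let ?pair = "{\<omega> \<in> space M. X_plus 1 \<omega> + X_plus (Suc m) \<omega> > u}"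
  have E: "?E1 \<in> events" "?E2 \<in> events" "?E3 \<in> events" "?G1 \<in> events" "?G2 \<in> events" "?G3 \<in> events" "?pair \<in> events"
    by measurable
  have "prob {\<omega> \<in> space M. (\<Sum>i=1..Suc m. X_plus i \<omega>) > u} \<le> prob (?E1 \<union> ?E2 \<union> ?E3)"
  proof (rule finite_measure_mono)
    have "\<omega> \<in> ?E1 \<union> ?E2 \<union> ?E3" if "\<omega> \<in> space M" "S \<omega> + X_plus (Suc m) \<omega> > u" for \<omega>
    proof (cases "?N \<omega> > u - A \<or> S \<omega> > u - A")
      case False
      then have "X_plus (Suc m) \<omega> > A" using that by linarith
      then have "X_plus (Suc m) \<omega> = ?N \<omega>" using A by (auto simp: X_plus_def max_def split: if_splits)
      then show ?thesis using that False \<open>X_plus (Suc m) \<omega> > A\<close> by auto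
    qed (use that in auto)
    then show "{\<omega> \<in> space M. (\<Sum>i=1..Suc m. X_plus i \<omega>) > u} \<subseteq> ?E1 \<union> ?E2 \<union> ?E3" by (auto simp: S_def)
  qed (use E in auto)
  also have "\<dots> \<le> prob ?E1 + prob ?E2 + prob ?E3"
    using E measure_Un_le[of "?E1 \<union> ?E2" M ?E3] measure_Un_le[of ?E1 M ?E2] by auto
  also have "prob ?E1 = tail F (u - A)" by (rule prob_X_gt) simp
  also have "prob ?E2 \<le> c * tail F (u - A)" using le[OF uA] by (simp add: S_def)
  also have "prob ?E3 \<le> c * prob ?G1"
  proof (rule prob_sum_restrict_mono)
    show "indep_var borel S borel (X (Suc m))" unfolding S_def by (rule indep_partial_sum)
    show "indep_var borel (X_plus 1) borel (X (Suc m))" by (rule indep_pair) (use m in auto)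
    show "prob {\<omega> \<in> space M. t < S \<omega>} \<le> c * prob {\<omega> \<in> space M. t < X_plus 1 \<omega>}" if "A \<le> t" for t
      using le[OF that] prob_X_plus_gt[of 1 t] A that by (simp add: S_def)
  qed (rule c)
  also have "c * prob ?G1 \<le> c * (prob ?pair - F A * tail F u - tail F u)"
  proof -
    have "prob ?G1 + prob ?G2 + prob ?G3 = prob (?G1 \<union> ?G2) + prob ?G3"
      using E by (subst finite_measure_Union) auto
    also have "\<dots> = prob (?G1 \<union> ?G2 \<union> ?G3)"
      using E u A by (subst finite_measure_Union[of "?G1 \<union> ?G2" ?G3]) auto
    also have "\<dots> \<le> prob ?pair"
      using A by (intro finite_measure_mono E) (auto simp: X_plus_def)
    finally have "prob ?G1 + prob ?G2 + prob ?G3 \<le> prob ?pair" .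
    moreover have "prob ?G2 = F A * tail F u"
      using m by (subst indep_X_prob) (auto simp: \<mu>_tail \<mu>_atMost)
    moreover have "prob ?G3 = tail F u" by (subst prob_X) (auto simp: \<mu>_tail)
    ultimately have "prob ?G1 \<le> prob ?pair - F A * tail F u - tail F u" by linarith
    then show ?thesis using c by (rule mult_left_mono)
  qed
  finally show ?thesis by (simp add: distrib_right)
qed

text \<open>
Induction on the number of summands. The remainder in the step is $c\,\overline F(A)\,\overline F(u)$
asymptotically, and $A$ may be taken as large as desired.
\<close>
lemma sum_tail_bound:
  assumes "m \<ge> 1" "\<epsilon> > 0"
  shows "eventually (\<lambda>u. prob {\<omega> \<in> space M. (\<Sum>i=1..m. X_plus i \<omega>) > u} \<le> (real m + \<epsilon>) * tail F u) at_top"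
  using assms
proof (induction m arbitrary: \<epsilon> rule: nat_induct_at_least)
  case base
  show ?case using eventually_ge_at_top[of 0]
  proof eventually_elim
    case (elim u)
    have "1 * tail F u \<le> (real 1 + \<epsilon>) * tail F u" using base F_tail_pos[of u] by (intro mult_right_mono) auto
    then show ?case using prob_X_plus_gt[of 1 u] elim by simp
  qed
next
  case (Suc m)
  define c where "c = real m + \<epsilon> / 4"
  have c: "c > 0" using Suc by (simp add: c_def)
  from Suc.IH[of "\<epsilon> / 4"] Suc.prems obtain u1 where u1:
    "\<And>u. u \<ge> u1 \<Longrightarrow> prob {\<omega> \<in> space M. (\<Sum>i=1..m. X_plus i \<omega>) > u} \<le> c * tail F u"
    by (auto simp: eventually_at_top_linorder c_def)
  have "eventually (\<lambda>A. tail F A < \<epsilon> / (4 * c)) at_top"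
    using Suc.prems c by (intro order_tendstoD(2)[OF tail_tendsto_0[OF F_distribution]]) auto
  from eventually_happens[OF eventually_conj[OF this eventually_ge_at_top[of "max u1 0"]]]
  obtain A where A: "tail F A < \<epsilon> / (4 * c)" "A \<ge> u1" "A \<ge> 0" by auto
  define \<phi> where "\<phi> u = (1 + c) * (tail F (u - A) / tail F u)
     + c * (prob {\<omega> \<in> space M. X_plus 1 \<omega> + X_plus (Suc m) \<omega> > u} / tail F u - F A - 1)" for u
  have "((\<lambda>u. tail F (u + - A) / tail F u) \<longlongrightarrow> 1) at_top"
    using F_tail_long_tailed unfolding long_tailed_def by blast
  then have "(\<phi> \<longlongrightarrow> (1 + c) * 1 + c * (2 - F A - 1)) at_top"
    unfolding \<phi>_def using Suc by (intro tendsto_intros pair_tail) auto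
  moreover have "(1 + c) * 1 + c * (2 - F A - 1) < real (Suc m) + \<epsilon>"
  proof -
    have "c * tail F A < c * (\<epsilon> / (4 * c))" using A(1) c by (intro mult_strict_left_mono)
    also have "\<dots> = \<epsilon> / 4" using c by simp
    finally have "c * (1 - F A) < \<epsilon> / 4" by (simp only: tail_def)
    moreover have "(1 + c) * 1 + c * (2 - F A - 1) = 1 + c + c * (1 - F A)" by simp
    moreover have "real (Suc m) + \<epsilon> = 1 + c + 3 * (\<epsilon> / 4)" by (simp add: c_def)
    ultimately show ?thesis using Suc.prems by linarith
  qed
  ultimately have "eventually (\<lambda>u. \<phi> u < real (Suc m) + \<epsilon>) at_top" by (rule order_tendstoD(2))
  then show ?case using eventually_ge_at_top[of "2 * A"]
  proof eventually_elim
    case (elim u)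
    have "prob {\<omega> \<in> space M. (\<Sum>i=1..Suc m. X_plus i \<omega>) > u} \<le> (1 + c) * tail F (u - A)
     + c * (prob {\<omega> \<in> space M. X_plus 1 \<omega> + X_plus (Suc m) \<omega> > u} - F A * tail F u - tail F u)"
      by (rule prob_sum_step) (use Suc c A elim u1 in auto)
    also have "\<dots> = \<phi> u * tail F u" using F_tail_pos[of u] by (simp add: \<phi>_def field_simps)
    also have "\<dots> \<le> (real (Suc m) + \<epsilon>) * tail F u"
      using elim F_tail_pos[of u] by (intro mult_right_mono) auto
    finally show ?case .
  qed
qed

definition one_jump :: "nat \<Rightarrow> real \<Rightarrow> nat \<Rightarrow> real \<Rightarrow> 'a set" where
  "one_jump n B k u = {\<omega> \<in> space M. X k \<omega> > u \<and> (\<forall>i\<in>{1..n} - {k}. \<bar>X i \<omega>\<bar> \<le> B)}"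

definition body_mass :: "real \<Rightarrow> real" where "body_mass B = measure \<mu> {- B..B}"

lemma body_mass_tendsto_1: "(body_mass \<longlongrightarrow> 1) at_top"
proof (rule tendsto_sandwich)
  interpret \<mu>: real_distribution \<mu> by (rule \<mu>_real_distribution)
  show "eventually (\<lambda>B. F B - F (- B) \<le> body_mass B) at_top"
    using eventually_ge_at_top[of 0]
  proof eventually_elim
    case (elim B)
    have "F B - F (- B) = measure \<mu> {- B<..B}" using elim by (simp add: \<mu>_Ioc)
    also have "\<dots> \<le> body_mass B" unfolding body_mass_def by (rule \<mu>.finite_measure_mono) auto
    finally show ?case .
  qed
  show "eventually (\<lambda>B. body_mass B \<le> 1) at_top" by (simp add: body_mass_def)
  have "((\<lambda>B. F B - F (- B)) \<longlongrightarrow> 1 - 0) at_top"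
    using F_distribution unfolding distribution_function_def
    by (intro tendsto_diff filterlim_compose[OF _ filterlim_uminus_at_bot_at_top]) auto
  then show "((\<lambda>B. F B - F (- B)) \<longlongrightarrow> 1) at_top" by simp
qed simp

lemma one_jump_measurable: "k \<in> {1..n} \<Longrightarrow> one_jump n B k u \<in> events"
proof -
  assume k: "k \<in> {1..n}"
  have [measurable]: "random_variable borel (X i)" if "i \<in> {1..n} - {k}" for i using that X_measurable by auto
  have [measurable]: "random_variable borel (X k)" using k X_measurable by auto
  show ?thesis unfolding one_jump_def by measurable
qed

lemma prob_one_jump: "k \<in> {1..n} \<Longrightarrow> prob (one_jump n B k u) = tail F u * body_mass B ^ (n - 1)"
proof -
  assume k: "k \<in> {1..n}"
  let ?A = "\<lambda>i. if i = k then {u<..} else {- B..B}"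
  have "one_jump n B k u = (\<Inter>i\<in>{1..n}. X i -` ?A i \<inter> space M)"
  proof -
    have "\<omega> \<in> one_jump n B k u \<longleftrightarrow> (\<forall>i\<in>{1..n}. \<omega> \<in> space M \<and> X i \<omega> \<in> ?A i)" for \<omega>
    proof
      assume "\<omega> \<in> one_jump n B k u"
      then have \<omega>: "\<omega> \<in> space M" "X k \<omega> > u" "\<And>i. i \<in> {1..n} - {k} \<Longrightarrow> \<bar>X i \<omega>\<bar> \<le> B"
        unfolding one_jump_def by blast+
      show "\<forall>i\<in>{1..n}. \<omega> \<in> space M \<and> X i \<omega> \<in> ?A i"
      proof
        fix i assume "i \<in> {1..n}"
        then show "\<omega> \<in> space M \<and> X i \<omega> \<in> ?A i" using \<omega>(1,2) \<omega>(3)[of i] by (cases "i = k") auto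
      qed
    next
      assume *: "\<forall>i\<in>{1..n}. \<omega> \<in> space M \<and> X i \<omega> \<in> ?A i"
      have "\<bar>X i \<omega>\<bar> \<le> B" if "i \<in> {1..n} - {k}" for i
        using bspec[OF *, of i] that by auto
      then show "\<omega> \<in> one_jump n B k u" using bspec[OF * k] by (simp add: one_jump_def)
    qed
    then show ?thesis by (intro set_eqI) (simp only: INT_iff Int_iff vimage_eq conj_commute)
  qed
  also have "prob \<dots> = (\<Prod>i\<in>{1..n}. prob (X i -` ?A i \<inter> space M))"
    by (rule indep_varsD[OF X_indep]) (use k in auto)
  also have "\<dots> = (\<Prod>i\<in>{1..n}. measure \<mu> (?A i))"
  proof (rule prod.cong[OF refl])
    fix i assume "i \<in> {1..n}"
    then show "prob (X i -` ?A i \<inter> space M) = measure \<mu> (?A i)"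
      using prob_X[of i "?A i"] by (simp add: vimage_def Int_def conj_commute)
  qed
  also have "\<dots> = measure \<mu> (?A k) * (\<Prod>i\<in>{1..n} - {k}. measure \<mu> (?A i))"
    using k by (intro prod.remove) auto
  also have "(\<Prod>i\<in>{1..n} - {k}. measure \<mu> (?A i)) = (\<Prod>i\<in>{1..n} - {k}. body_mass B)"
    by (intro prod.cong) (auto simp: body_mass_def)
  also have "\<dots> = body_mass B ^ (n - 1)" using k by simp
  finally show ?thesis by (simp add: \<mu>_tail)
qed

definition two_jumps :: "nat \<Rightarrow> real \<Rightarrow> real \<Rightarrow> 'a set" where
  "two_jumps n B u = {\<omega> \<in> space M. (\<Sum>i=1..n. X_plus i \<omega>) > u \<and> (\<exists>i\<in>{1..n}. \<exists>j\<in>{1..n}. i \<noteq> j \<and> X i \<omega> > B \<and> X j \<omega> > B)}"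

lemma two_jumps_measurable: "two_jumps n B u \<in> events"
proof -
  have [measurable]: "random_variable borel (X i)" "random_variable borel (X_plus i)" if "i \<in> {1..n}" for i
    using that X_measurable X_plus_measurable by auto
  show ?thesis unfolding two_jumps_def by measurable
qed

text \<open>
The events that one claim exceeds $u$ and all others stay in $[-B,B]$ are disjoint from each
other and from the two-jump event, and all of them force the sum to exceed $u$. For large $B$ they already
exhaust the asymptotic probability $n\overline F(u)$ of the sum.
\<close>
lemma two_jumps_negligible:
  assumes n: "n \<ge> 1" and \<epsilon>: "\<epsilon> > 0"
  obtains B where "B \<ge> 0" "eventually (\<lambda>u. prob (two_jumps n B u) \<le> \<epsilon> * tail F u) at_top"
proof -
  have "((\<lambda>B. real n * body_mass B ^ (n - 1)) \<longlongrightarrow> real n * 1 ^ (n - 1)) at_top"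
    by (intro tendsto_intros body_mass_tendsto_1)
  then have "eventually (\<lambda>B. real n * body_mass B ^ (n - 1) > real n - \<epsilon> / 2) at_top"
    using \<epsilon> by (intro order_tendstoD(1)) auto
  from eventually_happens[OF eventually_conj[OF this eventually_ge_at_top[of 0]]]
  obtain B where B: "real n * body_mass B ^ (n - 1) > real n - \<epsilon> / 2" "B \<ge> 0" by auto
  have [measurable]: "random_variable borel (X_plus i)" if "i \<in> {1..n}" for i
    using that X_plus_measurable by auto
  show ?thesis
  proof (rule that[OF B(2)])
    show "eventually (\<lambda>u. prob (two_jumps n B u) \<le> \<epsilon> * tail F u) at_top"
      using sum_tail_bound[OF n half_gt_zero[OF \<epsilon>]] eventually_ge_at_top[of B]
    proof eventually_elim
      case (elim u)
      let ?J = "\<Union>k\<in>{1..n}. one_jump n B k u"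
      let ?S = "{\<omega> \<in> space M. (\<Sum>i=1..n. X_plus i \<omega>) > u}"
      have J: "prob ?J = (\<Sum>k\<in>{1..n}. prob (one_jump n B k u))"
      proof (rule finite_measure_finite_Union)
        show "disjoint_family_on (\<lambda>k. one_jump n B k u) {1..n}"
        proof (unfold disjoint_family_on_def, intro ballI impI)
          fix i k assume "i \<in> {1..n}" "k \<in> {1..n}" "i \<noteq> k"
          then have "X i \<omega> \<le> B" if "\<omega> \<in> one_jump n B k u" for \<omega>
            using that by (auto simp: one_jump_def abs_le_iff)
          moreover have "X i \<omega> > B" if "\<omega> \<in> one_jump n B i u" for \<omega>
            using that elim by (auto simp: one_jump_def)
          ultimately show "one_jump n B i u \<inter> one_jump n B k u = {}" by force
        qed
      qed (auto simp: one_jump_measurable)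
      have "prob (two_jumps n B u) + prob ?J = prob (two_jumps n B u \<union> ?J)"
      proof (rule finite_measure_Union[symmetric])
        have False if two: "\<omega> \<in> two_jumps n B u" and one: "\<omega> \<in> one_jump n B k u" and k: "k \<in> {1..n}" for \<omega> k
        proof -
          obtain i j where ij: "i \<in> {1..n}" "j \<in> {1..n}" "i \<noteq> j" "X i \<omega> > B" "X j \<omega> > B"
            using two by (auto simp: two_jumps_def)
          have "X l \<omega> \<le> B" if "l \<in> {1..n}" "l \<noteq> k" for l
          proof -
            have "\<bar>X l \<omega>\<bar> \<le> B" using one that by (simp add: one_jump_def)
            then show ?thesis by simp
          qed
          then have "i = k" "j = k" using ij by force+
          then show False using ij by simp
        qed
        then show "two_jumps n B u \<inter> ?J = {}" by blast
      qed (auto simp: two_jumps_measurable intro!: sets.finite_UN one_jump_measurable)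
      also have "\<dots> \<le> prob ?S"
      proof (rule finite_measure_mono)
        have "(\<Sum>i=1..n. X_plus i \<omega>) > u" if "\<omega> \<in> one_jump n B k u" "k \<in> {1..n}" for \<omega> k
        proof -
          have "u < X_plus k \<omega>" using that by (auto simp: one_jump_def X_plus_def)
          also have "\<dots> \<le> (\<Sum>i=1..n. X_plus i \<omega>)" using that by (intro member_le_sum) (auto simp: X_plus_nonneg)
          finally show ?thesis .
        qed
        then show "two_jumps n B u \<union> ?J \<subseteq> ?S" by (auto simp: two_jumps_def one_jump_def)
      qed measurable
      also have "\<dots> \<le> (real n + \<epsilon> / 2) * tail F u" by (rule elim(1))
      finally have "prob (two_jumps n B u) \<le> (real n + \<epsilon> / 2 - real n * body_mass B ^ (n - 1)) * tail F u"
        using J by (simp add: prob_one_jump algebra_simps)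
      also have "\<dots> \<le> \<epsilon> * tail F u" using B(1) F_tail_pos[of u] by (intro mult_right_mono) auto
      finally show ?case .
    qed
  qed
qed

text \<open>
One big jump, uniformly in the weights. After division by the largest weight $p$ all weights are at
most 1. If no single term comes within the distance $A = nB$ of the level $u/p$, the largest term and a
second one exceed $B$, and a sum of unweighted claims exceeds $u/p$; the weights have disappeared from this event.
\<close>
lemma weighted_sum_bound:
  assumes n: "n \<ge> 1" and b: "b > 0" and \<epsilon>: "\<epsilon> > 0"
  obtains C where "eventually (\<lambda>u. \<forall>c. (\<forall>i\<in>{1..n}. 0 < c i \<and> c i \<le> b) \<longrightarrow>
     prob {\<omega> \<in> space M. (\<Sum>i=1..n. c i * X_plus i \<omega>) > u} \<le>
       (\<Sum>i=1..n. tail F ((u - C) / c i)) + \<epsilon> * (\<Sum>i=1..n. tail F (u / c i))) at_top"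
proof -
  obtain B where B: "B \<ge> 0" "eventually (\<lambda>u. prob (two_jumps n B u) \<le> \<epsilon> * tail F u) at_top"
    using two_jumps_negligible[OF n \<epsilon>] .
  from B(2) obtain u1 where u1: "\<And>u. u \<ge> u1 \<Longrightarrow> prob (two_jumps n B u) \<le> \<epsilon> * tail F u"
    by (auto simp: eventually_at_top_linorder)
  define A where "A = real n * B"
  have A: "A \<ge> 0" using B by (simp add: A_def)
  have [measurable]: "random_variable borel (X i)" "random_variable borel (X_plus i)" if "i \<in> {1..n}" for i
    using that X_measurable X_plus_measurable by auto
  show ?thesis
  proof (rule that[of "b * A"])
    show "eventually (\<lambda>u. \<forall>c. (\<forall>i\<in>{1..n}. 0 < c i \<and> c i \<le> b) \<longrightarrow>
     prob {\<omega> \<in> space M. (\<Sum>i=1..n. c i * X_plus i \<omega>) > u} \<le>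
       (\<Sum>i=1..n. tail F ((u - b * A) / c i)) + \<epsilon> * (\<Sum>i=1..n. tail F (u / c i))) at_top"
      using eventually_ge_at_top[of "max (b * u1) (b * A)"]
    proof eventually_elim
      case (elim u)
      have "b * A \<ge> 0" using A b by simp
      then have u: "u \<ge> b * u1" "u \<ge> b * A" "u \<ge> 0" using elim by simp_all
      show ?case
      proof (intro allI impI)
        fix c :: "nat \<Rightarrow> real" assume c: "\<forall>i\<in>{1..n}. 0 < c i \<and> c i \<le> b"
        \<comment> \<open>the largest weight; \<open>d\<close> below are the terms of the rescaled sum\<close>
        define p where "p = Max (c ` {1..n})"
        have "p \<in> c ` {1..n}" unfolding p_def using n by (intro Max_in) auto
        then obtain k where k: "k \<in> {1..n}" "p = c k" by auto
        have p: "0 < p" "p \<le> b" using c k by auto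
        have cp: "c i \<le> p" if "i \<in> {1..n}" for i unfolding p_def using that by (intro Max_ge) auto
        define U where "U = u / p"
        have "u / b \<le> U" unfolding U_def using p u b by (intro divide_left_mono) auto
        moreover have "u1 \<le> u / b" using u b by (simp add: field_simps)
        ultimately have U: "u1 \<le> U" by simp
        let ?E = "{\<omega> \<in> space M. (\<Sum>i=1..n. c i * X_plus i \<omega>) > u}"
        let ?G = "\<lambda>i. {\<omega> \<in> space M. X i \<omega> > (u - b * A) / c i}"
        have incl: "?E \<subseteq> (\<Union>i\<in>{1..n}. ?G i) \<union> two_jumps n B U"
        proof
          fix \<omega> assume \<omega>: "\<omega> \<in> ?E"
          show "\<omega> \<in> (\<Union>i\<in>{1..n}. ?G i) \<union> two_jumps n B U"
          proof (cases "\<omega> \<in> (\<Union>i\<in>{1..n}. ?G i)")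
            case False
            define d where "d i = c i * X_plus i \<omega> / p" for i
            have d_le: "d i \<le> U - A" if i: "i \<in> {1..n}" for i
            proof -
              have ci: "c i > 0" using c i by auto
              have "X i \<omega> \<le> (u - b * A) / c i" using False \<omega> i by (auto simp: not_less)
              moreover have "0 \<le> (u - b * A) / c i" using u ci by simp
              ultimately have "X_plus i \<omega> \<le> (u - b * A) / c i" by (simp add: X_plus_def)
              then have "c i * X_plus i \<omega> \<le> u - b * A" using ci by (simp add: field_simps)
              also have "\<dots> \<le> u - p * A" using p A by (simp add: mult_right_mono)
              finally show ?thesis using p by (simp add: d_def U_def field_simps)
            qed
            have d_X_plus: "d i \<le> X_plus i \<omega>" if "i \<in> {1..n}" for i
              using mult_right_mono[OF cp[OF that] X_plus_nonneg[of i \<omega>]] p by (simp add: d_def field_simps)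
            have sum_d: "(\<Sum>i=1..n. d i) > U"
            proof -
              have "(\<Sum>i=1..n. d i) = (\<Sum>i=1..n. c i * X_plus i \<omega>) / p" by (simp add: d_def sum_divide_distrib)
              then show ?thesis using \<omega> p by (simp add: U_def divide_strict_right_mono)
            qed
            have "Max (d ` {1..n}) \<in> d ` {1..n}" using n by (intro Max_in) auto
            then obtain i where i: "i \<in> {1..n}" "d i = Max (d ` {1..n})" by auto
            have i_max: "d j \<le> d i" if "j \<in> {1..n}" for j using i that by simp
            have "\<exists>j\<in>{1..n} - {i}. d j > B"
            proof (rule ccontr)
              assume "\<not> (\<exists>j\<in>{1..n} - {i}. d j > B)"
              then have le: "\<forall>j\<in>{1..n} - {i}. d j \<le> B" by (simp add: not_less)
              have "(\<Sum>j\<in>{1..n} - {i}. d j) \<le> real (card ({1..n} - {i})) * B"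
                by (rule sum_bounded_above) (use le in blast)
              also have "\<dots> \<le> A" unfolding A_def using B(1) by (intro mult_right_mono) (auto simp: card_Diff_singleton_if)
              finally have "(\<Sum>j\<in>{1..n} - {i}. d j) \<le> A" .
              moreover have "(\<Sum>j=1..n. d j) = d i + (\<Sum>j\<in>{1..n} - {i}. d j)"
                using i by (intro sum.remove) auto
              ultimately show False using sum_d d_le[OF i(1)] by linarith
            qed
            then obtain j where "j \<in> {1..n} - {i}" "d j > B" by (rule bexE)
            then have j: "j \<in> {1..n}" "j \<noteq> i" "d j > B" by simp_all
            have big: "X k \<omega> > B" if "k \<in> {1..n}" "d k > B" for k
              using d_X_plus[OF that(1)] that(2) B(1) by (auto simp: X_plus_def max_def split: if_splits)
            have "X i \<omega> > B" "X j \<omega> > B" using big i(1) j i_max[OF j(1)] by auto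
            moreover have "(\<Sum>i=1..n. X_plus i \<omega>) > U"
              using sum_d sum_mono[of "{1..n}" d "\<lambda>i. X_plus i \<omega>"] d_X_plus by fastforce
            moreover have "\<omega> \<in> space M" using \<omega> by simp
            ultimately have "\<omega> \<in> two_jumps n B U"
              unfolding two_jumps_def using i(1) j(1) j(2)[symmetric] by blast
            then show ?thesis ..
          qed simp
        qed
        have "prob ?E \<le> prob ((\<Union>i\<in>{1..n}. ?G i) \<union> two_jumps n B U)"
          using incl by (rule finite_measure_mono) (auto intro!: two_jumps_measurable sets.Un)
        also have "\<dots> \<le> prob (\<Union>i\<in>{1..n}. ?G i) + prob (two_jumps n B U)"
          by (rule measure_Un_le) (auto intro!: two_jumps_measurable)
        also have "prob (\<Union>i\<in>{1..n}. ?G i) \<le> (\<Sum>i=1..n. prob (?G i))"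
          by (rule measure_UNION_le) auto
        also have "\<dots> = (\<Sum>i=1..n. tail F ((u - b * A) / c i))"
          by (intro sum.cong refl prob_X_gt) auto
        also have "prob (two_jumps n B U) \<le> \<epsilon> * tail F U" by (rule u1[OF U])
        also have "\<epsilon> * tail F U \<le> \<epsilon> * (\<Sum>i=1..n. tail F (u / c i))"
        proof (rule mult_left_mono)
          show "tail F U \<le> (\<Sum>i=1..n. tail F (u / c i))"
            unfolding U_def k(2) using k(1) F_tail_pos
            by (intro member_le_sum[of k "{1..n}" "\<lambda>i. tail F (u / c i)"]) (auto simp: less_imp_le)
        qed (use \<epsilon> in simp)
        finally show "prob ?E \<le> (\<Sum>i=1..n. tail F ((u - b * A) / c i)) + \<epsilon> * (\<Sum>i=1..n. tail F (u / c i))"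
          by simp
      qed
    qed
  qed
qed

end

section \<open>Level crossing of a randomly weighted sum\<close>

lemma sum_ratio_tendsto_1:
  fixes f g :: "'i \<Rightarrow> 'b \<Rightarrow> real"
  assumes I: "finite I" "I \<noteq> {}" and g: "\<And>i x. i \<in> I \<Longrightarrow> g i x > 0"
    and lim: "\<And>i. i \<in> I \<Longrightarrow> ((\<lambda>x. f i x / g i x) \<longlongrightarrow> 1) \<F>"
  shows "((\<lambda>x. (\<Sum>i\<in>I. f i x) / (\<Sum>i\<in>I. g i x)) \<longlongrightarrow> 1) \<F>"
proof -
  have "((\<lambda>x. \<Sum>i\<in>I. \<bar>f i x / g i x - 1\<bar>) \<longlongrightarrow> (\<Sum>i\<in>I. \<bar>1 - 1\<bar>)) \<F>"
    by (intro tendsto_intros lim)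
  then have null: "((\<lambda>x. \<Sum>i\<in>I. \<bar>f i x / g i x - 1\<bar>) \<longlongrightarrow> 0) \<F>" by simp
  have "((\<lambda>x. (\<Sum>i\<in>I. f i x) / (\<Sum>i\<in>I. g i x) - 1) \<longlongrightarrow> 0) \<F>"
  proof (rule Lim_null_comparison[OF always_eventually null], intro allI)
    fix x
    define G where "G = (\<Sum>i\<in>I. g i x)"
    have G: "G > 0" unfolding G_def using I g by (intro sum_pos) auto
    have le: "\<bar>f i x - g i x\<bar> \<le> \<bar>f i x / g i x - 1\<bar> * G" if i: "i \<in> I" for i
    proof -
      have "\<bar>f i x - g i x\<bar> = \<bar>(f i x / g i x - 1) * g i x\<bar>" using g[OF i, of x] by (simp add: left_diff_distrib)
      also have "\<dots> = \<bar>f i x / g i x - 1\<bar> * g i x" using g[OF i, of x] by (simp only: abs_mult abs_of_pos)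
      also have "\<dots> \<le> \<bar>f i x / g i x - 1\<bar> * G"
        unfolding G_def using i I g by (intro mult_left_mono member_le_sum) (auto simp: less_imp_le)
      finally show ?thesis .
    qed
    have "norm ((\<Sum>i\<in>I. f i x) / G - 1) = \<bar>\<Sum>i\<in>I. f i x - g i x\<bar> / G"
      using G by (simp add: sum_subtractf G_def[symmetric] diff_divide_distrib[symmetric] abs_divide divide_diff_eq_iff)
    also have "\<dots> \<le> (\<Sum>i\<in>I. \<bar>f i x - g i x\<bar>) / G" using G by (intro divide_right_mono sum_abs) auto
    also have "\<dots> \<le> (\<Sum>i\<in>I. \<bar>f i x / g i x - 1\<bar> * G) / G"
      using G by (intro divide_right_mono sum_mono le) auto
    also have "\<dots> = (\<Sum>i\<in>I. \<bar>f i x / g i x - 1\<bar>)" using G by (simp flip: sum_distrib_right)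
    finally show "norm ((\<Sum>i\<in>I. f i x) / (\<Sum>i\<in>I. g i x) - 1) \<le> (\<Sum>i\<in>I. \<bar>f i x / g i x - 1\<bar>)"
      by (simp only: G_def)
  qed
  from tendsto_add[OF this tendsto_const[of 1]] show ?thesis by simp
qed

text \<open>
Claims with random weights that are functions of an independent $Y$. The weights may depend on each
other in any way; boundedness is what makes conditioning on them uniform.
\<close>
locale weighted_claims = subexponential_iid M X \<mu> F
  for M :: "'a measure" and X \<mu> F +
  fixes T :: "(nat \<Rightarrow> real) measure" and Y :: "'a \<Rightarrow> nat \<Rightarrow> real"
    and \<theta> :: "nat \<Rightarrow> (nat \<Rightarrow> real) \<Rightarrow> real" and b :: real and n :: nat
  assumes XY_indep: "indep_var (Pi\<^sub>M {1..} (\<lambda>_. borel)) (\<lambda>\<omega>. \<lambda>i\<in>{1..}. X i \<omega>) T Y"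
    and \<theta>_measurable: "\<And>i. i \<in> {1..n} \<Longrightarrow> \<theta> i \<in> borel_measurable T"
    and \<theta>_range: "\<And>i \<omega>. i \<in> {1..n} \<Longrightarrow> \<omega> \<in> space M \<Longrightarrow> 0 < \<theta> i (Y \<omega>) \<and> \<theta> i (Y \<omega>) \<le> b"
    and n_ge_1: "n \<ge> 1"
begin

lemma Y_measurable [measurable]: "random_variable T Y"
  using XY_indep by (rule indep_var_rv2)

lemma \<theta>Y_measurable: "i \<in> {1..n} \<Longrightarrow> random_variable borel (\<lambda>\<omega>. \<theta> i (Y \<omega>))"
  using \<theta>_measurable by measurable

lemma b_pos: "b > 0"
proof -
  obtain \<omega> where "\<omega> \<in> space M" using not_empty by blast
  then show ?thesis using \<theta>_range[of 1 \<omega>] n_ge_1 by force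
qed

definition jump_prob :: "nat \<Rightarrow> real \<Rightarrow> real" where
  "jump_prob k u = (\<integral>\<omega>. tail F (u / \<theta> k (Y \<omega>)) \<partial>M)"

lemma integrable_jump: "k \<in> {1..n} \<Longrightarrow> integrable M (\<lambda>\<omega>. tail F (u / \<theta> k (Y \<omega>)))"
proof (rule integrable_const_bound[where B = 1])
  assume "k \<in> {1..n}"
  note [measurable] = \<theta>Y_measurable[OF this] antimono_borel_measurable[OF tail_antimono[OF F_distribution]]
  show "(\<lambda>\<omega>. tail F (u / \<theta> k (Y \<omega>))) \<in> borel_measurable M" by measurable
  show "AE \<omega> in M. norm (tail F (u / \<theta> k (Y \<omega>))) \<le> 1"
    using F_tail_pos F_tail_le_1 by (intro AE_I2) (simp add: less_imp_le)
qed

lemma jump_prob_pos: "k \<in> {1..n} \<Longrightarrow> jump_prob k u > 0"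
  unfolding jump_prob_def by (rule expectation_greater) (auto intro: integrable_jump F_tail_pos)

lemma component_measurable:
  "i \<in> {1..n} \<Longrightarrow> (\<lambda>z. fst z i) \<in> borel_measurable (Pi\<^sub>M {1..} (\<lambda>_. borel) \<Otimes>\<^sub>M T)"
  "i \<in> {1..n} \<Longrightarrow> (\<lambda>z. \<theta> i (snd z)) \<in> borel_measurable (Pi\<^sub>M {1..} (\<lambda>_. borel) \<Otimes>\<^sub>M T)"
proof -
  assume i: "i \<in> {1..n}"
  show "(\<lambda>z. \<theta> i (snd z)) \<in> borel_measurable (Pi\<^sub>M {1..} (\<lambda>_. borel) \<Otimes>\<^sub>M T)"
    by (rule measurable_compose[OF measurable_snd \<theta>_measurable[OF i]])
  have "(\<lambda>x. x i) \<in> borel_measurable (Pi\<^sub>M {1..} (\<lambda>_. borel))"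
    using i by (intro measurable_component_singleton) auto
  then show "(\<lambda>z. fst z i) \<in> borel_measurable (Pi\<^sub>M {1..} (\<lambda>_. borel) \<Otimes>\<^sub>M T)"
    by (rule measurable_compose[OF measurable_fst])
qed

lemma weighted_positive_sum_bound:
  assumes \<epsilon>: "\<epsilon> > 0"
  obtains C where "eventually (\<lambda>u. prob {\<omega> \<in> space M. (\<Sum>i=1..n. \<theta> i (Y \<omega>) * X_plus i \<omega>) > u} \<le>
       (\<Sum>i=1..n. jump_prob i (u - C)) + \<epsilon> * (\<Sum>i=1..n. jump_prob i u)) at_top"
proof -
  note [measurable] = component_measurable
  obtain C where C: "eventually (\<lambda>u. \<forall>c. (\<forall>i\<in>{1..n}. 0 < c i \<and> c i \<le> b) \<longrightarrow>
     prob {\<omega> \<in> space M. (\<Sum>i=1..n. c i * X_plus i \<omega>) > u} \<le>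
       (\<Sum>i=1..n. tail F ((u - C) / c i)) + \<epsilon> * (\<Sum>i=1..n. tail F (u / c i))) at_top"
    using weighted_sum_bound[OF n_ge_1 b_pos \<epsilon>] .
  show ?thesis
  proof (rule that[of C])
    from C show "eventually (\<lambda>u. prob {\<omega> \<in> space M. (\<Sum>i=1..n. \<theta> i (Y \<omega>) * X_plus i \<omega>) > u} \<le>
       (\<Sum>i=1..n. jump_prob i (u - C)) + \<epsilon> * (\<Sum>i=1..n. jump_prob i u)) at_top"
    proof eventually_elim
      case (elim u)
      let ?P = "\<lambda>x y. (\<Sum>i=1..n. \<theta> i y * max 0 (x i)) > u"
      let ?X = "\<lambda>\<omega>. \<lambda>i\<in>{1..}. X i \<omega>"
      have sum_eq: "(\<Sum>i=1..n. \<theta> i y * max 0 (?X \<omega> i)) = (\<Sum>i=1..n. \<theta> i y * X_plus i \<omega>)" for \<omega> y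
        by (rule sum.cong) (auto simp: X_plus_def)
      have meas: "Measurable.pred (Pi\<^sub>M {1..} (\<lambda>_. borel) \<Otimes>\<^sub>M T) (\<lambda>z. ?P (fst z) (snd z))" by measurable
      note fubini = indep_var_prob[OF XY_indep, where P = ?P, OF meas, unfolded sum_eq]
      have "prob {\<omega> \<in> space M. (\<Sum>i=1..n. \<theta> i (Y \<omega>) * X_plus i \<omega>) > u} =
          (\<integral>\<omega>'. prob {\<omega> \<in> space M. (\<Sum>i=1..n. \<theta> i (Y \<omega>') * X_plus i \<omega>) > u} \<partial>M)" by (rule fubini(1))
      also have "\<dots> \<le> (\<integral>\<omega>'. (\<Sum>i=1..n. tail F ((u - C) / \<theta> i (Y \<omega>'))) + \<epsilon> * (\<Sum>i=1..n. tail F (u / \<theta> i (Y \<omega>'))) \<partial>M)"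
      proof (rule integral_mono[OF fubini(2)])
        show "integrable M (\<lambda>\<omega>'. (\<Sum>i=1..n. tail F ((u - C) / \<theta> i (Y \<omega>'))) + \<epsilon> * (\<Sum>i=1..n. tail F (u / \<theta> i (Y \<omega>'))))"
          by (intro Bochner_Integration.integrable_add Bochner_Integration.integrable_sum integrable_mult_right integrable_jump)
        fix \<omega>' assume "\<omega>' \<in> space M"
        then show "prob {\<omega> \<in> space M. (\<Sum>i=1..n. \<theta> i (Y \<omega>') * X_plus i \<omega>) > u} \<le>
            (\<Sum>i=1..n. tail F ((u - C) / \<theta> i (Y \<omega>'))) + \<epsilon> * (\<Sum>i=1..n. tail F (u / \<theta> i (Y \<omega>')))"
          using elim[rule_format, of "\<lambda>i. \<theta> i (Y \<omega>')"] \<theta>_range by blast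
      qed
      also have "\<dots> = (\<Sum>i=1..n. jump_prob i (u - C)) + \<epsilon> * (\<Sum>i=1..n. jump_prob i u)"
        unfolding jump_prob_def
        by (subst Bochner_Integration.integral_add)
          (auto intro!: Bochner_Integration.integrable_sum integrable_mult_right integrable_jump
            simp: Bochner_Integration.integral_sum integrable_jump)
      finally show ?case .
    qed
  qed
qed

definition single_jump :: "real \<Rightarrow> nat \<Rightarrow> real \<Rightarrow> 'a set" where
  "single_jump B k u = {\<omega> \<in> space M. X k \<omega> > u / \<theta> k (Y \<omega>) \<and> (\<forall>i\<in>{1..n} - {k}. \<bar>X i \<omega>\<bar> \<le> B)}"

lemma single_jump_measurable: "k \<in> {1..n} \<Longrightarrow> single_jump B k u \<in> events"
proof -
  assume k: "k \<in> {1..n}"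
  have [measurable]: "random_variable borel (X i)" if "i \<in> {1..n} - {k}" for i using that X_measurable by auto
  have [measurable]: "random_variable borel (X k)" using k X_measurable by auto
  note [measurable] = \<theta>Y_measurable[OF k]
  show ?thesis unfolding single_jump_def by measurable
qed

lemma prob_single_jump:
  assumes k: "k \<in> {1..n}"
  shows "prob (single_jump B k u) = body_mass B ^ (n - 1) * jump_prob k u"
proof -
  note [measurable] = component_measurable
  let ?P = "\<lambda>x y. x k > u / \<theta> k y \<and> (\<forall>i\<in>{1..n} - {k}. \<bar>x i\<bar> \<le> B)"
  let ?X = "\<lambda>\<omega>. \<lambda>i\<in>{1..}. X i \<omega>"
  have [measurable]: "(\<lambda>z. fst z k) \<in> borel_measurable (Pi\<^sub>M {1..} (\<lambda>_. borel) \<Otimes>\<^sub>M T)"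
    "(\<lambda>z. \<theta> k (snd z)) \<in> borel_measurable (Pi\<^sub>M {1..} (\<lambda>_. borel) \<Otimes>\<^sub>M T)"
    by (rule component_measurable[OF k])+
  have [measurable]: "(\<lambda>z. fst z i) \<in> borel_measurable (Pi\<^sub>M {1..} (\<lambda>_. borel) \<Otimes>\<^sub>M T)" if "i \<in> {1..n} - {k}" for i
    using that by (intro component_measurable) auto
  have P_eq: "?P (?X \<omega>) y \<longleftrightarrow> X k \<omega> > u / \<theta> k y \<and> (\<forall>i\<in>{1..n} - {k}. \<bar>X i \<omega>\<bar> \<le> B)" for \<omega> y
    using k by auto
  have meas: "Measurable.pred (Pi\<^sub>M {1..} (\<lambda>_. borel) \<Otimes>\<^sub>M T) (\<lambda>z. ?P (fst z) (snd z))" by measurable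
  have "prob (single_jump B k u) = (\<integral>\<omega>'. prob (one_jump n B k (u / \<theta> k (Y \<omega>'))) \<partial>M)"
    unfolding single_jump_def one_jump_def
    using indep_var_prob(1)[OF XY_indep, where P = ?P, OF meas, unfolded P_eq] .
  also have "\<dots> = body_mass B ^ (n - 1) * jump_prob k u"
    unfolding jump_prob_def prob_one_jump[OF k] by simp
  finally show ?thesis .
qed

definition crossing_prob :: "real \<Rightarrow> real" where
  "crossing_prob u = prob {\<omega> \<in> space M. \<exists>k\<in>{1..n}. (\<Sum>i=1..k. \<theta> i (Y \<omega>) * X i \<omega>) > u}"

lemma crossing_upper_bound:
  "crossing_prob u \<le> prob {\<omega> \<in> space M. (\<Sum>i=1..n. \<theta> i (Y \<omega>) * X_plus i \<omega>) > u}"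
  unfolding crossing_prob_def
proof (rule finite_measure_mono)
  have [measurable]: "random_variable borel (X_plus i)" "random_variable borel (\<lambda>\<omega>. \<theta> i (Y \<omega>))" if "i \<in> {1..n}" for i
    using that X_plus_measurable \<theta>Y_measurable by auto
  show "{\<omega> \<in> space M. (\<Sum>i=1..n. \<theta> i (Y \<omega>) * X_plus i \<omega>) > u} \<in> events" by measurable
  have "(\<Sum>i=1..k. \<theta> i (Y \<omega>) * X i \<omega>) \<le> (\<Sum>i=1..n. \<theta> i (Y \<omega>) * X_plus i \<omega>)"
    if "\<omega> \<in> space M" "k \<in> {1..n}" for \<omega> k
  proof -
    have "(\<Sum>i=1..k. \<theta> i (Y \<omega>) * X i \<omega>) \<le> (\<Sum>i=1..k. \<theta> i (Y \<omega>) * X_plus i \<omega>)"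
      using that \<theta>_range by (intro sum_mono mult_left_mono) (auto simp: X_plus_def less_imp_le)
    also have "\<dots> \<le> (\<Sum>i=1..n. \<theta> i (Y \<omega>) * X_plus i \<omega>)"
      using that \<theta>_range X_plus_nonneg by (intro sum_mono2) (auto intro!: mult_nonneg_nonneg simp: less_imp_le)
    finally show ?thesis .
  qed
  then show "{\<omega> \<in> space M. \<exists>k\<in>{1..n}. (\<Sum>i=1..k. \<theta> i (Y \<omega>) * X i \<omega>) > u}
      \<subseteq> {\<omega> \<in> space M. (\<Sum>i=1..n. \<theta> i (Y \<omega>) * X_plus i \<omega>) > u}"
    by (auto intro: less_le_trans)
qed

lemma crossing_lower_bound:
  assumes B: "B \<ge> 0" and u: "u \<ge> b * B"
  shows "body_mass B ^ (n - 1) * (\<Sum>k=1..n. jump_prob k (u + real n * (b * B))) \<le> crossing_prob u"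
proof -
  define v where "v = u + real n * (b * B)"
  have bB: "b * B \<ge> 0" using b_pos B by simp
  have v: "v \<ge> u" using bB by (simp add: v_def)
  have [measurable]: "random_variable borel (X i)" "random_variable borel (\<lambda>\<omega>. \<theta> i (Y \<omega>))" if "i \<in> {1..n}" for i
    using that X_measurable \<theta>Y_measurable by auto
  have big: "X k \<omega> > B" if \<omega>: "\<omega> \<in> single_jump B k v" and k: "k \<in> {1..n}" for k \<omega>
  proof -
    have \<theta>: "0 < \<theta> k (Y \<omega>)" "\<theta> k (Y \<omega>) \<le> b" using \<theta>_range[OF k, of \<omega>] \<omega> by (auto simp: single_jump_def)
    have "B * \<theta> k (Y \<omega>) \<le> B * b" using \<theta> B by (intro mult_left_mono)
    also have "\<dots> \<le> v" using u v by (simp add: mult.commute)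
    finally have "B \<le> v / \<theta> k (Y \<omega>)" using \<theta> by (simp add: pos_le_divide_eq)
    then show ?thesis using \<omega> by (auto simp: single_jump_def)
  qed
  have "body_mass B ^ (n - 1) * (\<Sum>k=1..n. jump_prob k v) = (\<Sum>k\<in>{1..n}. prob (single_jump B k v))"
    by (simp add: prob_single_jump sum_distrib_left)
  also have "\<dots> = prob (\<Union>k\<in>{1..n}. single_jump B k v)"
  proof (rule finite_measure_finite_Union[symmetric])
    show "disjoint_family_on (\<lambda>k. single_jump B k v) {1..n}"
    proof (unfold disjoint_family_on_def, intro ballI impI)
      fix i k assume ik: "i \<in> {1..n}" "k \<in> {1..n}" "i \<noteq> k"
      have "X i \<omega> \<le> B" if "\<omega> \<in> single_jump B k v" for \<omega>
      proof -
        have "\<bar>X i \<omega>\<bar> \<le> B" using that ik by (simp add: single_jump_def)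
        then show ?thesis by simp
      qed
      then show "single_jump B i v \<inter> single_jump B k v = {}" using big ik by force
    qed
  qed (auto intro: single_jump_measurable)
  also have "\<dots> \<le> crossing_prob u"
    unfolding crossing_prob_def
  proof (rule finite_measure_mono)
    have "(\<Sum>i=1..k. \<theta> i (Y \<omega>) * X i \<omega>) > u" if \<omega>: "\<omega> \<in> single_jump B k v" and k: "k \<in> {1..n}" for \<omega> k
    proof -
      have \<omega>': "\<omega> \<in> space M" "X k \<omega> > v / \<theta> k (Y \<omega>)" using \<omega> by (auto simp: single_jump_def)
      have small: "\<bar>X i \<omega>\<bar> \<le> B" if "i \<in> {1..n}" "i \<noteq> k" for i using \<omega> that by (simp add: single_jump_def)
      have "v < \<theta> k (Y \<omega>) * X k \<omega>"
        using \<omega>' \<theta>_range[OF k \<omega>'(1)] by (simp add: pos_divide_less_eq mult.commute)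
      moreover have "(\<Sum>i\<in>{1..k} - {k}. - (b * B)) \<le> (\<Sum>i\<in>{1..k} - {k}. \<theta> i (Y \<omega>) * X i \<omega>)"
      proof (rule sum_mono)
        fix i assume "i \<in> {1..k} - {k}"
        then have i: "i \<in> {1..n}" "i \<noteq> k" using k by auto
        have \<theta>: "0 < \<theta> i (Y \<omega>)" "\<theta> i (Y \<omega>) \<le> b" using \<theta>_range[OF i(1) \<omega>'(1)] by auto
        have "\<bar>\<theta> i (Y \<omega>) * X i \<omega>\<bar> \<le> b * B"
          unfolding abs_mult using \<theta> small[OF i] by (intro mult_mono) auto
        then show "- (b * B) \<le> \<theta> i (Y \<omega>) * X i \<omega>" by linarith
      qed
      moreover have "(\<Sum>i=1..k. \<theta> i (Y \<omega>) * X i \<omega>) = \<theta> k (Y \<omega>) * X k \<omega> + (\<Sum>i\<in>{1..k} - {k}. \<theta> i (Y \<omega>) * X i \<omega>)"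
        using k by (intro sum.remove) auto
      moreover have "real (k - 1) * (b * B) \<le> real n * (b * B)"
        using k bB by (intro mult_right_mono) auto
      ultimately show ?thesis using k by (simp add: v_def)
    qed
    moreover have "single_jump B k v \<subseteq> space M" for k by (auto simp: single_jump_def)
    ultimately show "(\<Union>k\<in>{1..n}. single_jump B k v) \<subseteq> {\<omega> \<in> space M. \<exists>k\<in>{1..n}. (\<Sum>i=1..k. \<theta> i (Y \<omega>) * X i \<omega>) > u}"
      by blast
    have [measurable]: "random_variable borel (\<lambda>\<omega>. \<Sum>i=1..k. \<theta> i (Y \<omega>) * X i \<omega>)" if "k \<in> {1..n}" for k
      using that by (intro borel_measurable_sum borel_measurable_times) (auto intro: X_measurable \<theta>Y_measurable)
    show "{\<omega> \<in> space M. \<exists>k\<in>{1..n}. (\<Sum>i=1..k. \<theta> i (Y \<omega>) * X i \<omega>) > u} \<in> events" by measurable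
  qed
  finally show ?thesis by (simp only: v_def)
qed

text \<open>
The upper and lower bounds differ from the sum of the single-jump probabilities only by bounded
shifts of the level, by $\epsilon$, and by the mass of $[-B,B]$.
\<close>
theorem crossing_prob_asymptotics:
  assumes long: "\<And>k. k \<in> {1..n} \<Longrightarrow> long_tailed (jump_prob k)"
  shows "((\<lambda>u. crossing_prob u / (\<Sum>k=1..n. jump_prob k u)) \<longlongrightarrow> 1) at_top"
proof (rule order_tendstoI)
  define J where "J u = (\<Sum>k=1..n. jump_prob k u)" for u
  have J: "J u > 0" for u unfolding J_def using n_ge_1 jump_prob_pos by (intro sum_pos) auto
  have shift: "((\<lambda>u. J (u + c) / J u) \<longlongrightarrow> 1) at_top" for c
    unfolding J_def using n_ge_1 jump_prob_pos long
    by (intro sum_ratio_tendsto_1) (auto simp: long_tailed_def)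
  {
    fix a :: real assume a: "a < 1"
    have "((\<lambda>B. body_mass B ^ (n - 1)) \<longlongrightarrow> 1 ^ (n - 1)) at_top" by (intro tendsto_intros body_mass_tendsto_1)
    then have "eventually (\<lambda>B. body_mass B ^ (n - 1) > a) at_top" using a by (intro order_tendstoD(1)) auto
    from eventually_happens[OF eventually_conj[OF this eventually_ge_at_top[of 0]]]
    obtain B where B: "body_mass B ^ (n - 1) > a" "B \<ge> 0" by auto
    have "((\<lambda>u. body_mass B ^ (n - 1) * (J (u + real n * (b * B)) / J u)) \<longlongrightarrow> body_mass B ^ (n - 1) * 1) at_top"
      by (intro tendsto_intros shift)
    then have "eventually (\<lambda>u. body_mass B ^ (n - 1) * (J (u + real n * (b * B)) / J u) > a) at_top"
      using B by (intro order_tendstoD(1)) auto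
    then show "eventually (\<lambda>u. crossing_prob u / (\<Sum>k=1..n. jump_prob k u) > a) at_top"
      using eventually_ge_at_top[of "b * B"]
    proof eventually_elim
      case (elim u)
      have "body_mass B ^ (n - 1) * J (u + real n * (b * B)) / J u \<le> crossing_prob u / J u"
        using crossing_lower_bound[OF B(2) elim(2)] J[of u] by (intro divide_right_mono) (auto simp: J_def)
      then show ?case using elim(1) by (simp add: J_def)
    qed
  }
  {
    fix a :: real assume a: "a > 1"
    define \<epsilon> where "\<epsilon> = (a - 1) / 2"
    have \<epsilon>: "\<epsilon> > 0" "1 + \<epsilon> < a" using a by (auto simp: \<epsilon>_def field_simps)
    obtain C where C: "eventually (\<lambda>u. prob {\<omega> \<in> space M. (\<Sum>i=1..n. \<theta> i (Y \<omega>) * X_plus i \<omega>) > u} \<le>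
       (\<Sum>i=1..n. jump_prob i (u - C)) + \<epsilon> * (\<Sum>i=1..n. jump_prob i u)) at_top"
      using weighted_positive_sum_bound[OF \<epsilon>(1)] .
    have "((\<lambda>u. J (u + - C) / J u + \<epsilon>) \<longlongrightarrow> 1 + \<epsilon>) at_top" by (intro tendsto_add shift tendsto_const)
    then have "eventually (\<lambda>u. J (u + - C) / J u + \<epsilon> < a) at_top" by (rule order_tendstoD(2)) (rule \<epsilon>(2))
    with C show "eventually (\<lambda>u. crossing_prob u / (\<Sum>k=1..n. jump_prob k u) < a) at_top"
    proof eventually_elim
      case (elim u)
      have "crossing_prob u \<le> J (u - C) + \<epsilon> * J u"
        using order_trans[OF crossing_upper_bound elim(1)] by (simp add: J_def)
      then have "crossing_prob u / J u \<le> (J (u - C) + \<epsilon> * J u) / J u" using J[of u] by (intro divide_right_mono) auto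
      also have "\<dots> = J (u + - C) / J u + \<epsilon>" using J[of u] by (simp add: add_divide_distrib)
      finally show ?case using elim(2) by (simp add: J_def)
    qed
  }
qed

end

section \<open>Products of independent perturbed factors\<close>

definition (in prob_space) compound :: "(real \<Rightarrow> real) \<Rightarrow> (nat \<Rightarrow> 'a \<Rightarrow> real) \<Rightarrow> nat \<Rightarrow> real \<Rightarrow> real" where
  "compound H W k x = (\<integral>\<omega>. H (x * (\<Prod>i=1..k. 1 + W i \<omega>)) \<partial>M)"

lemma (in prob_space) compound_Suc:
  assumes W: "indep_vars (\<lambda>_. borel) W {1..n}" and k: "Suc k \<le> n" and H: "gumbel_tail H w"
  shows "compound H W (Suc k) x = (\<integral>\<omega>. compound H W k (x * (1 + W (Suc k) \<omega>)) \<partial>M)"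
proof -
  note [measurable] = gumbel_tailD(5)[OF H]
  have "indep_var (Pi\<^sub>M {1..k} (\<lambda>_. borel)) (\<lambda>\<omega>. \<lambda>i\<in>{1..k}. W i \<omega>) (Pi\<^sub>M {Suc k} (\<lambda>_. borel)) (\<lambda>\<omega>. \<lambda>i\<in>{Suc k}. W i \<omega>)"
    by (rule indep_var_restrict[OF W]) (use k in auto)
  from indep_var_compose[OF this, of "\<lambda>x. \<Prod>i=1..k. 1 + x i" borel "\<lambda>x. x (Suc k)" borel]
  have "indep_var borel ((\<lambda>x. \<Prod>i = 1..k. 1 + x i) \<circ> (\<lambda>\<omega>. \<lambda>i\<in>{1..k}. W i \<omega>))
       borel ((\<lambda>x. x (Suc k)) \<circ> (\<lambda>\<omega>. \<lambda>i\<in>{Suc k}. W i \<omega>))" by measurable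
  moreover have "(\<Prod>i=1..k. 1 + (\<lambda>i\<in>{1..k}. W i \<omega>) i) = (\<Prod>i=1..k. 1 + W i \<omega>)" for \<omega>
    by (rule prod.cong) auto
  ultimately have ind: "indep_var borel (\<lambda>\<omega>. \<Prod>i=1..k. 1 + W i \<omega>) borel (W (Suc k))"
    unfolding o_def by simp
  have "(\<integral>\<omega>. (\<lambda>z. H (x * (1 + snd z) * fst z)) (\<Prod>i=1..k. 1 + W i \<omega>, W (Suc k) \<omega>) \<partial>M) =
      (\<integral>\<omega>'. (\<integral>\<omega>. (\<lambda>z. H (x * (1 + snd z) * fst z)) (\<Prod>i=1..k. 1 + W i \<omega>, W (Suc k) \<omega>') \<partial>M) \<partial>M)"
  proof (rule indep_var_expectation[OF ind, where B = 1])
    show "\<bar>H (x * (1 + snd z) * fst z)\<bar> \<le> 1" for z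
      using gumbel_tailD(2,3)[OF H] by (simp add: less_imp_le)
  qed measurable
  then show ?thesis by (simp add: compound_def mult_ac)
qed

text \<open>
One factor at a time: each application of the averaging step contributes its own factor and keeps the scaling function.
\<close>
lemma (in prob_space) compound_asymptotics:
  assumes W: "indep_vars (\<lambda>_. borel) W {1..n}"
    and reg: "\<And>i. i \<in> {1..n} \<Longrightarrow> small_value_regular M (W i) (g i) (\<alpha> i)"
    and H: "gumbel_tail H w" and w: "scaling_function w" and k: "k \<le> n"
  shows "gumbel_tail (compound H W k) w \<and>
    ((\<lambda>x. compound H W k x / (H x * (\<Prod>i=1..k. g i (x * w x)))) \<longlongrightarrow> (\<Prod>i=1..k. Gamma (\<alpha> i + 1))) at_top"
  using k
proof (induction k)
  case 0
  have "compound H W 0 = H" by (simp add: compound_def fun_eq_iff prob_space)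
  moreover have "H x \<noteq> 0" for x using gumbel_tailD(2)[OF H, of x] by simp
  ultimately show ?case using H by simp
next
  case (Suc k)
  interpret S: small_value_regular M "W (Suc k)" "g (Suc k)" "\<alpha> (Suc k)"
    by (rule reg) (use Suc in auto)
  let ?H = "compound H W k"
  have IH: "gumbel_tail ?H w"
    "((\<lambda>x. ?H x / (H x * (\<Prod>i=1..k. g i (x * w x)))) \<longlongrightarrow> (\<Prod>i=1..k. Gamma (\<alpha> i + 1))) at_top"
    using Suc by auto
  have eq: "compound H W (Suc k) = S.dilate ?H"
    unfolding S.dilate_def by (rule ext, rule compound_Suc[OF W Suc.prems H])
  have Hp: "?H x \<noteq> 0" for x using gumbel_tailD(2)[OF IH(1), of x] by simp
  have "((\<lambda>x. (?H x / (H x * (\<Prod>i=1..k. g i (x * w x)))) * (S.dilate ?H x / (?H x * g (Suc k) (x * w x)))) \<longlongrightarrow>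
      (\<Prod>i=1..k. Gamma (\<alpha> i + 1)) * Gamma (\<alpha> (Suc k) + 1)) at_top"
    by (intro tendsto_mult IH(2) S.dilate_asymptotics[OF IH(1) w])
  moreover have "(?H x / (H x * (\<Prod>i=1..k. g i (x * w x)))) * (S.dilate ?H x / (?H x * g (Suc k) (x * w x))) =
      compound H W (Suc k) x / (H x * (\<Prod>i=1..Suc k. g i (x * w x)))" for x
    using Hp[of x] by (simp add: eq)
  ultimately show ?case using S.gumbel_tail_dilate[OF IH(1) w] by (simp add: eq)
qed

section \<open>The ruin probability\<close>

lemma regular_tail_dilated:
  fixes f :: "real \<Rightarrow> real"
  assumes f: "regularly_varying f (- \<alpha>)" "antimono f" "\<And>x. f x \<le> 1" and c: "c > 0"
  shows "regular_tail (\<lambda>x. f (c * x)) \<alpha>" and "f x > 0"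
    and "((\<lambda>x. f (c * x) / f x) \<longlongrightarrow> c powr (- \<alpha>)) at_top"
proof -
  obtain x0 where x0: "\<And>x. x \<ge> x0 \<Longrightarrow> f x > 0" using f(1) by (auto simp: regularly_varying_def)
  show pos: "f x > 0" for x
    using x0[of "max x x0"] antimonoD[OF f(2), of x "max x x0"] by simp
  have lim: "((\<lambda>x. f (t * x) / f x) \<longlongrightarrow> t powr (- \<alpha>)) at_top" if "t > 0" for t
    using f(1) that by (auto simp: regularly_varying_def)
  show "((\<lambda>x. f (c * x) / f x) \<longlongrightarrow> c powr (- \<alpha>)) at_top" by (rule lim[OF c])
  have top: "filterlim (\<lambda>x. c * x) at_top at_top"
    by (rule filterlim_tendsto_pos_mult_at_top[OF tendsto_const c filterlim_ident])
  have "((\<lambda>x. f (t * (c * x)) / f (c * x)) \<longlongrightarrow> t powr (- \<alpha>)) at_top" if "t > 0" for t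
    by (rule filterlim_compose[OF lim[OF that] top])
  then show "regular_tail (\<lambda>x. f (c * x)) \<alpha>"
    using pos f(2,3) c by (auto simp: regular_tail_def antimono_def mult_ac)
qed

lemma gumbel_tail_of_MDA:
  assumes "MDA_Gumbel F w"
  shows "gumbel_tail (tail F) w" "scaling_function w"
proof -
  have F: "distribution_function F" "right_endpoint F = \<infinity>" using assms by (auto simp: MDA_Gumbel_def)
  show "gumbel_tail (tail F) w"
    using assms tail_antimono[OF F(1)] tail_positive[OF F] tail_le_1[OF F(1)]
    by (auto simp: MDA_Gumbel_def gumbel_tail_def)
  show "scaling_function w" using assms by (auto simp: MDA_Gumbel_def scaling_function_def)
qed

text \<open>
The accumulation factor of the portfolio over period $i$ when the stock returns $y_i$.
\<close>
definition growth :: "(nat \<Rightarrow> real) \<Rightarrow> (nat \<Rightarrow> real) \<Rightarrow> (nat \<Rightarrow> real) \<Rightarrow> nat \<Rightarrow> real" where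
  "growth \<delta> \<pi> y i = (1 - \<pi> i) * (1 + \<delta> i) + \<pi> i * (1 + y i)"

text \<open>
Discounting with the random portfolio growth turns wealth into the initial capital minus a randomly
weighted sum of net losses, so that ruin is a level crossing.
\<close>
lemma discounted_wealth:
  assumes "\<And>i. i \<in> {1..k} \<Longrightarrow> growth \<delta> \<pi> (\<lambda>i. \<Delta> i \<omega>) i > 0"
  shows "wealth \<delta> \<pi> \<Delta> Z u k \<omega> * (\<Prod>j=1..k. 1 / growth \<delta> \<pi> (\<lambda>i. \<Delta> i \<omega>) j) =
     u - (\<Sum>i=1..k. (\<Prod>j=1..i. 1 / growth \<delta> \<pi> (\<lambda>i. \<Delta> i \<omega>) j) * - Z i \<omega>)"
  using assms
proof (induction k)
  case (Suc k)
  let ?R = "growth \<delta> \<pi> (\<lambda>i. \<Delta> i \<omega>)"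
  let ?D = "\<lambda>k. \<Prod>j=1..k. 1 / ?R j"
  have R: "?R (Suc k) > 0" using Suc.prems by simp
  have "wealth \<delta> \<pi> \<Delta> Z u (Suc k) \<omega> * ?D (Suc k) =
      (?R (Suc k) * wealth \<delta> \<pi> \<Delta> Z u k \<omega> + Z (Suc k) \<omega>) * (?D k * (1 / ?R (Suc k)))"
    by (simp add: growth_def)
  also have "\<dots> = wealth \<delta> \<pi> \<Delta> Z u k \<omega> * ?D k + ?D (Suc k) * Z (Suc k) \<omega>"
    using R by (simp add: field_simps)
  also have "wealth \<delta> \<pi> \<Delta> Z u k \<omega> * ?D k = u - (\<Sum>i=1..k. ?D i * - Z i \<omega>)"
    using Suc by simp
  finally show ?case by simp
qed simp

theorem theorem4p1:
  fixes M :: "'a measure"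
    and Z \<Delta> :: "nat \<Rightarrow> 'a \<Rightarrow> real"
    and \<delta> \<pi> \<alpha> :: "nat \<Rightarrow> real"
    and F w :: "real \<Rightarrow> real"
    and n :: nat
  assumes "prob_space M"
    and Z_indep: "prob_space.indep_vars M (\<lambda>_. borel) Z {1..}"
    and Z_ident: "\<And>i. i \<ge> 1 \<Longrightarrow> distr M borel (Z i) = distr M borel (Z 1)"
    and Delta_indep: "prob_space.indep_vars M (\<lambda>_. borel) \<Delta> {1..}"
    and Delta_range: "\<And>i \<omega>. i \<ge> 1 \<Longrightarrow> \<omega> \<in> space M \<Longrightarrow> \<Delta> i \<omega> \<in> {-1<..}"
    and Z_Delta_indep: "prob_space.indep_var M
          (PiM {1..} (\<lambda>_. borel)) (\<lambda>\<omega>. \<lambda>i\<in>{1..}. Z i \<omega>)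
          (PiM {1..} (\<lambda>_. borel)) (\<lambda>\<omega>. \<lambda>i\<in>{1..}. \<Delta> i \<omega>)"
    and delta_pos: "\<And>i. i \<ge> 1 \<Longrightarrow> \<delta> i > 0"
    and pi_range: "\<And>i. i \<ge> 1 \<Longrightarrow> \<pi> i \<in> {0..<1}"
    and pi_pos: "\<And>i. i \<in> {1..n} \<Longrightarrow> \<pi> i > 0"
    and F_def: "\<And>i. i \<ge> 1 \<Longrightarrow> F = cdf (distr M borel (\<lambda>\<omega>. - Z i \<omega>))"
    and n_ge_1: "n \<ge> 1"
    and F_subexp: "subexponential F"
    and F_MDA: "MDA_Gumbel F w"
    and alpha_nonneg: "\<And>i. i \<in> {1..n} \<Longrightarrow> \<alpha> i \<ge> 0"
    and Upsilon_rv: "\<And>i. i \<in> {1..n} \<Longrightarrow>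
          regularly_varying (\<lambda>u. \<P>(\<omega> in M. inverse_return \<Delta> i \<omega> > u)) (- \<alpha> i)"
  shows "(\<lambda>u. ruin_prob M \<delta> \<pi> \<Delta> Z u n) \<sim>[at_top]
         (\<lambda>u. \<Sum>k=1..n. tail F (bond_value \<delta> \<pi> u k) *
                (\<Prod>i=1..k. Gamma (\<alpha> i + 1) / (\<pi> i * bond_discount \<delta> \<pi> i) powr \<alpha> i *
                   \<P>(\<omega> in M. inverse_return \<Delta> i \<omega> > bond_value \<delta> \<pi> u k * w (bond_value \<delta> \<pi> u k))))"
proof -
  interpret prob_space M by fact
  define X where "X i \<omega> = - Z i \<omega>" for i \<omega>
  define \<mu> where "\<mu> = distr M borel (X 1)"
  have Z_measurable: "random_variable borel (Z i)" if "i \<ge> 1" for i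
    using Z_indep that by (auto simp: indep_vars_def)
  have Delta_measurable: "random_variable borel (\<Delta> i)" if "i \<ge> 1" for i
    using Delta_indep that by (auto simp: indep_vars_def)
  interpret subexponential_iid M X \<mu> F
  proof
    show "indep_vars (\<lambda>_. borel) X {1..}"
      unfolding X_def by (rule indep_vars_compose2[OF Z_indep]) measurable
    show "distr M borel (X i) = \<mu>" if i: "i \<ge> 1" for i
    proof -
      have "distr M borel (X i) = distr (distr M borel (Z i)) borel uminus" if "i \<ge> 1" for i
        using Z_measurable[OF that] by (subst distr_distr) (auto simp: o_def X_def[abs_def])
      then show ?thesis using Z_ident[OF i] i by (simp add: \<mu>_def)
    qed
    show "F = cdf \<mu>" using F_def[of 1] by (simp add: \<mu>_def X_def[abs_def])
  qed (rule F_subexp)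
  define a where "a i = (1 - \<pi> i) * (1 + \<delta> i)" for i
  have a: "a i > 0" if "i \<ge> 1" for i
    using pi_range[OF that] delta_pos[OF that] by (auto simp: a_def)
  have bond_value: "bond_value \<delta> \<pi> u k = u * (\<Prod>i=1..k. a i)" for u k
    by (simp add: bond_value_def bond_discount_def a_def)
  define Y where "Y \<omega> = (\<lambda>i\<in>{1..}. \<Delta> i \<omega>)" for \<omega>
  define \<theta> where "\<theta> k y = (\<Prod>i=1..k. 1 / growth \<delta> \<pi> y i)" for k y
  \<comment> \<open>a common bound for all partial products, also when some \<open>a i\<close> exceed 1\<close>
  define b where "b = (\<Prod>i=1..n. max 1 (1 / a i))"
  have growth_Y: "growth \<delta> \<pi> (Y \<omega>) i = growth \<delta> \<pi> (\<lambda>i. \<Delta> i \<omega>) i" if "i \<ge> 1" for i \<omega>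
    using that by (simp add: growth_def Y_def)
  have \<theta>_Y: "\<theta> k (Y \<omega>) = (\<Prod>i=1..k. 1 / growth \<delta> \<pi> (\<lambda>i. \<Delta> i \<omega>) i)" for k \<omega>
    unfolding \<theta>_def by (rule prod.cong) (auto simp: growth_Y)
  have growth_ge: "growth \<delta> \<pi> (\<lambda>i. \<Delta> i \<omega>) i \<ge> a i" if "i \<ge> 1" "\<omega> \<in> space M" for i \<omega>
    using Delta_range[OF that] pi_range[OF that(1)] by (simp add: growth_def a_def)
  have growth_pos: "growth \<delta> \<pi> (\<lambda>i. \<Delta> i \<omega>) i > 0" if "i \<ge> 1" "\<omega> \<in> space M" for i \<omega>
    using growth_ge[OF that] a[OF that(1)] by linarith
  interpret weighted_claims M X \<mu> F "Pi\<^sub>M {1..} (\<lambda>_. borel)" Y \<theta> b n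
  proof
    have "indep_var (Pi\<^sub>M {1..} (\<lambda>_. borel)) ((\<lambda>z. \<lambda>i\<in>{1..}. - z i) \<circ> (\<lambda>\<omega>. \<lambda>i\<in>{1..}. Z i \<omega>))
        (Pi\<^sub>M {1..} (\<lambda>_. borel)) ((\<lambda>y. y) \<circ> (\<lambda>\<omega>. \<lambda>i\<in>{1..}. \<Delta> i \<omega>))"
      by (rule indep_var_compose[OF Z_Delta_indep]) (auto intro!: measurable_restrict borel_measurable_uminus measurable_component_singleton)
    moreover have "(\<lambda>z. \<lambda>i\<in>{1..}. - z i) \<circ> (\<lambda>\<omega>. \<lambda>i\<in>{1..}. Z i \<omega>) = (\<lambda>\<omega>. \<lambda>i\<in>{1..}. X i \<omega>)"
      by (auto simp: fun_eq_iff X_def restrict_def)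
    ultimately show "indep_var (Pi\<^sub>M {1..} (\<lambda>_. borel)) (\<lambda>\<omega>. \<lambda>i\<in>{1..}. X i \<omega>) (Pi\<^sub>M {1..} (\<lambda>_. borel)) Y"
      by (simp add: o_def Y_def[abs_def])
    show "\<theta> k \<in> borel_measurable (Pi\<^sub>M {1..} (\<lambda>_. borel))" for k
    proof -
      have [measurable]: "(\<lambda>y. y i) \<in> borel_measurable (Pi\<^sub>M {1..} (\<lambda>_. borel))" if "i \<in> {1..k}" for i
        using that by (intro measurable_component_singleton) auto
      show ?thesis unfolding \<theta>_def growth_def by measurable
    qed
    fix k \<omega> assume k: "k \<in> {1..n}" and \<omega>: "\<omega> \<in> space M"
    have "\<theta> k (Y \<omega>) > 0" unfolding \<theta>_Y using growth_pos[OF _ \<omega>] by (intro prod_pos) auto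
    moreover have "\<theta> k (Y \<omega>) \<le> b"
    proof -
      have "\<theta> k (Y \<omega>) \<le> (\<Prod>i=1..k. max 1 (1 / a i))"
        unfolding \<theta>_Y
      proof (rule prod_mono)
        fix i assume "i \<in> {1..k}"
        then have i: "i \<ge> 1" by simp
        have "1 / growth \<delta> \<pi> (\<lambda>i. \<Delta> i \<omega>) i \<le> 1 / a i"
          using growth_ge[OF i \<omega>] a[OF i] by (intro divide_left_mono) auto
        then show "0 \<le> 1 / growth \<delta> \<pi> (\<lambda>i. \<Delta> i \<omega>) i \<and> 1 / growth \<delta> \<pi> (\<lambda>i. \<Delta> i \<omega>) i \<le> max 1 (1 / a i)"
          using growth_pos[OF i \<omega>] by simp
      qed
      also have "\<dots> \<le> b" unfolding b_def using k by (intro prod_mono2) auto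
      finally show ?thesis .
    qed
    ultimately show "0 < \<theta> k (Y \<omega>) \<and> \<theta> k (Y \<omega>) \<le> b" ..
  qed (rule n_ge_1)

  have ruin: "ruin_prob M \<delta> \<pi> \<Delta> Z u n = crossing_prob u" if u: "u \<ge> 0" for u
  proof -
    have neg: "wealth \<delta> \<pi> \<Delta> Z u k \<omega> < 0 \<longleftrightarrow> (\<Sum>i=1..k. \<theta> i (Y \<omega>) * X i \<omega>) > u" if \<omega>: "\<omega> \<in> space M" for k \<omega>
    proof -
      have "\<theta> k (Y \<omega>) > 0" unfolding \<theta>_Y using growth_pos[OF _ \<omega>] by (intro prod_pos) auto
      moreover have "wealth \<delta> \<pi> \<Delta> Z u k \<omega> * \<theta> k (Y \<omega>) = u - (\<Sum>i=1..k. \<theta> i (Y \<omega>) * X i \<omega>)"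
        unfolding \<theta>_Y X_def by (rule discounted_wealth) (use growth_pos[OF _ \<omega>] in auto)
      ultimately show ?thesis by (metis diff_less_0_iff_less mult_less_0_iff order_less_asym)
    qed
    have "Min ((\<lambda>i. wealth \<delta> \<pi> \<Delta> Z u i \<omega>) ` {0..n}) < 0 \<longleftrightarrow> (\<exists>k\<in>{1..n}. (\<Sum>i=1..k. \<theta> i (Y \<omega>) * X i \<omega>) > u)"
      if \<omega>: "\<omega> \<in> space M" for \<omega>
    proof -
      have "Min ((\<lambda>i. wealth \<delta> \<pi> \<Delta> Z u i \<omega>) ` {0..n}) < 0 \<longleftrightarrow> (\<exists>k\<in>{0..n}. wealth \<delta> \<pi> \<Delta> Z u k \<omega> < 0)"
        by (subst Min_less_iff) auto
      also have "\<dots> \<longleftrightarrow> (\<exists>k\<in>{1..n}. wealth \<delta> \<pi> \<Delta> Z u k \<omega> < 0)"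
      proof -
        have "{0..n} = insert 0 {1..n}" by auto
        then show ?thesis using u by simp
      qed
      finally show ?thesis by (simp only: neg[OF \<omega>])
    qed
    then have "{\<omega> \<in> space M. Min ((\<lambda>i. wealth \<delta> \<pi> \<Delta> Z u i \<omega>) ` {0..n}) < 0} =
        {\<omega> \<in> space M. \<exists>k\<in>{1..n}. (\<Sum>i=1..k. \<theta> i (Y \<omega>) * X i \<omega>) > u}" by blast
    then show ?thesis unfolding ruin_prob_def crossing_prob_def by (rule arg_cong)
  qed

  define \<kappa> where "\<kappa> i = \<pi> i * bond_discount \<delta> \<pi> i" for i
  have \<kappa>_eq: "\<kappa> i = \<pi> i / a i" for i by (simp add: \<kappa>_def bond_discount_def a_def)
  have \<kappa>: "\<kappa> i > 0" if "i \<in> {1..n}" for i using a[of i] pi_pos[OF that] that by (simp add: \<kappa>_eq)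
  \<comment> \<open>the growth of the portfolio in period \<open>i\<close> is \<open>a i * (1 + W i)\<close>: the return of the stock is a relative perturbation of that of the bond\<close>
  define W where "W i \<omega> = \<kappa> i * (1 + \<Delta> i \<omega>)" for i \<omega>
  define f where "f i x = prob {\<omega> \<in> space M. inverse_return \<Delta> i \<omega> > x}" for i x
  have f_antimono: "antimono (f i)" if i: "i \<in> {1..n}" for i
  proof (rule antimonoI)
    fix x y :: real assume "x \<le> y"
    have [measurable]: "random_variable borel (\<Delta> i)" using i by (intro Delta_measurable) auto
    show "f i y \<le> f i x" unfolding f_def inverse_return_def
      using \<open>x \<le> y\<close> by (intro finite_measure_mono) auto
  qed
  have f_le_1: "f i x \<le> 1" for i x by (simp add: f_def)
  have f_rv: "regularly_varying (f i) (- \<alpha> i)" if "i \<in> {1..n}" for i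
    using Upsilon_rv[OF that] by (simp add: f_def[abs_def])
  note f_facts = regular_tail_dilated[OF f_rv f_antimono f_le_1 \<kappa>]
  have W_regular: "small_value_regular M (W i) (\<lambda>q. f i (\<kappa> i * q)) (\<alpha> i)" if i: "i \<in> {1..n}" for i
  proof
    have i1: "i \<ge> 1" using i by simp
    note [measurable] = Delta_measurable[OF i1]
    show "random_variable borel (W i)" unfolding W_def by measurable
    have D: "1 + \<Delta> i \<omega> > 0" if "\<omega> \<in> space M" for \<omega> using Delta_range[OF i1 that] by simp
    show "W i \<omega> > 0" if "\<omega> \<in> space M" for \<omega> using D[OF that] \<kappa>[OF i] by (simp add: W_def)
    show "f i (\<kappa> i * q) = prob {\<omega> \<in> space M. W i \<omega> < 1 / q}" if q: "q > 0" for q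
    proof -
      have "inverse_return \<Delta> i \<omega> > \<kappa> i * q \<longleftrightarrow> W i \<omega> < 1 / q" if "\<omega> \<in> space M" for \<omega>
        using D[OF that] \<kappa>[OF i] q by (simp add: inverse_return_def W_def pos_less_divide_eq mult_ac)
      then have "{\<omega> \<in> space M. inverse_return \<Delta> i \<omega> > \<kappa> i * q} = {\<omega> \<in> space M. W i \<omega> < 1 / q}" by blast
      then show ?thesis by (simp add: f_def)
    qed
    show "regular_tail (\<lambda>q. f i (\<kappa> i * q)) (\<alpha> i)" by (rule f_facts(1)[OF i i i])
    show "\<alpha> i \<ge> 0" by (rule alpha_nonneg[OF i])
  qed
  have W_indep: "indep_vars (\<lambda>_. borel) W {1..n}"
    unfolding W_def by (rule indep_vars_compose2[OF indep_vars_subset[OF Delta_indep]]) auto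

  let ?C = "compound (tail F) W"
  note Fw = gumbel_tail_of_MDA[OF F_MDA]
  have C_gumbel: "gumbel_tail (?C k) w"
    and C_lim: "((\<lambda>x. ?C k x / (tail F x * (\<Prod>i=1..k. f i (\<kappa> i * (x * w x))))) \<longlongrightarrow> (\<Prod>i=1..k. Gamma (\<alpha> i + 1))) at_top"
    if "k \<in> {1..n}" for k
    using compound_asymptotics[OF W_indep W_regular Fw, of k] that by auto
  \<comment> \<open>a claim of period \<open>k\<close> must exceed \<open>u\<close> accumulated to that period\<close>
  have jump: "jump_prob k u = ?C k (bond_value \<delta> \<pi> u k)" for k u
    unfolding jump_prob_def compound_def
  proof (rule Bochner_Integration.integral_cong[OF refl])
    fix \<omega> assume \<omega>: "\<omega> \<in> space M"
    have "u / \<theta> k (Y \<omega>) = u * (\<Prod>i=1..k. growth \<delta> \<pi> (\<lambda>i. \<Delta> i \<omega>) i)"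
      by (simp add: \<theta>_Y prod_dividef)
    also have "(\<Prod>i=1..k. growth \<delta> \<pi> (\<lambda>i. \<Delta> i \<omega>) i) = (\<Prod>i=1..k. a i * (1 + W i \<omega>))"
    proof (rule prod.cong[OF refl])
      fix i assume "i \<in> {1..k}"
      then show "growth \<delta> \<pi> (\<lambda>i. \<Delta> i \<omega>) i = a i * (1 + W i \<omega>)"
        using a[of i] unfolding growth_def a_def[symmetric] W_def \<kappa>_eq by (simp add: distrib_left)
    qed
    finally show "tail F (u / \<theta> k (Y \<omega>)) = tail F (bond_value \<delta> \<pi> u k * (\<Prod>i=1..k. 1 + W i \<omega>))"
      by (simp add: bond_value prod.distrib mult.assoc)
  qed
  have bond_top: "filterlim (\<lambda>u. bond_value \<delta> \<pi> u k) at_top at_top" for k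
  proof -
    have "(\<Prod>i=1..k. a i) > 0" using a by (intro prod_pos) auto
    from filterlim_tendsto_pos_mult_at_top[OF tendsto_const this filterlim_ident]
    show ?thesis by (simp add: bond_value mult.commute)
  qed
  have w0: "(w \<longlongrightarrow> 0) at_top" by (rule scaling_tendsto_0[OF Fw F_tail_long_tailed])
  have J_long: "long_tailed (jump_prob k)" if k: "k \<in> {1..n}" for k
  proof -
    have "long_tailed (?C k)" by (rule gumbel_tail_long_tailed[OF C_gumbel[OF k] Fw(2) w0])
    then have "((\<lambda>x. ?C k (x + c) / ?C k x) \<longlongrightarrow> 1) at_top" for c by (simp add: long_tailed_def)
    then have "((\<lambda>u. ?C k (bond_value \<delta> \<pi> u k + c) / ?C k (bond_value \<delta> \<pi> u k)) \<longlongrightarrow> 1) at_top" for c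
      by (rule filterlim_compose[OF _ bond_top])
    from this[of "bond_value \<delta> \<pi> c k" for c] show ?thesis
      by (simp add: long_tailed_def jump bond_value distrib_right)
  qed

  define t where "t k u = tail F (bond_value \<delta> \<pi> u k) *
      (\<Prod>i=1..k. Gamma (\<alpha> i + 1) / \<kappa> i powr \<alpha> i * f i (bond_value \<delta> \<pi> u k * w (bond_value \<delta> \<pi> u k)))" for k u
  have Gamma_pos: "Gamma (\<alpha> i + 1) > 0" if "i \<in> {1..n}" for i
    using alpha_nonneg[OF that] by (intro Gamma_real_pos) simp
  have f_pos: "f i x > 0" if "i \<in> {1..n}" for i x using f_facts(2)[OF that that that] .
  have t_pos: "t k u > 0" if "k \<in> {1..n}" for k u
    unfolding t_def
  proof (intro mult_pos_pos F_tail_pos prod_pos ballI)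
    fix i assume "i \<in> {1..k}"
    then have i: "i \<in> {1..n}" using that by auto
    show "Gamma (\<alpha> i + 1) / \<kappa> i powr \<alpha> i > 0" using Gamma_pos[OF i] \<kappa>[OF i] by simp
    show "f i x > 0" for x by (rule f_pos[OF i])
  qed
  have ratio: "((\<lambda>u. jump_prob k u / t k u) \<longlongrightarrow> 1) at_top" if k: "k \<in> {1..n}" for k
  proof -
    let ?q = "\<lambda>x. x * w x"
    let ?s = "\<lambda>x. tail F x * (\<Prod>i=1..k. Gamma (\<alpha> i + 1) / \<kappa> i powr \<alpha> i * f i (?q x))"
    let ?c = "\<lambda>i. Gamma (\<alpha> i + 1) / \<kappa> i powr \<alpha> i"
    have in_n: "i \<in> {1..n}" if "i \<in> {1..k}" for i using that k by auto
    have "?c i > 0" if "i \<in> {1..k}" for i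
      using Gamma_pos[OF in_n[OF that]] \<kappa>[OF in_n[OF that]] by simp
    then have c_pos: "(\<Prod>i=1..k. ?c i) > 0" by (intro prod_pos ballI)
    have "((\<lambda>x. (?C k x / (tail F x * (\<Prod>i=1..k. f i (\<kappa> i * ?q x)))) *
        (\<Prod>i=1..k. f i (\<kappa> i * ?q x) / f i (?q x)) / (\<Prod>i=1..k. ?c i)) \<longlongrightarrow>
        (\<Prod>i=1..k. Gamma (\<alpha> i + 1)) * (\<Prod>i=1..k. \<kappa> i powr (- \<alpha> i)) / (\<Prod>i=1..k. ?c i)) at_top"
    proof (intro tendsto_divide tendsto_mult tendsto_prod tendsto_const C_lim[OF k])
      show "((\<lambda>x. f i (\<kappa> i * ?q x) / f i (?q x)) \<longlongrightarrow> \<kappa> i powr (- \<alpha> i)) at_top" if "i \<in> {1..k}" for i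
        using in_n[OF that] by (intro filterlim_compose[OF f_facts(3) scaling_functionD(2)[OF Fw(2)]])
      show "\<kappa> i powr \<alpha> i \<noteq> 0" if "i \<in> {1..k}" for i using \<kappa>[OF in_n[OF that]] by simp
      show "(\<Prod>i=1..k. ?c i) \<noteq> 0" by (rule less_imp_neq[OF c_pos, symmetric])
    qed
    also have "(\<Prod>i=1..k. Gamma (\<alpha> i + 1)) * (\<Prod>i=1..k. \<kappa> i powr (- \<alpha> i)) / (\<Prod>i=1..k. ?c i) = 1"
    proof -
      have prod_eq: "(\<Prod>i=1..k. Gamma (\<alpha> i + 1)) * (\<Prod>i=1..k. \<kappa> i powr (- \<alpha> i)) = (\<Prod>i=1..k. ?c i)"
        by (simp add: powr_minus divide_inverse prod.distrib)
      show ?thesis unfolding prod_eq by (rule divide_self[OF less_imp_neq[OF c_pos, symmetric]])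
    qed
    also have "(\<lambda>x. (?C k x / (tail F x * (\<Prod>i=1..k. f i (\<kappa> i * ?q x)))) *
        (\<Prod>i=1..k. f i (\<kappa> i * ?q x) / f i (?q x)) / (\<Prod>i=1..k. ?c i)) = (\<lambda>x. ?C k x / ?s x)"
    proof
      fix x
      have "(\<Prod>i=1..k. f i (\<kappa> i * ?q x)) > 0" using f_pos in_n by (intro prod_pos) auto
      have cancel: "(h / (b * d)) * (d / e) / c = h / (b * (c * e))" if "d > 0" for h b c d e :: real
        using that by simp
      show "(?C k x / (tail F x * (\<Prod>i=1..k. f i (\<kappa> i * ?q x)))) *
        (\<Prod>i=1..k. f i (\<kappa> i * ?q x) / f i (?q x)) / (\<Prod>i=1..k. ?c i) = ?C k x / ?s x"
        unfolding prod_dividef[of "\<lambda>i. f i (\<kappa> i * ?q x)"] prod.distrib by (rule cancel) fact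
    qed
    finally have "((\<lambda>x. ?C k x / ?s x) \<longlongrightarrow> 1) at_top" .
    from filterlim_compose[OF this bond_top[of k]] show ?thesis by (simp add: jump t_def)
  qed

  have "((\<lambda>u. (crossing_prob u / (\<Sum>k=1..n. jump_prob k u)) * ((\<Sum>k=1..n. jump_prob k u) / (\<Sum>k=1..n. t k u))) \<longlongrightarrow> 1 * 1) at_top"
    using n_ge_1 t_pos ratio J_long
    by (intro tendsto_mult crossing_prob_asymptotics sum_ratio_tendsto_1) auto
  moreover have "eventually (\<lambda>u. (crossing_prob u / (\<Sum>k=1..n. jump_prob k u)) * ((\<Sum>k=1..n. jump_prob k u) / (\<Sum>k=1..n. t k u)) =
      ruin_prob M \<delta> \<pi> \<Delta> Z u n / (\<Sum>k=1..n. t k u)) at_top"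
    using eventually_ge_at_top[of 0]
  proof eventually_elim
    case (elim u)
    have "(\<Sum>k=1..n. jump_prob k u) > 0" using n_ge_1 jump_prob_pos by (intro sum_pos) auto
    then show ?case using ruin[OF elim] by simp
  qed
  ultimately have "((\<lambda>u. ruin_prob M \<delta> \<pi> \<Delta> Z u n / (\<Sum>k=1..n. t k u)) \<longlongrightarrow> 1) at_top"
    by (simp add: Lim_transform_eventually)
  then have "(\<lambda>u. ruin_prob M \<delta> \<pi> \<Delta> Z u n) \<sim>[at_top] (\<lambda>u. \<Sum>k=1..n. t k u)" by (rule asymp_equivI')
  then show ?thesis by (simp only: t_def \<kappa>_def f_def)
qed

end
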